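(* Let $1<p<q<n$, let $\Omega\subset\mathbb R^n$ be a bounded domain, and assume that $\frac qp<1+\frac1n$, that $\partial\Omega$ is Lipschitz continuous and that $a:\overline\Omega\to[0,\infty)$ is Lipschitz continuous. Let $((p_h,q_h))_{h\in\mathbb N}\subset\mathbb R^2$ satisfy $(p_h,q_h)\searrow(p,q)$ as $h\to\infty$. Put $\mathcal H_h(x,t)=t^{p_h}+a(x)t^{q_h}$ and $\mathcal H(x,t)=t^p+a(x)t^q$. Then $$\lim_{h\to\infty}\lambda^m_{\mathcal H_h}=\lambda^m_{\mathcal H}\qquad\text{for every }m\ge1.$$
   Context: $(p_h,q_h)\searrow(p,q)$ means: $q_1<n$, $p_h<q_h$ for all $h$, and $(p_h)$, $(q_h)$ are non-increasing sequences converging to $p$ and $q$ respectively. For $\mathcal G(x,t)=t^r+a(x)t^s$ with $1<r<s<n$: for measurable $u:\Omega\to\mathbb R$ put $\varrho_{\mathcal G}(u)=\int_\Omega(|u|^r+a(x)|u|^s)\,dx$; $L^{\mathcal G}(\Omega)$ consists of measurable $u$ with $\varrho_{\mathcal G}(u)<\infty$, with norm $\|u\|_{\mathcal G}=\inf\{\gamma>0:\varrho_{\mathcal G}(u/\gamma)\le1\}$; $W^{1,\mathcal G}(\Omega)$ is the set of $u\in L^{\mathcal G}(\Omega)$ with $|\nabla u|\in L^{\mathcal G}(\Omega)$, with norm $\|u\|_{\mathcal G}+\|\nabla u\|_{\mathcal G}$, where $\|\nabla u\|_{\mathcal G}:=\|\,|\nabla u|\,\|_{\mathcal G}$; $W^{1,\mathcal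 G}_0(\Omega)$ is the completion (closure) of $C^\infty_0(\Omega)$ in $W^{1,\mathcal G}(\Omega)$. The $m$-th variational eigenvalue is $$\lambda^m_{\mathcal G}:=\inf_{K\in\mathcal W^m_{\mathcal G}}\ \sup_{u\in K}\|\nabla u\|_{\mathcal G},$$ where $\mathcal W^m_{\mathcal G}$ is the set of compact subsets $K$ of $\{u\in W^{1,\mathcal G}_0(\Omega):\|u\|_{\mathcal G}=1\}$ that are symmetric ($K=-K$) and have $i(K)\ge m$. Here $i$ is the Krasnosel'skii genus ($\gamma(A)=\inf\{k\in\mathbb N:\exists$ a continuous odd map $A\to\mathbb S^{k-1}\}$, $+\infty$ if there is none) or any topological index satisfying: $(i_1)$ if $X$ is a topological vector space and $K\subseteq X\setminus\{0\}$ is compact, symmetric and nonempty, $i(K)$ is an integer greater than or equal to $1$; $(i_2)$ if $X$ is a topological vector space and $K\subseteq X\setminus\{0\}$ is compact, symmetric and nonempty, then there exists an open subset $U$ of $X\setminus\{0\}$ such that $K\subseteq U$ and $i(\hat K)\le i(K)$ for any compact, symmetric and nonempty $\hat K\subseteq U$; $(i_3)$ if $X,Y$ are topological vector spaces, $K\subseteq X\setminus\{0\}$ is compact, symmetric and nonempty and $\pi:K\to Y\setminus\{0\}$ is continuous and odd, then $i(\pi(K))\ge i(K)$; $(i_4)$ if $(X,\|\cdot\|)$ is a normed space with $1\le\dim X<\infty$, then $i(\{u\in X:\|u\|=1\})=\dim X$. *)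

theory Defs
  imports "HOL-Analysis.Analysis"
begin

section \<open>Functions modulo equality almost everywhere\<close>

text \<open>
  A measurable function on \<open>\<Omega> \<subseteq> \<real>\<^sup>n\<close>, up to equality a.e., is represented by the class of its
  extension by zero. The spaces \<open>L\<^sup>G(\<Omega>)\<close>, \<open>W\<^sup>1\<^sup>,\<^sup>G(\<Omega>)\<close> for all \<open>G\<close> thus are linear
  subspaces of the single real vector space \<open>aefun\<close>, and their topologies are genuinely Hausdorff.
\<close>

quotient_type (overloaded) 'n aefun = "(real ^ 'n::finite) \<Rightarrow> real" /
  "\<lambda>f g. AE x in lebesgue. f x = g x"
  by (rule equivpI) (auto simp: reflp_def symp_def transp_def elim: eventually_mono eventually_elim2)

instantiation aefun :: (finite) real_vector
begin

lift_definition zero_aefun :: "'a aefun" is "\<lambda>_. 0" .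
lift_definition plus_aefun :: "'a aefun \<Rightarrow> 'a aefun \<Rightarrow> 'a aefun" is "\<lambda>f g x. f x + g x"
  subgoal premises prems using prems by eventually_elim simp
  done
lift_definition minus_aefun :: "'a aefun \<Rightarrow> 'a aefun \<Rightarrow> 'a aefun" is "\<lambda>f g x. f x - g x"
  subgoal premises prems using prems by eventually_elim simp
  done
lift_definition uminus_aefun :: "'a aefun \<Rightarrow> 'a aefun" is "\<lambda>f x. - f x"
  by (elim eventually_mono) simp
lift_definition scaleR_aefun :: "real \<Rightarrow> 'a aefun \<Rightarrow> 'a aefun" is "\<lambda>c f x. c *\<^sub>R f x"
  by (elim eventually_mono) simp

instance
proof
  fix f g h :: "'a aefun" and c d :: real
  show "f + g + h = f + (g + h)" by transfer (simp add: algebra_simps)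
  show "f + g = g + f" by transfer (simp add: algebra_simps)
  show "0 + f = f" by transfer simp
  show "- f + f = 0" by transfer simp
  show "f - g = f + - g" by transfer simp
  show "c *\<^sub>R (f + g) = c *\<^sub>R f + c *\<^sub>R g" by transfer (simp add: algebra_simps)
  show "(c + d) *\<^sub>R f = c *\<^sub>R f + d *\<^sub>R f" by transfer (simp add: algebra_simps)
  show "c *\<^sub>R d *\<^sub>R f = (c * d) *\<^sub>R f" by transfer (simp add: algebra_simps)
  show "1 *\<^sub>R f = f" by transfer simp
qed

end

lemma rep_abs_aefun: "AE x in lebesgue. rep_aefun (abs_aefun f) x = f x"
  using Quotient3_rep_abs[OF Quotient3_aefun, where r = f] by simp


section \<open>Lipschitz domains and test functions\<close>

text \<open>
  Near each boundary point, \<open>\<Omega>\<close> is, in suitable orthonormal coordinates, the strict subgraph of a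
  Lipschitz function. The last coordinate is \<open>x \<bullet> \<nu>\<close> and the others are collected in
  the orthogonal projection of \<open>x\<close> to the hyperplane \<open>{y. y \<bullet> \<nu> = 0}\<close>.
\<close>

definition lipschitz_boundary :: "(real ^ 'n) set \<Rightarrow> bool" where
  "lipschitz_boundary \<Omega> \<longleftrightarrow>
     (\<forall>z \<in> frontier \<Omega>. \<exists>r>0. \<exists>\<nu>. \<exists>\<phi>. \<exists>L.
        norm \<nu> = 1 \<and> L-lipschitz_on {y. y \<bullet> \<nu> = 0} \<phi> \<and>
        \<Omega> \<inter> ball z r = {x \<in> ball z r. x \<bullet> \<nu> < \<phi> (x - (x \<bullet> \<nu>) *\<^sub>R \<nu>)})"

definition partial_deriv :: "'n \<Rightarrow> (real ^ 'n \<Rightarrow> real) \<Rightarrow> real ^ 'n \<Rightarrow> real" where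
  "partial_deriv i f = (\<lambda>x. frechet_derivative f (at x) (axis i 1))"

fun C_class :: "nat \<Rightarrow> (real ^ 'n \<Rightarrow> real) \<Rightarrow> bool" where
  "C_class 0 f \<longleftrightarrow> continuous_on UNIV f"
| "C_class (Suc k) f \<longleftrightarrow> (\<forall>x. f differentiable at x) \<and> (\<forall>i. C_class k (partial_deriv i f))"

definition test_functions :: "(real ^ 'n) set \<Rightarrow> (real ^ 'n \<Rightarrow> real) set" where
  "test_functions \<Omega> =
     {\<phi>. (\<forall>k. C_class k \<phi>) \<and> compact (closure {x. \<phi> x \<noteq> 0}) \<and> closure {x. \<phi> x \<noteq> 0} \<subseteq> \<Omega>}"

definition weak_gradient ::
    "(real ^ 'n) set \<Rightarrow> (real ^ 'n \<Rightarrow> real) \<Rightarrow> (real ^ 'n \<Rightarrow> real ^ 'n) \<Rightarrow> bool" where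
  "weak_gradient \<Omega> u g \<longleftrightarrow>
     u \<in> borel_measurable (lebesgue_on \<Omega>) \<and> g \<in> borel_measurable (lebesgue_on \<Omega>) \<and>
     (\<forall>C. compact C \<and> C \<subseteq> \<Omega> \<longrightarrow> integrable (lebesgue_on C) u \<and> integrable (lebesgue_on C) g) \<and>
     (\<forall>\<phi> \<in> test_functions \<Omega>. \<forall>i.
        (\<integral>x. u x * partial_deriv i \<phi> x \<partial>lebesgue_on \<Omega>) = - (\<integral>x. g x $ i * \<phi> x \<partial>lebesgue_on \<Omega>))"


section \<open>Musielak-Orlicz and Musielak-Orlicz-Sobolev spaces\<close>

definition double_phase ::
    "(real ^ 'n \<Rightarrow> real) \<Rightarrow> real \<Rightarrow> real \<Rightarrow> real ^ 'n \<Rightarrow> real \<Rightarrow> real" where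
  "double_phase a r s = (\<lambda>x t. t powr r + a x * t powr s)"

definition modular ::
    "(real ^ 'n) set \<Rightarrow> (real ^ 'n \<Rightarrow> real \<Rightarrow> real) \<Rightarrow> (real ^ 'n \<Rightarrow> real) \<Rightarrow> ennreal" where
  "modular \<Omega> G f = (\<integral>\<^sup>+x. ennreal (G x \<bar>f x\<bar>) \<partial>lebesgue_on \<Omega>)"

definition finite_modular ::
    "(real ^ 'n) set \<Rightarrow> (real ^ 'n \<Rightarrow> real \<Rightarrow> real) \<Rightarrow> (real ^ 'n \<Rightarrow> real) \<Rightarrow> bool" where
  "finite_modular \<Omega> G f \<longleftrightarrow> f \<in> borel_measurable (lebesgue_on \<Omega>) \<and> modular \<Omega> G f < \<infinity>"

definition luxemburg ::
    "(real ^ 'n) set \<Rightarrow> (real ^ 'n \<Rightarrow> real \<Rightarrow> real) \<Rightarrow> (real ^ 'n \<Rightarrow> real) \<Rightarrow> real" where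
  "luxemburg \<Omega> G f = Inf {\<gamma>. 0 < \<gamma> \<and> modular \<Omega> G (\<lambda>x. f x / \<gamma>) \<le> 1}"

definition L_space ::
    "(real ^ 'n) set \<Rightarrow> (real ^ 'n \<Rightarrow> real \<Rightarrow> real) \<Rightarrow> 'n aefun set" where
  "L_space \<Omega> G = {u. finite_modular \<Omega> G (rep_aefun u) \<and> (AE x in lebesgue. x \<notin> \<Omega> \<longrightarrow> rep_aefun u x = 0)}"

definition L_norm ::
    "(real ^ 'n) set \<Rightarrow> (real ^ 'n \<Rightarrow> real \<Rightarrow> real) \<Rightarrow> 'n aefun \<Rightarrow> real" where
  "L_norm \<Omega> G u = luxemburg \<Omega> G (rep_aefun u)"

text \<open>The weak gradient on \<open>\<Omega>\<close> is unique up to equality a.e. on \<open>\<Omega>\<close>.\<close>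

definition grad :: "(real ^ 'n) set \<Rightarrow> 'n aefun \<Rightarrow> real ^ 'n \<Rightarrow> real ^ 'n" where
  "grad \<Omega> u = (SOME g. weak_gradient \<Omega> (rep_aefun u) g)"

definition grad_norm ::
    "(real ^ 'n) set \<Rightarrow> (real ^ 'n \<Rightarrow> real \<Rightarrow> real) \<Rightarrow> 'n aefun \<Rightarrow> real" where
  "grad_norm \<Omega> G u = luxemburg \<Omega> G (\<lambda>x. norm (grad \<Omega> u x))"

definition W1 ::
    "(real ^ 'n) set \<Rightarrow> (real ^ 'n \<Rightarrow> real \<Rightarrow> real) \<Rightarrow> 'n aefun set" where
  "W1 \<Omega> G = {u \<in> L_space \<Omega> G. (\<exists>g. weak_gradient \<Omega> (rep_aefun u) g) \<and>
                             finite_modular \<Omega> G (\<lambda>x. norm (grad \<Omega> u x))}"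

definition W1_norm ::
    "(real ^ 'n) set \<Rightarrow> (real ^ 'n \<Rightarrow> real \<Rightarrow> real) \<Rightarrow> 'n aefun \<Rightarrow> real" where
  "W1_norm \<Omega> G u = L_norm \<Omega> G u + grad_norm \<Omega> G u"

definition norm_on :: "'u::real_vector set \<Rightarrow> ('u \<Rightarrow> real) \<Rightarrow> bool" where
  "norm_on V N \<longleftrightarrow>
     (\<forall>u\<in>V. 0 \<le> N u \<and> (N u = 0 \<longleftrightarrow> u = 0)) \<and>
     (\<forall>u\<in>V. \<forall>c. N (c *\<^sub>R u) = \<bar>c\<bar> * N u) \<and>
     (\<forall>u\<in>V. \<forall>v\<in>V. N (u + v) \<le> N u + N v)"

text \<open>
  The distance is set to \<open>0\<close> outside \<open>V\<close> only because \<^locale>\<open>Metric_space\<close> demands a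
  nonnegative symmetric function on the whole type; points outside \<open>V\<close> do not enter the topology.
\<close>

definition norm_dist :: "'u::real_vector set \<Rightarrow> ('u \<Rightarrow> real) \<Rightarrow> 'u \<Rightarrow> 'u \<Rightarrow> real" where
  "norm_dist V N = (\<lambda>u v. if u \<in> V \<and> v \<in> V then N (u - v) else 0)"

definition norm_topology :: "'u::real_vector set \<Rightarrow> ('u \<Rightarrow> real) \<Rightarrow> 'u topology" where
  "norm_topology V N = Metric_space.mtopology V (norm_dist V N)"

lemma Metric_space_norm_dist:
  assumes V: "subspace V" and N: "norm_on V N"
  shows "Metric_space V (norm_dist V N)"
proof -
  have diff: "u - v \<in> V" if "u \<in> V" "v \<in> V" for u v
    using that V by (simp add: subspace_diff)
  have nonneg: "0 \<le> N u" and zero: "N u = 0 \<longleftrightarrow> u = 0" and hom: "N (c *\<^sub>R u) = \<bar>c\<bar> * N u"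
    if "u \<in> V" for u c
    using N that by (simp_all add: norm_on_def)
  have tri: "N (u + v) \<le> N u + N v" if "u \<in> V" "v \<in> V" for u v
    using N that by (simp add: norm_on_def)
  have comm: "N (u - v) = N (v - u)" if "u \<in> V" "v \<in> V" for u v
    using hom[OF diff[OF that], of "-1"] by simp
  show ?thesis
  proof (unfold_locales, goal_cases)
    case (1 x y)
    show ?case using nonneg[OF diff] by (simp add: norm_dist_def)
  next
    case (2 x y)
    show ?case unfolding norm_dist_def using comm by presburger
  next
    case (3 x y)
    then show ?case using zero[OF diff] by (simp add: norm_dist_def)
  next
    case (4 x y z)
    then show ?case using tri[OF diff diff, of x y y z] by (simp add: norm_dist_def)
  qed
qed

definition W0 ::
    "(real ^ 'n) set \<Rightarrow> (real ^ 'n \<Rightarrow> real \<Rightarrow> real) \<Rightarrow> 'n aefun set" where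
  "W0 \<Omega> G = norm_topology (W1 \<Omega> G) (W1_norm \<Omega> G) closure_of (abs_aefun ` test_functions \<Omega>)"

definition W0_topology ::
    "(real ^ 'n) set \<Rightarrow> (real ^ 'n \<Rightarrow> real \<Rightarrow> real) \<Rightarrow> 'n aefun topology" where
  "W0_topology \<Omega> G = norm_topology (W0 \<Omega> G) (W1_norm \<Omega> G)"


section \<open>Topological indices\<close>

text \<open>
  A real topological vector space is given by its topology; the underlying vector space is the
  subspace \<open>topspace T\<close> of an ambient real vector space. Topological vector spaces are Hausdorff, as
  usual; without this, the axioms of an index below would be contradictory
  (map spheres oddly onto a two-point set in an indiscrete space).
\<close>

definition topological_vector_space :: "'u::real_vector topology \<Rightarrow> bool" where
  "topological_vector_space T \<longleftrightarrow>
     subspace (topspace T) \<and> Hausdorff_space T \<and>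
     continuous_map (prod_topology T T) T (\<lambda>(u, v). u + v) \<and>
     continuous_map (prod_topology euclideanreal T) T (\<lambda>(c, u). c *\<^sub>R u)"

definition index_set :: "'u::real_vector topology \<Rightarrow> 'u set \<Rightarrow> bool" where
  "index_set T K \<longleftrightarrow> compactin T K \<and> 0 \<notin> K \<and> uminus ` K = K \<and> K \<noteq> {}"

text \<open>
  An index assigns a value to a set \<open>K\<close> in a topological vector space \<open>T\<close>. A HOL variable cannot
  range over all topological vector spaces on all types, so only those on subspaces of the ambient
  space \<open>'u\<close> are considered. An index in the usual sense restricts to one of this kind.
\<close>

definition topological_index :: "('u::real_vector topology \<Rightarrow> 'u set \<Rightarrow> enat) \<Rightarrow> bool" where
  "topological_index i \<longleftrightarrow>
     (\<forall>T K. topological_vector_space T \<and> index_set T K \<longrightarrow> (\<exists>k::nat. 1 \<le> k \<and> i T K = enat k)) \<and>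
     (\<forall>T K. topological_vector_space T \<and> index_set T K \<longrightarrow>
        (\<exists>U. openin (subtopology T (topspace T - {0})) U \<and> K \<subseteq> U \<and>
             (\<forall>K'. index_set T K' \<and> K' \<subseteq> U \<longrightarrow> i T K' \<le> i T K))) \<and>
     (\<forall>T S K \<pi>. topological_vector_space T \<and> topological_vector_space S \<and> index_set T K \<and>
        continuous_map (subtopology T K) (subtopology S (topspace S - {0})) \<pi> \<and>
        (\<forall>u\<in>K. \<pi> (- u) = - \<pi> u) \<longrightarrow> i T K \<le> i S (\<pi> ` K)) \<and>
     (\<forall>V N. subspace V \<and> norm_on V N \<and> (\<exists>B. finite B \<and> V = span B) \<and> 1 \<le> dim V \<longrightarrow>
        i (norm_topology V N) {u \<in> V. N u = 1} = enat (dim V))"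

text \<open>\<^term>\<open>nsphere (k - 1)\<close> is the unit sphere of \<open>\<real>\<^sup>k\<close>.\<close>

definition genus :: "'u::real_vector topology \<Rightarrow> 'u set \<Rightarrow> enat" where
  "genus T A = Inf {enat k | k. 1 \<le> k \<and>
     (\<exists>f. continuous_map (subtopology T A) (nsphere (k - 1)) f \<and> (\<forall>u\<in>A. f (- u) = (\<lambda>j. - f u j)))}"


section \<open>Variational eigenvalues\<close>

text \<open>
  The empty set is excluded: it has no meaningful supremum, and the axioms say nothing about its index.
\<close>

definition W_family ::
    "('n aefun topology \<Rightarrow> 'n aefun set \<Rightarrow> enat) \<Rightarrow> (real ^ 'n::finite) set \<Rightarrow>
     (real ^ 'n \<Rightarrow> real \<Rightarrow> real) \<Rightarrow> nat \<Rightarrow> 'n aefun set set" where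
  "W_family i \<Omega> G m =
     {K. K \<subseteq> {u \<in> W0 \<Omega> G. L_norm \<Omega> G u = 1} \<and> compactin (W0_topology \<Omega> G) K \<and>
         uminus ` K = K \<and> K \<noteq> {} \<and> enat m \<le> i (W0_topology \<Omega> G) K}"

definition variational_eigenvalue ::
    "('n aefun topology \<Rightarrow> 'n aefun set \<Rightarrow> enat) \<Rightarrow> (real ^ 'n::finite) set \<Rightarrow>
     (real ^ 'n \<Rightarrow> real \<Rightarrow> real) \<Rightarrow> nat \<Rightarrow> ereal" where
  "variational_eigenvalue i \<Omega> G m = (INF K \<in> W_family i \<Omega> G m. SUP u \<in> K. ereal (grad_norm \<Omega> G u))"

definition exponents_decrease_to ::
    "real \<Rightarrow> (nat \<Rightarrow> real) \<Rightarrow> (nat \<Rightarrow> real) \<Rightarrow> real \<Rightarrow> real \<Rightarrow> bool" where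
  "exponents_decrease_to n ph qh p q \<longleftrightarrow>
     qh 0 < n \<and> (\<forall>h. ph h < qh h) \<and> decseq ph \<and> decseq qh \<and>
     ph \<longlonglongrightarrow> p \<and> qh \<longlonglongrightarrow> q"

end

theory Submission
  imports Defs
begin

text \<open>
  Only the monotonicity of the index under odd continuous maps is used, so it suffices to map
  competitors for one integrand to competitors for another one with almost the same Rayleigh quotient.

  Upper bound: a compact symmetric set \<open>K\<close> for \<open>\<H>\<close> is approximated by an odd finite-rank map
  with values in the span of finitely many test functions. On functions with a common bound for the gradient
  the \<open>\<H>\<^sub>h\<close>-norms of the gradients are eventually almost dominated by the \<open>\<H>\<close>-norms, because
  \<open>t\<^sup>q\<^sup>' \<le> t\<^sup>q + \<theta> t\<^sup>S\<close> with \<open>\<theta> = (q' - q) / (S - q)\<close> for \<open>q \<le> q' \<le> S\<close>.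

  Lower bound: since \<open>\<Omega>\<close> has finite measure and \<open>p \<le> p\<^sub>h\<close>, \<open>q \<le> q\<^sub>h\<close>, Young's inequality embeds the space of
  \<open>\<H>\<^sub>h\<close> into that of \<open>\<H>\<close> with a constant tending to \<open>1\<close>. That the \<open>\<H>\<close>-norm of a normalized function with bounded
  gradient does not drop below \<open>1 - \<epsilon>\<close> follows from the same interpolation and a bound for \<open>\<integral>\<bar>u\<bar>\<^sup>S\<close>
  with some \<open>S > q\<close>. Such an \<open>S\<close> is available as \<open>q < p + p / n \<le> p + p\<^sup>2 / n\<close>, and below the exponent
  \<open>p + p\<^sup>2 / n\<close> the Sobolev inequality is elementary: comparing \<open>u\<close> with its averages over cubes gives
  \<open>\<integral>\<^bsub>\<bar>u\<bar> > l\<^esub> \<bar>u\<bar>\<^sup>p \<le> C l powr (- p\<^sup>2 / n)\<close>, which is summed over dyadic levels \<open>l\<close>.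
\<close>

section \<open>Normed subspaces and topological indices\<close>

text \<open>The obstacle is that the space moves with the exponents: raising them shrinks it, so a
  competitor for the limit integrand may contain functions that are not admissible for the larger
  exponents. Test functions belong to all these spaces at once, and finitely many of them with
  bounded coefficients have one common gradient bound; this is why the competitor is replaced by a
  finite-rank image. In the other direction the inclusion itself is the odd map, and the danger is
  that the smaller-exponent norm of a normalized function collapses. Gradients have no extra
  integrability there, but only the norm of the function has to stay away from zero, and the
  function does gain integrability from its gradient. The number p^2/n arises as follows. Averages
  over cubes of side rho fall below the level l once rho^n l^p exceeds a constant, so rho is of
  order l^(-p/n); the translation estimate then costs rho^p, that is l^(-p^2/n).\<close>

locale normed_subspace =
  fixes V :: "'u::real_vector set" and N :: "'u \<Rightarrow> real"
  assumes subspace_V: "subspace V" and norm_on_V: "norm_on V N"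
begin

sublocale Metric_space V "norm_dist V N"
  by (rule Metric_space_norm_dist[OF subspace_V norm_on_V])

lemma mtopology_eq: "norm_topology V N = mtopology"
  by (simp add: norm_topology_def)

lemma topspace_norm_topology [simp]: "topspace (norm_topology V N) = V"
  by (simp add: mtopology_eq)

lemma
  shows zero_mem: "0 \<in> V"
    and add_mem: "u \<in> V \<Longrightarrow> v \<in> V \<Longrightarrow> u + v \<in> V"
    and diff_mem: "u \<in> V \<Longrightarrow> v \<in> V \<Longrightarrow> u - v \<in> V"
    and neg_mem: "u \<in> V \<Longrightarrow> - u \<in> V"
    and scale_mem: "u \<in> V \<Longrightarrow> c *\<^sub>R u \<in> V"
  using subspace_V by (auto simp: subspace_0 subspace_add subspace_diff subspace_neg subspace_scale)

lemma
  shows N_nonneg: "u \<in> V \<Longrightarrow> 0 \<le> N u"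
    and N_eq_0_iff: "u \<in> V \<Longrightarrow> N u = 0 \<longleftrightarrow> u = 0"
    and N_scaleR: "u \<in> V \<Longrightarrow> N (c *\<^sub>R u) = \<bar>c\<bar> * N u"
    and N_triangle: "u \<in> V \<Longrightarrow> v \<in> V \<Longrightarrow> N (u + v) \<le> N u + N v"
  using norm_on_V by (auto simp: norm_on_def)

lemma N_zero: "N 0 = 0"
  using N_eq_0_iff[OF zero_mem] by simp

lemma N_minus: "u \<in> V \<Longrightarrow> N (- u) = N u"
  using N_scaleR[of u "-1"] by simp

lemma N_commute: "u \<in> V \<Longrightarrow> v \<in> V \<Longrightarrow> N (u - v) = N (v - u)"
  using N_minus[OF diff_mem, of u v] by simp

lemma N_diff_triangle: "u \<in> V \<Longrightarrow> v \<in> V \<Longrightarrow> N (u - v) \<le> N u + N v"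
  using N_triangle[of u "- v"] by (simp add: N_minus neg_mem)

lemma N_abs_diff_le: "u \<in> V \<Longrightarrow> v \<in> V \<Longrightarrow> \<bar>N u - N v\<bar> \<le> N (u - v)"
  using N_triangle[OF diff_mem, of u v v] N_triangle[OF diff_mem, of v u u] N_commute[of u v]
  by auto

lemma N_sum_le: "finite J \<Longrightarrow> (\<And>j. j \<in> J \<Longrightarrow> f j \<in> V) \<Longrightarrow> N (sum f J) \<le> (\<Sum>j\<in>J. N (f j))"
proof (induction J rule: finite_induct)
  case empty
  then show ?case by (simp add: N_zero)
next
  case (insert j J)
  have "N (f j + sum f J) \<le> N (f j) + N (sum f J)"
    using insert by (intro N_triangle) (auto intro: subspace_sum[OF subspace_V])
  with insert show ?case by auto
qed

lemma in_mball_iff: "v \<in> mball u e \<longleftrightarrow> u \<in> V \<and> v \<in> V \<and> N (v - u) < e"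
  unfolding in_mball using N_commute[of u v] by (auto simp: norm_dist_def)

lemma in_closure_of_iff:
  assumes "S \<subseteq> V"
  shows "u \<in> norm_topology V N closure_of S \<longleftrightarrow> u \<in> V \<and> (\<forall>e>0. \<exists>v\<in>S. N (v - u) < e)"
  using assms unfolding mtopology_eq metric_closure_of by (simp del: in_mball add: in_mball_iff) blast

text \<open>The source is an arbitrary topology because addition and scaling start from product
  topologies, which carry no chosen metric.\<close>

lemma continuous_map_intoI:
  assumes "\<And>x. x \<in> topspace X \<Longrightarrow> f x \<in> V"
    and "\<And>x e. x \<in> topspace X \<Longrightarrow> 0 < e \<Longrightarrow> \<exists>U. openin X U \<and> x \<in> U \<and> (\<forall>y\<in>U. N (f y - f x) < e)"
  shows "continuous_map X (norm_topology V N) f"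
  unfolding mtopology_eq continuous_map_to_metric
proof (intro ballI allI impI)
  fix x e assume x: "x \<in> topspace X" and e: "(0::real) < e"
  obtain U where U: "openin X U" "x \<in> U" "\<forall>y\<in>U. N (f y - f x) < e" using assms(2)[OF x e] by auto
  have "f y \<in> mball (f x) e" if "y \<in> U" for y
    using U that openin_subset[OF U(1)] assms(1) x by (auto simp del: in_mball simp: in_mball_iff)
  with U show "\<exists>U. openin X U \<and> x \<in> U \<and> (\<forall>y\<in>U. f y \<in> mball (f x) e)" by blast
qed

lemma openin_ball: "openin (norm_topology V N) {v \<in> V. N (v - u) < e}" if "u \<in> V"
proof -
  have "{v \<in> V. N (v - u) < e} = mball u e" using that by (auto simp del: in_mball simp: in_mball_iff)
  then show ?thesis by (simp add: mtopology_eq)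
qed

text \<open>The axioms of an index speak about topological vector spaces only, so the Sobolev spaces
  have to be recognized as such.\<close>

lemma topological_vector_space_norm_topology: "topological_vector_space (norm_topology V N)"
  unfolding topological_vector_space_def
proof (intro conjI)
  show "subspace (topspace (norm_topology V N))" by (simp add: subspace_V)
  show "Hausdorff_space (norm_topology V N)"
    by (simp add: mtopology_eq Hausdorff_space_mtopology)
  show "continuous_map (prod_topology (norm_topology V N) (norm_topology V N)) (norm_topology V N)
          (\<lambda>(u, v). u + v)"
  proof (rule continuous_map_intoI)
    fix x :: "'u \<times> 'u" and e :: real
    assume x: "x \<in> topspace (prod_topology (norm_topology V N) (norm_topology V N))" and e: "0 < e"
    obtain u v where uv: "x = (u, v)" "u \<in> V" "v \<in> V" using x by (cases x) auto
    define U where "U = {w \<in> V. N (w - u) < e / 2} \<times> {w \<in> V. N (w - v) < e / 2}"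
    have "openin (prod_topology (norm_topology V N) (norm_topology V N)) U"
      unfolding U_def openin_prod_Times_iff using uv openin_ball by blast
    moreover have "x \<in> U" using uv e by (auto simp: U_def N_zero)
    moreover have "N ((case y of (u, v) \<Rightarrow> u + v) - (case x of (u, v) \<Rightarrow> u + v)) < e" if "y \<in> U" for y
    proof -
      obtain a b where ab: "y = (a, b)" by (cases y)
      then have y: "y = (a, b)" "a \<in> V" "b \<in> V" "N (a - u) < e / 2" "N (b - v) < e / 2"
        using that unfolding U_def by auto
      have "N ((a - u) + (b - v)) < e"
        using N_triangle[OF diff_mem diff_mem, of a u b v] y uv by auto
      then show ?thesis using y uv by (simp add: algebra_simps)
    qed
    ultimately show "\<exists>U. openin (prod_topology (norm_topology V N) (norm_topology V N)) U \<and> x \<in> U \<and>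
        (\<forall>y\<in>U. N ((case y of (u, v) \<Rightarrow> u + v) - (case x of (u, v) \<Rightarrow> u + v)) < e)" by blast
  qed (auto intro: add_mem)
  show "continuous_map (prod_topology euclideanreal (norm_topology V N)) (norm_topology V N)
          (\<lambda>(c, u). c *\<^sub>R u)"
  proof (rule continuous_map_intoI)
    fix x :: "real \<times> 'u" and e :: real
    assume x: "x \<in> topspace (prod_topology euclideanreal (norm_topology V N))" and e: "0 < e"
    obtain c u where cu: "x = (c, u)" "u \<in> V" using x by (cases x) auto
    \<comment> \<open>Within distance \<open>d\<close> one has
      \<open>\<bar>b\<bar> \<le> \<bar>c\<bar> + 1\<close>, so both parts of
      \<open>b w - c u = b (w - u) + (b - c) u\<close> together stay below
      \<open>d * (\<bar>c\<bar> + 1 + N u)\<close>.\<close>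
    define d where "d = min 1 (e / (2 * (\<bar>c\<bar> + 1 + N u)))"
    have Nu: "0 \<le> N u" using N_nonneg cu by auto
    have d: "0 < d" "d \<le> 1" "d * (\<bar>c\<bar> + 1 + N u) \<le> e / 2"
    proof -
      have pos: "\<bar>c\<bar> + 1 + N u > 0" using Nu by linarith
      show "0 < d" "d \<le> 1" using pos e by (auto simp: d_def)
      have "d \<le> e / (2 * (\<bar>c\<bar> + 1 + N u))" by (simp add: d_def)
      then show "d * (\<bar>c\<bar> + 1 + N u) \<le> e / 2" using pos by (simp add: field_simps)
    qed
    define U where "U = ball c d \<times> {w \<in> V. N (w - u) < d}"
    have "openin (prod_topology euclideanreal (norm_topology V N)) U"
      unfolding U_def openin_prod_Times_iff using cu openin_ball by auto
    moreover have "x \<in> U" using cu d by (auto simp: U_def N_zero)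
    moreover have "N ((case y of (c, u) \<Rightarrow> c *\<^sub>R u) - (case x of (c, u) \<Rightarrow> c *\<^sub>R u)) < e" if "y \<in> U" for y
    proof -
      obtain b w where bw: "y = (b, w)" by (cases y)
      then have y: "y = (b, w)" "\<bar>b - c\<bar> < d" "w \<in> V" "N (w - u) < d"
        using that unfolding U_def by (auto simp: dist_real_def abs_minus_commute)
      have "N (b *\<^sub>R (w - u) + (b - c) *\<^sub>R u) \<le> \<bar>b\<bar> * N (w - u) + \<bar>b - c\<bar> * N u"
        using N_triangle[of "b *\<^sub>R (w - u)" "(b - c) *\<^sub>R u"] y cu
        by (simp add: N_scaleR diff_mem scale_mem)
      also have "\<dots> \<le> (\<bar>c\<bar> + 1) * d + d * N u"
        using y Nu d N_nonneg[OF diff_mem, of w u] cu by (intro add_mono mult_mono) auto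
      also have "\<dots> = d * (\<bar>c\<bar> + 1 + N u)" by (simp add: algebra_simps)
      also have "\<dots> < e" using d e by linarith
      finally show ?thesis using y cu by (simp add: algebra_simps)
    qed
    ultimately show "\<exists>U. openin (prod_topology euclideanreal (norm_topology V N)) U \<and> x \<in> U \<and>
        (\<forall>y\<in>U. N ((case y of (c, u) \<Rightarrow> c *\<^sub>R u) - (case x of (c, u) \<Rightarrow> c *\<^sub>R u)) < e)" by blast
  qed (auto intro: scale_mem)
qed

text \<open>The partition of unity subordinate to a finite net is antisymmetrized, which makes the approximation
  odd and, as \<open>K = - K\<close>, does not worsen it.\<close>

lemma odd_finite_rank_approximation:
  assumes K: "compactin (norm_topology V N) K" and sym: "uminus ` K = K"
    and S: "S \<subseteq> V" and dense: "\<And>u e. u \<in> V \<Longrightarrow> 0 < e \<Longrightarrow> \<exists>v\<in>S. N (v - u) < e" and e: "0 < e"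
  obtains F and c :: "'u \<Rightarrow> 'u \<Rightarrow> real" where "finite F" "F \<subseteq> S"
    "\<And>f u. u \<in> K \<Longrightarrow> c f (- u) = - c f u"
    "\<And>f u. u \<in> K \<Longrightarrow> \<bar>c f u\<bar> \<le> 1"
    "\<And>f u d. u \<in> K \<Longrightarrow> 0 < d \<Longrightarrow> \<exists>\<delta>>0. \<forall>v\<in>K. N (v - u) < \<delta> \<longrightarrow> \<bar>c f v - c f u\<bar> < d"
    "\<And>u. u \<in> K \<Longrightarrow> N ((\<Sum>f\<in>F. c f u *\<^sub>R f) - u) \<le> e"
proof -
  have KV: "K \<subseteq> V" using K by (simp add: compactin_def)
  define B where "B f = {v \<in> V. N (v - f) < e}" for f
  have "Ball (B ` S) (openin (norm_topology V N))" using S openin_ball by (auto simp: B_def)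
  moreover have "K \<subseteq> \<Union>(B ` S)"
  proof
    fix u assume u: "u \<in> K"
    then obtain v where "v \<in> S" "N (v - u) < e" using dense e KV by blast
    moreover have "u \<in> V" "v \<in> V" using u KV S \<open>v \<in> S\<close> by auto
    ultimately have "u \<in> B v" using N_commute[of u v] by (simp add: B_def)
    then show "u \<in> \<Union>(B ` S)" using \<open>v \<in> S\<close> by blast
  qed
  ultimately have "\<exists>\<F>. finite \<F> \<and> \<F> \<subseteq> B ` S \<and> K \<subseteq> \<Union>\<F>"
    using K unfolding compactin_def by (metis (no_types, lifting))
  then obtain F where F: "finite F" "F \<subseteq> S" and cov: "K \<subseteq> \<Union>(B ` F)"
    by (metis finite_subset_image)
  have FV: "F \<subseteq> V" using F S by auto
  \<comment> \<open>Tent functions of the balls of the net: \<open>\<alpha> f u\<close> is positive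
    exactly when \<open>f\<close> is within \<open>e\<close> of \<open>u\<close>.\<close>
  define \<alpha> where "\<alpha> f u = max 0 (e - N (u - f))" for f u
  define s where "s u = (\<Sum>f\<in>F. \<alpha> f u)" for u
  define b where "b f u = (if f \<in> F then \<alpha> f u / s u else 0)" for f u
  define c where "c f u = (b f u - b f (- u)) / 2" for f u
  have a0: "\<alpha> f u \<ge> 0" for f u by (simp add: \<alpha>_def)
  have s0: "s u > 0" if "u \<in> K" for u
  proof -
    obtain f where "f \<in> F" "u \<in> B f" using cov \<open>u \<in> K\<close> by auto
    then have "0 < \<alpha> f u" by (auto simp: \<alpha>_def B_def)
    also have "\<alpha> f u \<le> s u" unfolding s_def using F(1) \<open>f \<in> F\<close> a0 by (intro member_le_sum) auto
    finally show ?thesis .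
  qed
  have b0: "0 \<le> b f u" if "u \<in> K" for f u using a0 s0[OF that] by (simp add: b_def)
  have b1: "(\<Sum>f\<in>F. b f u) = 1" if "u \<in> K" for u
    using s0[OF that] by (simp add: b_def s_def flip: sum_divide_distrib)
  have ble: "b f u \<le> 1" if "u \<in> K" for f u
  proof (cases "f \<in> F")
    case True
    then have "b f u \<le> (\<Sum>f\<in>F. b f u)" using F(1) b0[OF that] by (intro member_le_sum) auto
    then show ?thesis using b1[OF that] by simp
  qed (simp add: b_def)
  have neg: "- u \<in> K" if "u \<in> K" for u using that sym by blast
  have acont: "\<bar>\<alpha> f v - \<alpha> f u\<bar> \<le> N (v - u)" if "f \<in> F" "u \<in> V" "v \<in> V" for f u v
  proof -
    have "\<bar>N (v - f) - N (u - f)\<bar> \<le> N (v - u)"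
      using N_abs_diff_le[OF diff_mem diff_mem, of v f u f] that FV by auto
    then show ?thesis unfolding \<alpha>_def by linarith
  qed
  have bcont: "\<exists>\<delta>>0. \<forall>v\<in>K. N (v - u) < \<delta> \<longrightarrow> \<bar>b f v - b f u\<bar> < d" if u: "u \<in> K" and d: "0 < d" for f u d
  proof (cases "f \<in> F")
    case False
    then show ?thesis using d by (auto simp: b_def intro: exI[of _ 1])
  next
    case True
    \<comment> \<open>The summand 1 pays for the change of the numerator \<open>\<alpha> f\<close>,
      and \<open>card F\<close> for that of the denominator \<open>s\<close>.\<close>
    define n where "n = real (card F) + 1"
    have n: "n > 0" by (simp add: n_def)
    have su: "s u > 0" using s0 u by auto
    define \<delta> where "\<delta> = s u * d / (2 * n)"
    have \<delta>: "\<delta> > 0" using n su d by (simp add: \<delta>_def)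
    have "\<bar>b f v - b f u\<bar> < d" if v: "v \<in> K" and vu: "N (v - u) < \<delta>" for v
    proof -
      have sv: "s v > 0" using s0 v by auto
      have x: "\<bar>\<alpha> f v - \<alpha> f u\<bar> \<le> N (v - u)" using acont True u v KV by auto
      have "\<bar>s v - s u\<bar> \<le> (\<Sum>f\<in>F. \<bar>\<alpha> f v - \<alpha> f u\<bar>)"
        unfolding s_def sum_subtractf[symmetric] by (rule sum_abs)
      also have "\<dots> \<le> (\<Sum>f\<in>F. N (v - u))" using acont u v KV by (intro sum_mono) auto
      finally have y: "\<bar>s v - s u\<bar> \<le> real (card F) * N (v - u)" by simp
      \<comment> \<open>A quotient rule with only \<open>s u\<close> in the denominator; the
        quotient at \<open>v\<close> enters through \<open>b f v \<le> 1\<close>, so no lower bound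
        of \<open>s\<close> near \<open>u\<close> is required.\<close>
      have eq: "b f v - b f u = ((\<alpha> f v - \<alpha> f u) - b f v * (s v - s u)) / s u"
        using True su sv by (simp add: b_def field_simps)
      have "\<bar>(\<alpha> f v - \<alpha> f u) - b f v * (s v - s u)\<bar> \<le> \<bar>\<alpha> f v - \<alpha> f u\<bar> + \<bar>b f v\<bar> * \<bar>s v - s u\<bar>"
        by (metis abs_mult abs_triangle_ineq4)
      also have "\<dots> \<le> N (v - u) + 1 * (real (card F) * N (v - u))"
        using x y b0[OF v] ble[OF v] by (intro add_mono mult_mono) auto
      also have "\<dots> = n * N (v - u)" by (simp add: n_def algebra_simps)
      also have "\<dots> < n * \<delta>" using n vu by simp
      also have "\<dots> = s u * d / 2" using n by (simp add: \<delta>_def)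
      also have "\<dots> < s u * d" using su d by simp
      finally have "\<bar>(\<alpha> f v - \<alpha> f u) - b f v * (s v - s u)\<bar> < d * s u" by (simp add: mult.commute)
      then have "\<bar>(\<alpha> f v - \<alpha> f u) - b f v * (s v - s u)\<bar> / s u < d"
        using su by (simp add: pos_divide_less_eq)
      then show ?thesis unfolding eq using su by simp
    qed
    then show ?thesis using \<delta> by blast
  qed
  have conv: "N ((\<Sum>f\<in>F. b f u *\<^sub>R f) - u) \<le> e" if u: "u \<in> K" for u
  proof -
    \<comment> \<open>The weights add up to 1, so the error is a convex combination of the
      \<open>f - u\<close>, and weights of those \<open>f\<close> at distance at least
      \<open>e\<close> vanish.\<close>
    have "(\<Sum>f\<in>F. b f u *\<^sub>R f) - u = (\<Sum>f\<in>F. b f u *\<^sub>R f) - (\<Sum>f\<in>F. b f u) *\<^sub>R u"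
      using b1[OF u] by simp
    also have "\<dots> = (\<Sum>f\<in>F. b f u *\<^sub>R (f - u))"
      by (simp add: scaleR_sum_left scaleR_diff_right sum_subtractf)
    also have "N \<dots> \<le> (\<Sum>f\<in>F. N (b f u *\<^sub>R (f - u)))"
      using F(1) FV u KV by (intro N_sum_le scale_mem diff_mem) auto
    also have "\<dots> \<le> (\<Sum>f\<in>F. b f u * e)"
    proof (rule sum_mono)
      fix f assume f: "f \<in> F"
      have eq: "N (b f u *\<^sub>R (f - u)) = b f u * N (f - u)"
        using N_scaleR[OF diff_mem, of f u "b f u"] subsetD[OF FV f] subsetD[OF KV u] b0[OF u, of f]
        by simp
      show "N (b f u *\<^sub>R (f - u)) \<le> b f u * e"
      proof (cases "N (f - u) < e")
        case True
        then show ?thesis unfolding eq using b0[OF u] by (intro mult_left_mono) auto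
      next
        case False
        then have "b f u = 0" using N_commute[OF subsetD[OF FV f] subsetD[OF KV u]] by (simp add: b_def \<alpha>_def)
        then show ?thesis unfolding eq by simp
      qed
    qed
    also have "\<dots> = e" unfolding sum_distrib_right[symmetric] using b1[OF u] by simp
    finally show ?thesis .
  qed
  show ?thesis
  proof (rule that[of F c])
    show "finite F" "F \<subseteq> S" by fact+
  next
    fix f u d assume u: "u \<in> K"
    show "c f (- u) = - c f u" by (simp add: c_def field_simps)
    show "\<bar>c f u\<bar> \<le> 1" using b0[OF u, of f] ble[OF u, of f] b0[OF neg[OF u], of f] ble[OF neg[OF u], of f]
      unfolding c_def by argo
  next
    fix f u and d :: real assume u: "u \<in> K" and d: "0 < d"
    obtain \<delta>1 where 1: "\<delta>1 > 0" "\<forall>v\<in>K. N (v - u) < \<delta>1 \<longrightarrow> \<bar>b f v - b f u\<bar> < d"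
      using bcont u d by blast
    obtain \<delta>2 where 2: "\<delta>2 > 0" "\<forall>v\<in>K. N (v - (- u)) < \<delta>2 \<longrightarrow> \<bar>b f v - b f (- u)\<bar> < d"
      using bcont[OF neg[OF u] d] by blast
    have "\<bar>c f v - c f u\<bar> < d" if v: "v \<in> K" "N (v - u) < min \<delta>1 \<delta>2" for v
    proof -
      have "N ((- v) - (- u)) = N (v - u)" using N_commute[of u v] u v KV by auto
      then have "\<bar>b f (- v) - b f (- u)\<bar> < d" "\<bar>b f v - b f u\<bar> < d"
        using 1 2 v neg by auto
      then show ?thesis unfolding c_def by argo
    qed
    then show "\<exists>\<delta>>0. \<forall>v\<in>K. N (v - u) < \<delta> \<longrightarrow> \<bar>c f v - c f u\<bar> < d"
      using 1 2 by (intro exI[of _ "min \<delta>1 \<delta>2"]) auto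
  next
    fix u assume u: "u \<in> K"
    define w where "w = (\<Sum>f\<in>F. b f u *\<^sub>R f)"
    \<comment> \<open>\<open>w'\<close> approximates \<open>- u\<close>, so
      \<open>(w - w') / 2\<close> is the mean of two approximations of \<open>u\<close> and inherits
      the bound \<open>e\<close>.\<close>
    define w' where "w' = (\<Sum>f\<in>F. b f (- u) *\<^sub>R f)"
    have wV: "w \<in> V" "w' \<in> V" "u \<in> V"
      using FV u KV unfolding w_def w'_def by (auto intro!: subspace_sum[OF subspace_V] scale_mem)
    have "(\<Sum>f\<in>F. c f u *\<^sub>R f) = (1/2) *\<^sub>R (w - w')"
      by (simp add: c_def w_def w'_def scaleR_sum_right flip: sum_subtractf scaleR_diff_left)
    moreover have "u = (1/2) *\<^sub>R (u + u)" by (simp flip: scaleR_2)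
    moreover have "(w - u) - (w' - (- u)) = (w - w') - (u + u)" by simp
    ultimately have "(\<Sum>f\<in>F. c f u *\<^sub>R f) - u = (1/2) *\<^sub>R ((w - u) - (w' - (- u)))"
      by (metis scaleR_diff_right)
    also have "N \<dots> = (1/2) * N ((w - u) - (w' - (- u)))"
      using wV by (intro N_scaleR[THEN trans]) (simp_all add: diff_mem add_mem)
    also have "\<dots> \<le> (1/2) * (N (w - u) + N (w' - (- u)))"
      using wV by (intro mult_left_mono N_diff_triangle diff_mem neg_mem) auto
    also have "\<dots> \<le> e" using conv[OF u] conv[OF neg[OF u]] by (simp add: w_def w'_def)
    finally show "N ((\<Sum>f\<in>F. c f u *\<^sub>R f) - u) \<le> e" .
  qed
qed

end

section \<open>Continuous odd maps and the index\<close>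

lemma continuous_map_normed_subspaces:
  assumes "normed_subspace V N" "normed_subspace W M" "K \<subseteq> V" "\<And>u. u \<in> K \<Longrightarrow> f u \<in> W"
    and "\<And>u e. u \<in> K \<Longrightarrow> 0 < e \<Longrightarrow> \<exists>d>0. \<forall>v\<in>K. N (v - u) < d \<longrightarrow> M (f v - f u) < e"
  shows "continuous_map (subtopology (norm_topology V N) K) (norm_topology W M) f"
proof -
  interpret V: normed_subspace V N by fact
  interpret W: normed_subspace W M by fact
  show ?thesis
  proof (rule W.continuous_map_intoI)
    fix u and e :: real
    assume "u \<in> topspace (subtopology (norm_topology V N) K)" "0 < e"
    then have u: "u \<in> K" "u \<in> V" using assms by auto
    obtain d where d: "d > 0" "\<forall>v\<in>K. N (v - u) < d \<longrightarrow> M (f v - f u) < e"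
      using assms(5)[OF u(1) \<open>0 < e\<close>] by auto
    have "openin (subtopology (norm_topology V N) K) ({v \<in> V. N (v - u) < d} \<inter> K)"
      using V.openin_ball[OF u(2)] by (auto simp: openin_subtopology)
    then show "\<exists>U. openin (subtopology (norm_topology V N) K) U \<and> u \<in> U \<and> (\<forall>y\<in>U. M (f y - f u) < e)"
      using d u by (intro exI[of _ "{v \<in> V. N (v - u) < d} \<inter> K"]) (auto simp: V.N_zero)
  qed (use assms in auto)
qed

text \<open>For an abstract index this is axiom \<open>(i_3)\<close>. For the genus, every odd map
  from the image to a sphere can be composed with \<open>\<pi>\<close>, so the infimum for
  \<open>K\<close> runs over at least as many numbers. From here on both kinds of index are treated
  alike.\<close>

lemma index_mono_image:
  fixes i :: "'u::real_vector topology \<Rightarrow> 'u set \<Rightarrow> enat"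
  assumes i: "i = genus \<or> topological_index i"
    and T: "topological_vector_space T" and S: "topological_vector_space S" and K: "index_set T K"
    and \<pi>: "continuous_map (subtopology T K) S \<pi>" "\<And>u. u \<in> K \<Longrightarrow> \<pi> u \<noteq> 0"
    and odd: "\<And>u. u \<in> K \<Longrightarrow> \<pi> (- u) = - \<pi> u"
  shows "i T K \<le> i S (\<pi> ` K)"
proof -
  have KT: "K \<subseteq> topspace T" using K by (simp add: index_set_def compactin_def)
  have cont: "continuous_map (subtopology T K) (subtopology S (topspace S - {0})) \<pi>"
    using \<pi> KT continuous_map_image_subset_topspace[OF \<pi>(1)]
    by (auto simp: continuous_map_in_subtopology)
  show ?thesis
  proof (cases "i = genus")
    case False
    then have "topological_index i" using i by simp
    then have "\<forall>T S K \<pi>. topological_vector_space T \<and> topological_vector_space S \<and> index_set T K \<and>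
        continuous_map (subtopology T K) (subtopology S (topspace S - {0})) \<pi> \<and>
        (\<forall>u\<in>K. \<pi> (- u) = - \<pi> u) \<longrightarrow> i T K \<le> i S (\<pi> ` K)"
      unfolding topological_index_def by (elim conjE)
    then show ?thesis using T S K cont odd by metis
  next
    case True
    have cont': "continuous_map (subtopology T K) (subtopology S (\<pi> ` K)) \<pi>"
      using \<pi>(1) KT by (simp add: continuous_map_in_subtopology)
    have "genus T K \<le> genus S (\<pi> ` K)"
      unfolding genus_def
    proof (rule Inf_superset_mono, clarify)
      fix k f assume k: "1 \<le> k" and f: "continuous_map (subtopology S (\<pi> ` K)) (nsphere (k - 1)) f"
        and fodd: "\<forall>u\<in>\<pi> ` K. f (- u) = (\<lambda>j. - f u j)"
      have "continuous_map (subtopology T K) (nsphere (k - 1)) (f \<circ> \<pi>)"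
        by (rule continuous_map_compose[OF cont' f])
      moreover have "\<forall>u\<in>K. (f \<circ> \<pi>) (- u) = (\<lambda>j. - (f \<circ> \<pi>) u j)" using fodd odd by simp
      ultimately show "\<exists>k'. enat k = enat k' \<and> 1 \<le> k' \<and>
          (\<exists>f. continuous_map (subtopology T K) (nsphere (k' - 1)) f \<and> (\<forall>u\<in>K. f (- u) = (\<lambda>j. - f u j)))"
        using k by blast
    qed
    with True show ?thesis by simp
  qed
qed

section \<open>The Luxemburg norm of a double phase integrand\<close>

lemma powr_le_self: "0 \<le> c \<Longrightarrow> c \<le> 1 \<Longrightarrow> 1 \<le> r \<Longrightarrow> c powr r \<le> (c::real)"
  using powr_mono'[of 1 r c] by auto

text \<open>Convexity on the open half-line has to be extended to 0, where it reduces to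
  \<open>c powr p \<le> c\<close> for \<open>c\<close> in the unit interval.\<close>

lemma powr_convex_combination:
  fixes x y \<mu> \<nu> p :: real
  assumes p: "1 \<le> p" and xy: "0 \<le> x" "0 \<le> y" and \<mu>: "0 \<le> \<mu>" "0 \<le> \<nu>" "\<mu> + \<nu> = 1"
  shows "(\<mu> * x + \<nu> * y) powr p \<le> \<mu> * x powr p + \<nu> * y powr p"
proof -
  have le: "c powr p * z powr p \<le> c * z powr p" if "0 \<le> c" "c \<le> 1" for c z :: real
    using powr_le_self[OF that p] by (intro mult_right_mono) auto
  consider "x = 0" | "y = 0" | "0 < x" "0 < y" using xy by linarith
  then show ?thesis
  proof cases
    case 3
    have "convex_on {0<..} (\<lambda>x::real. x powr p)" by (rule powr_convex[OF p])
    then show ?thesis using 3 \<mu> unfolding convex_on_def by auto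
  qed (use le[of \<mu> x] le[of \<nu> y] \<mu> in \<open>auto simp: powr_mult\<close>)
qed

lemma powr_interpolation:
  fixes t r s s' \<theta> :: real
  assumes t: "0 \<le> t" and \<theta>: "0 \<le> \<theta>" "\<theta> \<le> 1" and s': "s' = (1 - \<theta>) * r + \<theta> * s"
  shows "t powr s' \<le> (1 - \<theta>) * t powr r + \<theta> * t powr s"
proof (cases "t = 0")
  case False
  then have "(t powr r) powr (1 - \<theta>) * (t powr s) powr \<theta> \<le> (1 - \<theta>) * t powr r + \<theta> * t powr s"
    using t \<theta> by (intro Youngs_inequality_0) auto
  then show ?thesis by (simp add: powr_powr s' powr_add mult.commute)
qed simp

text \<open>Young's inequality with the exponents \<open>r\<close> and \<open>s\<close>. The weight
  of the higher power tends to 0 as \<open>r'\<close> decreases to \<open>r\<close>, which is what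
  raises exponents at a small price.\<close>

lemma powr_le_add_powr:
  fixes t r r' s :: real
  assumes t: "0 \<le> t" and r: "r \<le> r'" "r' \<le> s" "r < s"
  shows "t powr r' \<le> t powr r + (r' - r) / (s - r) * t powr s"
proof -
  define \<theta> where "\<theta> = (r' - r) / (s - r)"
  have \<theta>: "0 \<le> \<theta>" "\<theta> \<le> 1" "r' = (1 - \<theta>) * r + \<theta> * s"
  proof -
    show "0 \<le> \<theta>" "\<theta> \<le> 1" using r by (auto simp: \<theta>_def)
    have "\<theta> * (s - r) = r' - r" using r by (simp add: \<theta>_def)
    then show "r' = (1 - \<theta>) * r + \<theta> * s" by (simp add: algebra_simps)
  qed
  have "t powr r' \<le> (1 - \<theta>) * t powr r + \<theta> * t powr s"
    by (rule powr_interpolation[OF t \<theta>])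
  also have "\<dots> \<le> t powr r + \<theta> * t powr s"
    using \<theta> mult_right_mono[of "1 - \<theta>" 1 "t powr r"] by simp
  finally show ?thesis by (simp add: \<theta>_def)
qed

text \<open>Interpolation between the exponents 0 and \<open>r'\<close>; the zeroth power
  contributes the constant. The case \<open>t = 0\<close> is split off because
  \<open>0 powr 0 = 0\<close>.\<close>

lemma powr_le_add_const:
  fixes t r r' :: real
  assumes t: "0 \<le> t" and r: "0 < r" "r \<le> r'"
  shows "t powr r \<le> t powr r' + (1 - r / r')"
proof (cases "t = 0")
  case False
  have q: "r / r' \<le> 1" "0 \<le> r / r'" using r by auto
  have "t powr r \<le> (1 - r / r') * t powr 0 + r / r' * t powr r'"
    using r t q by (intro powr_interpolation) auto
  also have "\<dots> \<le> t powr r' + (1 - r / r')"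
    using False t q mult_right_mono[OF q(1), of "t powr r'"] by simp
  finally show ?thesis .
qed (use r in auto)

text \<open>One integrand on one domain; the limit exponents and each pair of the sequence
  instantiate it. Boundedness of \<open>a\<close> gives bounded functions a finite modular and
  thereby puts test functions into the space.\<close>

locale double_phase_domain =
  fixes \<Omega> :: "(real ^ 'n::finite) set" and a :: "real ^ 'n \<Rightarrow> real" and r s :: real
  assumes open_\<Omega>: "open \<Omega>" and bounded_\<Omega>: "bounded \<Omega>"
    and r_gt_1: "1 < r" and r_less_s: "r < s"
    and a_nonneg: "\<And>x. x \<in> \<Omega> \<Longrightarrow> 0 \<le> a x"
    and a_measurable [measurable]: "a \<in> borel_measurable (lebesgue_on \<Omega>)"
    and a_bounded: "\<exists>A. \<forall>x\<in>\<Omega>. a x \<le> A"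
begin

abbreviation "G \<equiv> double_phase a r s"

lemma sets_\<Omega> [simp, measurable]: "\<Omega> \<in> sets lebesgue"
  using open_\<Omega> by auto

lemma AE_\<Omega>_iff: "(AE x in lebesgue_on \<Omega>. P x) \<longleftrightarrow> (AE x in lebesgue. x \<in> \<Omega> \<longrightarrow> P x)"
  by (simp add: AE_restrict_space_iff)

lemma AE_\<Omega>I: "(AE x in lebesgue. P x) \<Longrightarrow> AE x in lebesgue_on \<Omega>. P x"
  unfolding AE_\<Omega>_iff by (erule eventually_mono) simp

lemma emeasure_\<Omega>_finite: "emeasure (lebesgue_on \<Omega>) \<Omega> < \<infinity>"
proof -
  have "\<Omega> \<in> lmeasurable" using open_\<Omega> bounded_\<Omega> lmeasurable_open by blast
  then show ?thesis by (simp add: emeasure_restrict_space fmeasurable_def)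
qed

section \<open>The integrand and its modular\<close>

lemma G_nonneg: "x \<in> \<Omega> \<Longrightarrow> 0 \<le> G x t"
  using a_nonneg by (auto simp: double_phase_def intro!: add_nonneg_nonneg mult_nonneg_nonneg)

lemma G_mono: "x \<in> \<Omega> \<Longrightarrow> 0 \<le> t \<Longrightarrow> t \<le> t' \<Longrightarrow> G x t \<le> G x t'"
  using a_nonneg r_gt_1 r_less_s
  by (auto simp: double_phase_def intro!: add_mono mult_left_mono powr_mono2)

lemma G_scale_le_1: "x \<in> \<Omega> \<Longrightarrow> 0 \<le> c \<Longrightarrow> c \<le> 1 \<Longrightarrow> 0 \<le> t \<Longrightarrow> G x (c * t) \<le> c * G x t"
proof -
  assume *: "x \<in> \<Omega>" "0 \<le> c" "c \<le> 1" "0 \<le> t"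
  have "(c * t) powr r \<le> c * t powr r" "(c * t) powr s \<le> c * t powr s"
    using * r_gt_1 r_less_s by (auto simp: powr_mult intro!: mult_right_mono powr_le_self)
  then have "(c * t) powr r + a x * (c * t) powr s \<le> c * t powr r + a x * (c * t powr s)"
    using a_nonneg * by (intro add_mono mult_left_mono) auto
  then show ?thesis by (simp add: double_phase_def algebra_simps)
qed

text \<open>For factors above 1 the larger exponent decides. The factor tends to 1 with
  \<open>c\<close>, so the modular is continuous from one side under scaling.\<close>

lemma G_scale_ge_1: "x \<in> \<Omega> \<Longrightarrow> 1 \<le> c \<Longrightarrow> 0 \<le> t \<Longrightarrow> G x (c * t) \<le> c powr s * G x t"
proof -
  assume *: "x \<in> \<Omega>" "1 \<le> c" "0 \<le> t"
  have "(c * t) powr r \<le> c powr s * t powr r"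
    unfolding powr_mult using * r_gt_1 r_less_s by (intro mult_right_mono powr_mono) auto
  then have "(c * t) powr r + a x * (c * t) powr s \<le> c powr s * t powr r + a x * (c powr s * t powr s)"
    unfolding powr_mult[of c t s] using a_nonneg * by (intro add_mono mult_left_mono) auto
  then show ?thesis by (simp add: double_phase_def algebra_simps)
qed

lemma G_convex:
  assumes "x \<in> \<Omega>" "0 \<le> \<mu>" "0 \<le> \<nu>" "\<mu> + \<nu> = 1" "0 \<le> t" "0 \<le> t'"
  shows "G x (\<mu> * t + \<nu> * t') \<le> \<mu> * G x t + \<nu> * G x t'"
proof -
  have "(\<mu> * t + \<nu> * t') powr r + a x * (\<mu> * t + \<nu> * t') powr s
      \<le> (\<mu> * t powr r + \<nu> * t' powr r) + a x * (\<mu> * t powr s + \<nu> * t' powr s)"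
    using assms a_nonneg r_gt_1 r_less_s by (intro add_mono mult_left_mono powr_convex_combination) auto
  then show ?thesis by (simp add: double_phase_def algebra_simps)
qed

lemma G_measurable [measurable (raw)]:
  assumes [measurable]: "f \<in> borel_measurable (lebesgue_on \<Omega>)"
  shows "(\<lambda>x. G x (f x)) \<in> borel_measurable (lebesgue_on \<Omega>)"
  unfolding double_phase_def by measurable

lemma modular_mono:
  assumes "AE x in lebesgue_on \<Omega>. \<bar>f x\<bar> \<le> \<bar>g x\<bar>"
  shows "modular \<Omega> G f \<le> modular \<Omega> G g"
  unfolding modular_def
proof (rule nn_integral_mono_AE)
  show "AE x in lebesgue_on \<Omega>. ennreal (G x \<bar>f x\<bar>) \<le> ennreal (G x \<bar>g x\<bar>)"
    using assms AE_space by eventually_elim (auto intro!: ennreal_leI G_mono)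
qed

lemma modular_cong:
  assumes "AE x in lebesgue_on \<Omega>. \<bar>f x\<bar> = \<bar>g x\<bar>"
  shows "modular \<Omega> G f = modular \<Omega> G g"
  by (intro antisym modular_mono; use assms in \<open>eventually_elim\<close>) auto

lemma modular_scale:
  assumes [measurable]: "f \<in> borel_measurable (lebesgue_on \<Omega>)"
    and k: "0 \<le> k" "\<And>x. x \<in> \<Omega> \<Longrightarrow> G x (\<bar>c\<bar> * \<bar>f x\<bar>) \<le> k * G x \<bar>f x\<bar>"
  shows "modular \<Omega> G (\<lambda>x. c * f x) \<le> ennreal k * modular \<Omega> G f"
proof -
  have "modular \<Omega> G (\<lambda>x. c * f x) \<le> (\<integral>\<^sup>+x. ennreal k * ennreal (G x \<bar>f x\<bar>) \<partial>lebesgue_on \<Omega>)"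
    unfolding modular_def
    using k G_nonneg by (intro nn_integral_mono) (auto simp: abs_mult simp flip: ennreal_mult intro!: ennreal_leI)
  also have "\<dots> = ennreal k * modular \<Omega> G f"
    unfolding modular_def by (rule nn_integral_cmult) measurable
  finally show ?thesis .
qed

lemma modular_scale_le_1:
  assumes "f \<in> borel_measurable (lebesgue_on \<Omega>)" "\<bar>c\<bar> \<le> 1"
  shows "modular \<Omega> G (\<lambda>x. c * f x) \<le> ennreal \<bar>c\<bar> * modular \<Omega> G f"
  using assms by (intro modular_scale G_scale_le_1) auto

lemma modular_scale_ge_1:
  assumes "f \<in> borel_measurable (lebesgue_on \<Omega>)" "1 \<le> \<bar>c\<bar>"
  shows "modular \<Omega> G (\<lambda>x. c * f x) \<le> ennreal (\<bar>c\<bar> powr s) * modular \<Omega> G f"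
  using assms by (intro modular_scale G_scale_ge_1) auto

lemma modular_convex:
  assumes [measurable]: "f \<in> borel_measurable (lebesgue_on \<Omega>)" "g \<in> borel_measurable (lebesgue_on \<Omega>)"
    and \<mu>: "0 \<le> \<mu>" "0 \<le> \<nu>" "\<mu> + \<nu> = 1"
  shows "modular \<Omega> G (\<lambda>x. \<mu> * f x + \<nu> * g x) \<le> ennreal \<mu> * modular \<Omega> G f + ennreal \<nu> * modular \<Omega> G g"
proof -
  have "modular \<Omega> G (\<lambda>x. \<mu> * f x + \<nu> * g x)
      \<le> (\<integral>\<^sup>+x. ennreal \<mu> * ennreal (G x \<bar>f x\<bar>) + ennreal \<nu> * ennreal (G x \<bar>g x\<bar>) \<partial>lebesgue_on \<Omega>)"
    unfolding modular_def
  proof (intro nn_integral_mono)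
    fix x assume "x \<in> space (lebesgue_on \<Omega>)"
    then have x: "x \<in> \<Omega>" by simp
    have "\<bar>\<mu> * f x + \<nu> * g x\<bar> \<le> \<mu> * \<bar>f x\<bar> + \<nu> * \<bar>g x\<bar>"
      using abs_triangle_ineq[of "\<mu> * f x" "\<nu> * g x"] \<mu> by (simp add: abs_mult)
    then have "G x \<bar>\<mu> * f x + \<nu> * g x\<bar> \<le> G x (\<mu> * \<bar>f x\<bar> + \<nu> * \<bar>g x\<bar>)"
      by (intro G_mono x) auto
    also have "\<dots> \<le> \<mu> * G x \<bar>f x\<bar> + \<nu> * G x \<bar>g x\<bar>"
      by (intro G_convex x \<mu>) auto
    finally have "ennreal (G x \<bar>\<mu> * f x + \<nu> * g x\<bar>) \<le> ennreal (\<mu> * G x \<bar>f x\<bar> + \<nu> * G x \<bar>g x\<bar>)"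
      by (rule ennreal_leI)
    also have "\<dots> = ennreal \<mu> * ennreal (G x \<bar>f x\<bar>) + ennreal \<nu> * ennreal (G x \<bar>g x\<bar>)"
      using \<mu> G_nonneg[OF x] by (subst ennreal_plus) (auto simp: ennreal_mult)
    finally show "ennreal (G x \<bar>\<mu> * f x + \<nu> * g x\<bar>)
        \<le> ennreal \<mu> * ennreal (G x \<bar>f x\<bar>) + ennreal \<nu> * ennreal (G x \<bar>g x\<bar>)" .
  qed
  also have "\<dots> = ennreal \<mu> * modular \<Omega> G f + ennreal \<nu> * modular \<Omega> G g"
    unfolding modular_def by (subst nn_integral_add, measurable) (simp add: nn_integral_cmult)
  finally show ?thesis .
qed

lemma finite_modular_scale:
  assumes "finite_modular \<Omega> G f"
  shows "finite_modular \<Omega> G (\<lambda>x. c * f x)"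
proof -
  have [measurable]: "f \<in> borel_measurable (lebesgue_on \<Omega>)" and fin: "modular \<Omega> G f < \<infinity>"
    using assms by (auto simp: finite_modular_def)
  have "\<exists>k. modular \<Omega> G (\<lambda>x. c * f x) \<le> ennreal k * modular \<Omega> G f"
    using modular_scale_le_1[of f c] modular_scale_ge_1[of f c] by (cases "\<bar>c\<bar> \<le> 1") auto
  then have "modular \<Omega> G (\<lambda>x. c * f x) < \<infinity>"
    using fin by (auto simp: ennreal_mult_less_top intro: le_less_trans)
  then show ?thesis unfolding finite_modular_def by simp
qed

lemma finite_modular_mono:
  assumes "finite_modular \<Omega> G g" "f \<in> borel_measurable (lebesgue_on \<Omega>)"
    "AE x in lebesgue_on \<Omega>. \<bar>f x\<bar> \<le> \<bar>g x\<bar>"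
  shows "finite_modular \<Omega> G f"
  using assms modular_mono[OF assms(3)] by (auto simp: finite_modular_def)

lemma finite_modular_add:
  assumes f: "finite_modular \<Omega> G f" and g: "finite_modular \<Omega> G g"
  shows "finite_modular \<Omega> G (\<lambda>x. f x + g x)"
proof -
  have [measurable]: "f \<in> borel_measurable (lebesgue_on \<Omega>)" "g \<in> borel_measurable (lebesgue_on \<Omega>)"
    and fin: "modular \<Omega> G f < \<infinity>" "modular \<Omega> G g < \<infinity>"
    using assms by (auto simp: finite_modular_def)
  \<comment> \<open>Convexity controls only the midpoint of \<open>f\<close> and \<open>g\<close>;
    the factor 2 is restored by scaling.\<close>
  define k :: real where "k = 1 / 2"
  have "modular \<Omega> G (\<lambda>x. k * f x + k * g x) \<le> ennreal k * modular \<Omega> G f + ennreal k * modular \<Omega> G g"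
    by (rule modular_convex) (auto simp: k_def)
  also have "\<dots> < \<infinity>" using fin by (auto simp: ennreal_mult_less_top)
  finally have "finite_modular \<Omega> G (\<lambda>x. k * f x + k * g x)"
    by (simp add: finite_modular_def)
  from finite_modular_scale[OF this, of 2] show ?thesis by (simp add: k_def algebra_simps)
qed

lemma finite_modular_bounded:
  assumes [measurable]: "f \<in> borel_measurable (lebesgue_on \<Omega>)" and B: "\<And>x. x \<in> \<Omega> \<Longrightarrow> \<bar>f x\<bar> \<le> B"
  shows "finite_modular \<Omega> G f"
proof -
  obtain A where A: "\<And>x. x \<in> \<Omega> \<Longrightarrow> a x \<le> A" using a_bounded by auto
  have "modular \<Omega> G f \<le> (\<integral>\<^sup>+x. ennreal (B powr r + \<bar>A\<bar> * B powr s) \<partial>lebesgue_on \<Omega>)"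
    unfolding modular_def
  proof (intro nn_integral_mono ennreal_leI)
    fix x assume "x \<in> space (lebesgue_on \<Omega>)"
    then have x: "x \<in> \<Omega>" by simp
    have "G x \<bar>f x\<bar> \<le> G x B" using G_mono[OF x _ B[OF x]] by simp
    also have "\<dots> \<le> B powr r + \<bar>A\<bar> * B powr s"
      unfolding double_phase_def using A[OF x] by (intro add_left_mono mult_right_mono) auto
    finally show "G x \<bar>f x\<bar> \<le> B powr r + \<bar>A\<bar> * B powr s" .
  qed
  also have "\<dots> < \<infinity>" using emeasure_\<Omega>_finite by (simp add: ennreal_mult_less_top)
  finally show ?thesis by (simp add: finite_modular_def)
qed

text \<open>The term with exponent \<open>r\<close> has coefficient 1, so \<open>f\<close> is forced
  to vanish even where \<open>a\<close> does.\<close>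

lemma modular_eq_0D:
  assumes [measurable]: "f \<in> borel_measurable (lebesgue_on \<Omega>)" and 0: "modular \<Omega> G f = 0"
  shows "AE x in lebesgue_on \<Omega>. f x = 0"
proof -
  have "AE x in lebesgue_on \<Omega>. ennreal (G x \<bar>f x\<bar>) = 0"
    using 0 unfolding modular_def by (subst (asm) nn_integral_0_iff_AE) auto
  then show ?thesis using AE_space
  proof eventually_elim
    case (elim x)
    then have "G x \<bar>f x\<bar> \<le> 0" "0 \<le> a x" using a_nonneg by (auto simp: ennreal_eq_0_iff)
    then have "\<bar>f x\<bar> powr r \<le> 0"
      unfolding double_phase_def using mult_nonneg_nonneg[of "a x" "\<bar>f x\<bar> powr s"]
        powr_ge_zero[of "\<bar>f x\<bar>" s] by linarith
    then show ?case by simp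
  qed
qed

section \<open>The Luxemburg norm\<close>

lemma modular_divide_antimono:
  assumes "0 < \<gamma>" "\<gamma> \<le> \<gamma>'"
  shows "modular \<Omega> G (\<lambda>x. f x / \<gamma>') \<le> modular \<Omega> G (\<lambda>x. f x / \<gamma>)"
  using assms by (intro modular_mono AE_I2) (auto simp: abs_divide intro!: divide_left_mono)

text \<open>The modular unit ball is convex, and the quotient is the convex combination of
  \<open>f / \<gamma>\<close> and \<open>g / \<delta>\<close> with weights proportional to
  \<open>\<gamma>\<close> and \<open>\<delta>\<close>. This is the triangle inequality of the
  norm.\<close>

lemma modular_add_divide_le:
  assumes [measurable]: "f \<in> borel_measurable (lebesgue_on \<Omega>)" "g \<in> borel_measurable (lebesgue_on \<Omega>)"
    and "0 < \<gamma>" "0 < \<delta>" "modular \<Omega> G (\<lambda>x. f x / \<gamma>) \<le> 1" "modular \<Omega> G (\<lambda>x. g x / \<delta>) \<le> 1"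
  shows "modular \<Omega> G (\<lambda>x. (f x + g x) / (\<gamma> + \<delta>)) \<le> 1"
proof -
  have eq: "(f x + g x) / (\<gamma> + \<delta>) = \<gamma> / (\<gamma> + \<delta>) * (f x / \<gamma>) + \<delta> / (\<gamma> + \<delta>) * (g x / \<delta>)" for x
    using assms by (simp add: add_divide_distrib)
  have "modular \<Omega> G (\<lambda>x. (f x + g x) / (\<gamma> + \<delta>))
      \<le> ennreal (\<gamma> / (\<gamma> + \<delta>)) * modular \<Omega> G (\<lambda>x. f x / \<gamma>) + ennreal (\<delta> / (\<gamma> + \<delta>)) * modular \<Omega> G (\<lambda>x. g x / \<delta>)"
    unfolding eq using assms by (intro modular_convex) (auto simp flip: add_divide_distrib)
  also have "\<dots> \<le> ennreal (\<gamma> / (\<gamma> + \<delta>)) * 1 + ennreal (\<delta> / (\<gamma> + \<delta>)) * 1"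
    using assms by (intro add_mono mult_left_mono) auto
  also have "\<dots> = 1"
    using assms by (simp flip: ennreal_plus add_divide_distrib)
  finally show ?thesis .
qed

text \<open>Dividing by a number above 1 shrinks the modular at least linearly, so the modular
  itself, if above 1, is an admissible \<open>\<gamma>\<close>. It makes the infimum in the
  definition meaningful.\<close>

lemma luxemburg_set_nonempty:
  assumes "finite_modular \<Omega> G f"
  shows "\<exists>\<gamma>>0. modular \<Omega> G (\<lambda>x. f x / \<gamma>) \<le> 1"
proof -
  have [measurable]: "f \<in> borel_measurable (lebesgue_on \<Omega>)" and fin: "modular \<Omega> G f < \<infinity>"
    using assms by (auto simp: finite_modular_def)
  define \<gamma> where "\<gamma> = max 1 (enn2real (modular \<Omega> G f))"
  have "modular \<Omega> G f = ennreal (enn2real (modular \<Omega> G f))" using fin by simp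
  also have "\<dots> \<le> ennreal \<gamma>" by (rule ennreal_leI) (simp add: \<gamma>_def)
  finally have \<gamma>: "1 \<le> \<gamma>" "modular \<Omega> G f \<le> ennreal \<gamma>" by (auto simp: \<gamma>_def)
  have "modular \<Omega> G (\<lambda>x. (1 / \<gamma>) * f x) \<le> ennreal \<bar>1 / \<gamma>\<bar> * modular \<Omega> G f"
    using \<gamma> by (intro modular_scale_le_1) auto
  also have "\<dots> \<le> ennreal \<bar>1 / \<gamma>\<bar> * ennreal \<gamma>" using \<gamma> by (intro mult_left_mono) auto
  also have "\<dots> = 1" using \<gamma> by (simp flip: ennreal_mult)
  finally show ?thesis using \<gamma> by (intro exI[of _ \<gamma>]) simp
qed

lemma luxemburg_nonneg:
  assumes "finite_modular \<Omega> G f"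
  shows "0 \<le> luxemburg \<Omega> G f"
  unfolding luxemburg_def using luxemburg_set_nonempty[OF assms] by (intro cInf_greatest) auto

lemma luxemburg_leI:
  assumes "0 < \<gamma>" "modular \<Omega> G (\<lambda>x. f x / \<gamma>) \<le> 1"
  shows "luxemburg \<Omega> G f \<le> \<gamma>"
  unfolding luxemburg_def using assms by (intro cInf_lower) (auto intro: bdd_belowI[of _ 0])

lemma modular_divide_le_1_of_luxemburg_less:
  assumes "finite_modular \<Omega> G f" "luxemburg \<Omega> G f < \<gamma>"
  shows "modular \<Omega> G (\<lambda>x. f x / \<gamma>) \<le> 1"
proof -
  obtain \<gamma>' where "0 < \<gamma>'" "modular \<Omega> G (\<lambda>x. f x / \<gamma>') \<le> 1" "\<gamma>' < \<gamma>"
    using assms(2) luxemburg_set_nonempty[OF assms(1)] unfolding luxemburg_def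
    by (subst (asm) cInf_less_iff) (auto intro: bdd_belowI[of _ 0])
  then show ?thesis using modular_divide_antimono[of \<gamma>' \<gamma> f] by (auto intro: order_trans)
qed

text \<open>The infimum is attained: passing from \<open>c * \<gamma>\<close> with
  \<open>c > 1\<close> back to \<open>\<gamma>\<close> costs the factor \<open>c powr s\<close>,
  which tends to 1.\<close>

lemma luxemburg_le_iff:
  assumes "finite_modular \<Omega> G f" and \<gamma>: "0 < \<gamma>"
  shows "luxemburg \<Omega> G f \<le> \<gamma> \<longleftrightarrow> modular \<Omega> G (\<lambda>x. f x / \<gamma>) \<le> 1"
proof
  assume le: "luxemburg \<Omega> G f \<le> \<gamma>"
  have [measurable]: "f \<in> borel_measurable (lebesgue_on \<Omega>)"
    using assms by (auto simp: finite_modular_def)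
  have *: "modular \<Omega> G (\<lambda>x. f x / \<gamma>) \<le> ennreal (c powr s)" if c: "1 < c" for c
  proof -
    have "luxemburg \<Omega> G f < c * \<gamma>" using le c \<gamma> by (smt (verit) mult_less_cancel_right1)
    then have 1: "modular \<Omega> G (\<lambda>x. f x / (c * \<gamma>)) \<le> 1"
      by (rule modular_divide_le_1_of_luxemburg_less[OF assms(1)])
    have "modular \<Omega> G (\<lambda>x. c * (f x / (c * \<gamma>))) \<le> ennreal (\<bar>c\<bar> powr s) * modular \<Omega> G (\<lambda>x. f x / (c * \<gamma>))"
      using c by (intro modular_scale_ge_1) auto
    also have "\<dots> \<le> ennreal (\<bar>c\<bar> powr s) * 1" using 1 by (intro mult_left_mono) auto
    finally show ?thesis using c by simp
  qed
  have lim: "((\<lambda>c. ennreal (c powr s)) \<longlongrightarrow> ennreal (1 powr s)) (at_right 1)"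
    by (intro tendsto_intros) auto
  have "eventually (\<lambda>c. modular \<Omega> G (\<lambda>x. f x / \<gamma>) \<le> ennreal (c powr s)) (at_right 1)"
    unfolding eventually_at_right_field using * by (intro exI[of _ 2]) auto
  from tendsto_lowerbound[OF lim this] show "modular \<Omega> G (\<lambda>x. f x / \<gamma>) \<le> 1" by simp
qed (rule luxemburg_leI[OF \<gamma>])

text \<open>An additive excess in the modular becomes a multiplicative one in the norm. All
  comparisons of different exponents are made between modulars and reach the norms through this
  bound.\<close>

lemma luxemburg_le_of_modular_le:
  assumes f: "f \<in> borel_measurable (lebesgue_on \<Omega>)" and \<gamma>: "0 < \<gamma>" and \<eta>: "0 \<le> \<eta>"
    and le: "modular \<Omega> G (\<lambda>x. f x / \<gamma>) \<le> ennreal (1 + \<eta>)"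
  shows "luxemburg \<Omega> G f \<le> \<gamma> * (1 + \<eta>)"
proof (rule luxemburg_leI)
  show "0 < \<gamma> * (1 + \<eta>)" using \<gamma> \<eta> by simp
  have "modular \<Omega> G (\<lambda>x. (1 / (1 + \<eta>)) * (f x / \<gamma>)) \<le> ennreal \<bar>1 / (1 + \<eta>)\<bar> * modular \<Omega> G (\<lambda>x. f x / \<gamma>)"
    using \<eta> f by (intro modular_scale_le_1) auto
  also have "\<dots> \<le> ennreal \<bar>1 / (1 + \<eta>)\<bar> * ennreal (1 + \<eta>)"
    using le by (intro mult_left_mono) auto
  also have "\<dots> = 1" using \<eta> by (subst ennreal_mult[symmetric]) auto
  finally show "modular \<Omega> G (\<lambda>x. f x / (\<gamma> * (1 + \<eta>))) \<le> 1" by (simp add: mult.commute)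
qed

lemma luxemburg_mono:
  assumes g: "finite_modular \<Omega> G g" and le: "AE x in lebesgue_on \<Omega>. \<bar>f x\<bar> \<le> \<bar>g x\<bar>"
  shows "luxemburg \<Omega> G f \<le> luxemburg \<Omega> G g"
proof (rule dense_ge)
  fix \<gamma> assume \<gamma>: "luxemburg \<Omega> G g < \<gamma>"
  then have pos: "0 < \<gamma>" using luxemburg_nonneg[OF g] by linarith
  have "modular \<Omega> G (\<lambda>x. f x / \<gamma>) \<le> modular \<Omega> G (\<lambda>x. g x / \<gamma>)"
  proof (rule modular_mono)
    show "AE x in lebesgue_on \<Omega>. \<bar>f x / \<gamma>\<bar> \<le> \<bar>g x / \<gamma>\<bar>"
      using le by eventually_elim (use pos in \<open>auto simp: abs_divide intro: divide_right_mono\<close>)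
  qed
  also have "\<dots> \<le> 1" by (rule modular_divide_le_1_of_luxemburg_less[OF g \<gamma>])
  finally show "luxemburg \<Omega> G f \<le> \<gamma>" by (rule luxemburg_leI[OF pos])
qed

lemma luxemburg_cong:
  assumes "AE x in lebesgue_on \<Omega>. \<bar>f x\<bar> = \<bar>g x\<bar>"
  shows "luxemburg \<Omega> G f = luxemburg \<Omega> G g"
proof -
  have "modular \<Omega> G (\<lambda>x. f x / \<gamma>) = modular \<Omega> G (\<lambda>x. g x / \<gamma>)" for \<gamma>
  proof (rule modular_cong)
    show "AE x in lebesgue_on \<Omega>. \<bar>f x / \<gamma>\<bar> = \<bar>g x / \<gamma>\<bar>"
      using assms by eventually_elim (simp add: abs_divide)
  qed
  then show ?thesis by (simp add: luxemburg_def)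
qed

lemma luxemburg_zero: "luxemburg \<Omega> G (\<lambda>_. 0) = 0"
proof -
  have 0: "finite_modular \<Omega> G (\<lambda>_. 0)" by (rule finite_modular_bounded[of _ 0]) auto
  have "luxemburg \<Omega> G (\<lambda>_. 0) \<le> \<gamma>" if "0 < \<gamma>" for \<gamma>
    using that by (intro luxemburg_leI) (auto simp: modular_def double_phase_def)
  then have "luxemburg \<Omega> G (\<lambda>_. 0) \<le> 0" by (rule dense_ge)
  then show ?thesis using luxemburg_nonneg[OF 0] by simp
qed

lemma luxemburg_scale_le:
  assumes f: "finite_modular \<Omega> G f"
  shows "luxemburg \<Omega> G (\<lambda>x. c * f x) \<le> \<bar>c\<bar> * luxemburg \<Omega> G f"
proof (cases "c = 0")
  case False
  have "luxemburg \<Omega> G (\<lambda>x. c * f x) / \<bar>c\<bar> \<le> luxemburg \<Omega> G f"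
  proof (rule dense_ge)
    fix \<gamma> assume \<gamma>: "luxemburg \<Omega> G f < \<gamma>"
    then have pos: "0 < \<gamma>" using luxemburg_nonneg[OF f] by linarith
    have "modular \<Omega> G (\<lambda>x. c * f x / (\<bar>c\<bar> * \<gamma>)) = modular \<Omega> G (\<lambda>x. f x / \<gamma>)"
      using False by (intro modular_cong AE_I2) (auto simp: abs_mult)
    also have "\<dots> \<le> 1" by (rule modular_divide_le_1_of_luxemburg_less[OF f \<gamma>])
    finally have "luxemburg \<Omega> G (\<lambda>x. c * f x) \<le> \<bar>c\<bar> * \<gamma>"
      using False pos by (intro luxemburg_leI) auto
    then show "luxemburg \<Omega> G (\<lambda>x. c * f x) / \<bar>c\<bar> \<le> \<gamma>"
      using False by (simp add: divide_le_eq mult.commute)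
  qed
  then show ?thesis using False by (simp add: divide_le_eq mult.commute)
qed (simp add: luxemburg_zero)

lemma luxemburg_scale:
  assumes f: "finite_modular \<Omega> G f"
  shows "luxemburg \<Omega> G (\<lambda>x. c * f x) = \<bar>c\<bar> * luxemburg \<Omega> G f"
proof (cases "c = 0")
  case False
  have "luxemburg \<Omega> G (\<lambda>x. (1/c) * (c * f x)) \<le> \<bar>1/c\<bar> * luxemburg \<Omega> G (\<lambda>x. c * f x)"
    by (intro luxemburg_scale_le finite_modular_scale f)
  then have "\<bar>c\<bar> * luxemburg \<Omega> G f \<le> luxemburg \<Omega> G (\<lambda>x. c * f x)"
    using False by (simp add: field_simps abs_divide)
  then show ?thesis using luxemburg_scale_le[OF f, of c] by simp
qed (simp add: luxemburg_zero)

lemma luxemburg_triangle: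
  assumes f: "finite_modular \<Omega> G f" and g: "finite_modular \<Omega> G g"
  shows "luxemburg \<Omega> G (\<lambda>x. f x + g x) \<le> luxemburg \<Omega> G f + luxemburg \<Omega> G g"
proof (rule field_le_epsilon)
  fix e :: real assume e: "0 < e"
  let ?c = "luxemburg \<Omega> G f + e / 2" and ?d = "luxemburg \<Omega> G g + e / 2"
  have pos: "0 < ?c" "0 < ?d" using luxemburg_nonneg f g e by (auto intro: add_nonneg_pos)
  have "luxemburg \<Omega> G (\<lambda>x. f x + g x) \<le> ?c + ?d"
    using pos e f g by (intro luxemburg_leI modular_add_divide_le modular_divide_le_1_of_luxemburg_less)
      (auto simp: finite_modular_def)
  then show "luxemburg \<Omega> G (\<lambda>x. f x + g x) \<le> luxemburg \<Omega> G f + luxemburg \<Omega> G g + e" by simp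
qed

text \<open>Norm 0 makes the modular of \<open>f / \<gamma>\<close> at most 1 for every positive
  \<open>\<gamma>\<close>; scaling back by \<open>\<gamma> < 1\<close> leaves at most
  \<open>\<gamma>\<close> for the modular of \<open>f\<close>.\<close>

lemma luxemburg_eq_0D:
  assumes f: "finite_modular \<Omega> G f" and 0: "luxemburg \<Omega> G f = 0"
  shows "AE x in lebesgue_on \<Omega>. f x = 0"
proof -
  have [measurable]: "f \<in> borel_measurable (lebesgue_on \<Omega>)"
    using assms by (auto simp: finite_modular_def)
  have "modular \<Omega> G f \<le> ennreal \<gamma>" if \<gamma>: "0 < \<gamma>" "\<gamma> < 1" for \<gamma>
  proof -
    have "modular \<Omega> G (\<lambda>x. \<gamma> * (f x / \<gamma>)) \<le> ennreal \<bar>\<gamma>\<bar> * modular \<Omega> G (\<lambda>x. f x / \<gamma>)"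
      using \<gamma> by (intro modular_scale_le_1) auto
    also have "\<dots> \<le> ennreal \<bar>\<gamma>\<bar> * 1"
      using modular_divide_le_1_of_luxemburg_less[OF f] \<gamma> 0 by (intro mult_left_mono) auto
    finally show ?thesis using \<gamma> by simp
  qed
  then have ev: "eventually (\<lambda>\<gamma>. modular \<Omega> G f \<le> ennreal \<gamma>) (at_right 0)"
    unfolding eventually_at_right_field by (intro exI[of _ 1]) auto
  have lim: "((\<lambda>\<gamma>. ennreal \<gamma>) \<longlongrightarrow> ennreal 0) (at_right 0)" by (intro tendsto_intros)
  have "modular \<Omega> G f \<le> ennreal 0" using tendsto_lowerbound[OF lim ev] by simp
  then show ?thesis by (intro modular_eq_0D) auto
qed

text \<open>Only the first phase is kept, as \<open>t powr r \<le> G x t\<close>. This is how norm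
  bounds enter the Sobolev inequality, which knows nothing of \<open>a\<close>.\<close>

lemma nn_integral_powr_le:
  assumes f: "finite_modular \<Omega> G f" and B: "0 < B" "luxemburg \<Omega> G f \<le> B"
  shows "(\<integral>\<^sup>+x. ennreal (\<bar>f x\<bar> powr r) \<partial>lebesgue_on \<Omega>) \<le> ennreal (B powr r)"
proof -
  have [measurable]: "f \<in> borel_measurable (lebesgue_on \<Omega>)"
    using assms by (auto simp: finite_modular_def)
  have "(\<integral>\<^sup>+x. ennreal (\<bar>f x\<bar> powr r) \<partial>lebesgue_on \<Omega>)
      \<le> (\<integral>\<^sup>+x. ennreal (B powr r) * ennreal (G x \<bar>f x / B\<bar>) \<partial>lebesgue_on \<Omega>)"
  proof (rule nn_integral_mono)
    fix x assume "x \<in> space (lebesgue_on \<Omega>)"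
    then have x: "x \<in> \<Omega>" by simp
    have "\<bar>f x\<bar> powr r = B powr r * \<bar>f x / B\<bar> powr r" using B by (simp add: abs_divide powr_divide)
    also have "\<dots> \<le> B powr r * G x \<bar>f x / B\<bar>"
      unfolding double_phase_def using a_nonneg[OF x] by (intro mult_left_mono) auto
    finally show "ennreal (\<bar>f x\<bar> powr r) \<le> ennreal (B powr r) * ennreal (G x \<bar>f x / B\<bar>)"
      using G_nonneg[OF x] by (simp flip: ennreal_mult add: ennreal_leI)
  qed
  also have "\<dots> = ennreal (B powr r) * modular \<Omega> G (\<lambda>x. f x / B)"
    unfolding modular_def by (rule nn_integral_cmult) measurable
  also have "\<dots> \<le> ennreal (B powr r) * 1"
    using luxemburg_le_iff[OF f B(1)] B by (intro mult_left_mono) auto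
  finally show ?thesis by simp
qed

end

section \<open>Test functions and integration by parts\<close>

lemma partial_deriv_eq: "(f has_derivative D) (at x) \<Longrightarrow> partial_deriv i f x = D (axis i 1)"
  unfolding partial_deriv_def using frechet_derivative_at[of f D x] by simp

lemma differentiable_has_frechet:
  "f differentiable at x \<Longrightarrow> (f has_derivative frechet_derivative f (at x)) (at x)"
  by (simp add: frechet_derivative_works)

lemma partial_deriv_add:
  assumes "f differentiable at x" "g differentiable at x"
  shows "partial_deriv i (\<lambda>x. f x + g x) x = partial_deriv i f x + partial_deriv i g x"
  by (subst partial_deriv_eq[OF has_derivative_add[OF assms[THEN differentiable_has_frechet]]])
    (simp add: partial_deriv_def)

lemma partial_deriv_cmult:
  assumes "f differentiable at x"
  shows "partial_deriv i (\<lambda>x. c * f x) x = c * partial_deriv i f x"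
  by (subst partial_deriv_eq[OF has_derivative_mult_right[OF assms[THEN differentiable_has_frechet]]])
    (simp add: partial_deriv_def)

lemma partial_deriv_mult:
  assumes "f differentiable at x" "g differentiable at x"
  shows "partial_deriv i (\<lambda>x. f x * g x) x = f x * partial_deriv i g x + partial_deriv i f x * g x"
  by (subst partial_deriv_eq[OF has_derivative_mult[OF assms[THEN differentiable_has_frechet]]])
    (simp add: partial_deriv_def)

lemma C_class_add: "C_class k f \<Longrightarrow> C_class k g \<Longrightarrow> C_class k (\<lambda>x. f x + g x)"
proof (induction k arbitrary: f g)
  case (Suc k)
  have "partial_deriv i (\<lambda>x. f x + g x) = (\<lambda>x. partial_deriv i f x + partial_deriv i g x)" for i
    using Suc.prems by (intro ext partial_deriv_add) auto
  then show ?case using Suc by (auto intro: differentiable_add)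
qed (auto intro: continuous_on_add)

lemma C_class_cmult: "C_class k f \<Longrightarrow> C_class k (\<lambda>x. c * f x)"
proof (induction k arbitrary: f)
  case (Suc k)
  have "partial_deriv i (\<lambda>x. c * f x) = (\<lambda>x. c * partial_deriv i f x)" for i
    using Suc.prems by (intro ext partial_deriv_cmult) auto
  then show ?case using Suc by (auto intro: differentiable_mult)
qed (auto intro: continuous_on_mult)

text \<open>A coinduction principle: smoothness follows from membership in a family closed under
  partial derivatives, without formulas for the higher ones.\<close>

lemma C_class_of_closed_family:
  assumes "f \<in> S" "\<And>f x. f \<in> S \<Longrightarrow> f differentiable at x" "\<And>f i. f \<in> S \<Longrightarrow> partial_deriv i f \<in> S"
  shows "C_class k f"
  using assms(1)
proof (induction k arbitrary: f)
  case 0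
  then show ?case using assms(2) by (simp add: continuous_at_imp_continuous_on differentiable_imp_continuous_within)
qed (use assms in auto)

lemma test_functions_add:
  assumes "f \<in> test_functions \<Omega>" "g \<in> test_functions \<Omega>"
  shows "(\<lambda>x. f x + g x) \<in> test_functions \<Omega>"
proof -
  let ?c = "\<lambda>f. closure {x. f x \<noteq> (0::real)}"
  have sub: "?c (\<lambda>x. f x + g x) \<subseteq> ?c f \<union> ?c g"
    unfolding closure_Un[symmetric] by (intro closure_mono) auto
  have "bounded ({x. f x \<noteq> 0} \<union> {x. g x \<noteq> 0})" using assms by (simp add: test_functions_def)
  then have "compact (?c (\<lambda>x. f x + g x))"
    unfolding compact_closure by (rule bounded_subset) auto
  then show ?thesis using assms sub by (auto simp: test_functions_def intro: C_class_add)
qed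

lemma test_functions_cmult:
  assumes "f \<in> test_functions \<Omega>"
  shows "(\<lambda>x. c * f x) \<in> test_functions \<Omega>"
proof -
  have "C_class k (\<lambda>x. c * f x)" for k
    using assms by (auto simp: test_functions_def intro: C_class_cmult)
  moreover have "{x. c * f x \<noteq> 0} = (if c = 0 then {} else {x. f x \<noteq> 0})" by auto
  ultimately show ?thesis using assms by (cases "c = 0") (simp_all add: test_functions_def)
qed

text \<open>The part of the test function property that the integral estimates use; unlike
  smoothness it is checked with one differentiation.\<close>

definition C1_compact :: "(real ^ 'n::finite \<Rightarrow> real) \<Rightarrow> bool" where
  "C1_compact f \<longleftrightarrow> (\<forall>x. f differentiable at x) \<and> (\<forall>i. continuous_on UNIV (partial_deriv i f)) \<and>
     bounded {x. f x \<noteq> 0}"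

definition gradient :: "(real ^ 'n::finite \<Rightarrow> real) \<Rightarrow> real ^ 'n \<Rightarrow> real ^ 'n" where
  "gradient f x = (\<chi> i. partial_deriv i f x)"

lemma test_functions_C1_compact: "f \<in> test_functions \<Omega> \<Longrightarrow> C1_compact f"
proof -
  assume f: "f \<in> test_functions \<Omega>"
  then have "C_class (Suc 0) f" unfolding test_functions_def by blast
  moreover have "bounded {x. f x \<noteq> 0}"
    using f by (auto simp: test_functions_def intro: bounded_subset[OF _ closure_subset] compact_imp_bounded)
  ultimately show ?thesis by (auto simp: C1_compact_def)
qed

lemma has_derivative_gradient:
  assumes "f differentiable at x"
  shows "(f has_derivative (\<lambda>h. gradient f x \<bullet> h)) (at x)"
proof -
  let ?D = "frechet_derivative f (at x)"
  have D: "(f has_derivative ?D) (at x)" by (rule differentiable_has_frechet[OF assms])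
  have "?D h = gradient f x \<bullet> h" for h
  proof -
    have "?D h = ?D (\<Sum>i\<in>UNIV. (h $ i) *\<^sub>R axis i 1)"
      using basis_expansion[of h] by (simp add: scalar_mult_eq_scaleR)
    also have "\<dots> = (\<Sum>i\<in>UNIV. (h $ i) *\<^sub>R ?D (axis i 1))"
      using has_derivative_linear[OF D] by (simp add: linear_sum linear_scale)
    also have "\<dots> = gradient f x \<bullet> h"
      by (simp add: gradient_def inner_vec_def partial_deriv_def mult.commute)
    finally show ?thesis .
  qed
  then show ?thesis using D by (metis (no_types, lifting) ext)
qed

lemma continuous_on_gradient: "C1_compact f \<Longrightarrow> continuous_on UNIV (gradient f)"
  unfolding gradient_def C1_compact_def by (intro continuous_on_vec_lambda) auto

lemma C1_compact_continuous: "C1_compact f \<Longrightarrow> continuous_on UNIV f"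
  by (simp add: C1_compact_def continuous_at_imp_continuous_on differentiable_imp_continuous_within)

lemma C1_compact_mult: "C1_compact f \<Longrightarrow> C1_compact g \<Longrightarrow> C1_compact (\<lambda>x. f x * g x)"
proof -
  assume f: "C1_compact f" and g: "C1_compact g"
  have "partial_deriv i (\<lambda>x. f x * g x) = (\<lambda>x. f x * partial_deriv i g x + partial_deriv i f x * g x)" for i
    using f g by (intro ext partial_deriv_mult) (auto simp: C1_compact_def)
  then have "continuous_on UNIV (partial_deriv i (\<lambda>x. f x * g x))" for i
    using f g C1_compact_continuous[OF f] C1_compact_continuous[OF g]
    by (auto simp: C1_compact_def intro!: continuous_intros)
  moreover have "bounded {x. f x * g x \<noteq> 0}"
    using f by (auto simp: C1_compact_def intro: bounded_subset)
  ultimately show ?thesis using f g by (auto simp: C1_compact_def intro: differentiable_mult)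
qed

lemma gradient_eq_0_outside: "x \<notin> closure {x. f x \<noteq> 0} \<Longrightarrow> gradient f x = 0"
proof -
  assume x: "x \<notin> closure {x. f x \<noteq> 0}"
  have "((\<lambda>_. 0) has_derivative (\<lambda>_. 0)) (at x)" by simp
  then have "(f has_derivative (\<lambda>_. 0)) (at x)"
  proof (rule has_derivative_transform_within_open)
    show "open (- closure {x. f x \<noteq> 0})" by auto
    show "\<And>y. y \<in> - closure {x. f x \<noteq> 0} \<Longrightarrow> 0 = f y" using closure_subset by force
  qed (use x in auto)
  then show ?thesis by (auto simp: gradient_def partial_deriv_eq vec_eq_iff)
qed

lemma C1_compact_bounds:
  assumes f: "C1_compact f"
  obtains R M where "0 \<le> R" "0 \<le> M" "\<And>x. \<bar>f x\<bar> \<le> M" "\<And>x. norm (gradient f x) \<le> M"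
    "\<And>x. R < norm x \<Longrightarrow> f x = 0"
proof -
  obtain R where R: "\<And>x. f x \<noteq> 0 \<Longrightarrow> norm x \<le> R" "0 \<le> R"
    using f unfolding C1_compact_def bounded_iff
    by (metis (mono_tags, lifting) dual_order.trans linorder_linear mem_Collect_eq)
  have "closure {x. f x \<noteq> 0} \<subseteq> cball 0 R" using R by (intro closure_minimal) auto
  then have g0: "gradient f x = 0" if "R < norm x" for x
    using that by (intro gradient_eq_0_outside) auto
  have "compact ((\<lambda>x. norm (gradient f x)) ` cball 0 R)" "compact ((\<lambda>x. \<bar>f x\<bar>) ` cball 0 R)"
    using continuous_on_gradient[OF f] C1_compact_continuous[OF f]
    by (auto intro!: compact_continuous_image continuous_intros intro: continuous_on_subset)
  then have "bdd_above ((\<lambda>x. norm (gradient f x)) ` cball 0 R)" "bdd_above ((\<lambda>x. \<bar>f x\<bar>) ` cball 0 R)"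
    by (auto intro: bounded_imp_bdd_above compact_imp_bounded)
  then obtain M1 M2 where "\<forall>z\<in>(\<lambda>x. norm (gradient f x)) ` cball 0 R. z \<le> M1" "\<forall>z\<in>(\<lambda>x. \<bar>f x\<bar>) ` cball 0 R. z \<le> M2"
    unfolding bdd_above_def by blast
  then have M: "norm (gradient f x) \<le> M1" "\<bar>f x\<bar> \<le> M2" if "x \<in> cball 0 R" for x
    using that by blast+
  define M where "M = max 0 (max M1 M2)"
  have "norm (gradient f x) \<le> M \<and> \<bar>f x\<bar> \<le> M" for x
  proof (cases "norm x \<le> R")
    case True
    then show ?thesis using M[of x] by (auto simp: M_def)
  next
    case False
    then have "f x = 0" using R(1) by blast
    then show ?thesis using g0[of x] False by (simp add: M_def)
  qed
  moreover have "R < norm x \<Longrightarrow> f x = 0" for x using R by force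
  ultimately show ?thesis using R(2) that[of R M] by (auto simp: M_def)
qed

lemma C1_compact_lipschitz:
  assumes f: "C1_compact f" and M: "\<And>x. norm (gradient f x) \<le> M"
  shows "\<bar>f x - f y\<bar> \<le> M * norm (x - y)"
proof -
  have "norm (f x - f y) \<le> M * norm (x - y)"
  proof (rule differentiable_bound[of UNIV f "\<lambda>x h. gradient f x \<bullet> h"])
    fix z
    show "(f has_derivative (\<lambda>h. gradient f z \<bullet> h)) (at z within UNIV)"
      using f by (auto simp: C1_compact_def intro: has_derivative_gradient)
    show "onorm (\<lambda>h. gradient f z \<bullet> h) \<le> M"
    proof (rule onorm_le)
      fix h
      show "norm (gradient f z \<bullet> h) \<le> M * norm h"
        using Cauchy_Schwarz_ineq2[of "gradient f z" h] mult_right_mono[OF M[of z], of "norm h"] by simp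
    qed
  qed auto
  then show ?thesis by simp
qed

text \<open>The step lengths \<open>1 / (k + 1)\<close> form a sequence, as dominated convergence
  wants, and \<open>k + 1\<close> such steps make up the whole translation by
  \<open>y\<close>.\<close>

definition diff_quotient :: "(real ^ 'n::finite \<Rightarrow> real) \<Rightarrow> real ^ 'n \<Rightarrow> nat \<Rightarrow> real ^ 'n \<Rightarrow> real" where
  "diff_quotient f y k x = real (Suc k) * (f (x + (1 / real (Suc k)) *\<^sub>R y) - f x)"

lemma diff_quotient_tendsto:
  assumes f: "C1_compact f"
  shows "(\<lambda>k. diff_quotient f y k x) \<longlonglongrightarrow> gradient f x \<bullet> y"
proof -
  have lin: "((\<lambda>t. x + t *\<^sub>R y) has_derivative (\<lambda>t. t *\<^sub>R y)) (at 0)"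
    by (auto intro!: derivative_eq_intros)
  have "(f has_derivative (\<lambda>h. gradient f x \<bullet> h)) (at (x + 0 *\<^sub>R y))"
    using f by (auto simp: C1_compact_def intro: has_derivative_gradient)
  then have "((\<lambda>t. f (x + t *\<^sub>R y)) has_derivative (\<lambda>t. gradient f x \<bullet> (t *\<^sub>R y))) (at 0)"
    using has_derivative_compose[of "\<lambda>t. x + t *\<^sub>R y" "\<lambda>t. t *\<^sub>R y" 0 UNIV f "\<lambda>h. gradient f x \<bullet> h"]
      lin by simp
  then have "((\<lambda>t. f (x + t *\<^sub>R y)) has_field_derivative (gradient f x \<bullet> y)) (at 0)"
    by (simp add: has_field_derivative_def mult_commute_abs)
  then have "(\<lambda>t. (f (x + t *\<^sub>R y) - f x) / t) \<midarrow>0\<rightarrow> gradient f x \<bullet> y"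
    by (simp add: has_field_derivative_iff)
  moreover have "filterlim (\<lambda>k. 1 / real (Suc k)) (at 0) sequentially"
    unfolding filterlim_at using LIMSEQ_inverse_real_of_nat by (auto simp: inverse_eq_divide)
  ultimately have "(\<lambda>k. (f (x + (1 / real (Suc k)) *\<^sub>R y) - f x) / (1 / real (Suc k))) \<longlonglongrightarrow> gradient f x \<bullet> y"
    by (rule filterlim_compose)
  then show ?thesis by (simp add: diff_quotient_def mult.commute)
qed

text \<open>A dominating function independent of \<open>k\<close>: the Lipschitz bound on a ball
  enlarged by \<open>norm y\<close>, outside of which both values of \<open>f\<close>
  vanish.\<close>

lemma diff_quotient_bounds:
  assumes f: "C1_compact f"
  obtains R M where "0 \<le> M" "\<And>k x. \<bar>diff_quotient f y k x\<bar> \<le> M * indicator (cball 0 R) x"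
proof -
  obtain R M where R: "0 \<le> R" "0 \<le> M" "\<And>x. norm (gradient f x) \<le> M" "\<And>x. R < norm x \<Longrightarrow> f x = 0"
    using C1_compact_bounds[OF f] by metis
  have "\<bar>diff_quotient f y k x\<bar> \<le> (M * norm y) * indicator (cball 0 (R + norm y)) x" for k x
  proof (cases "norm x \<le> R + norm y")
    case True
    have "\<bar>f (x + (1 / real (Suc k)) *\<^sub>R y) - f x\<bar> \<le> M * (norm y / real (Suc k))"
      using C1_compact_lipschitz[OF f R(3), of "x + (1 / real (Suc k)) *\<^sub>R y" x] by (simp add: divide_inverse mult.commute)
    then have "real (Suc k) * \<bar>f (x + (1 / real (Suc k)) *\<^sub>R y) - f x\<bar> \<le> real (Suc k) * (M * (norm y / real (Suc k)))"
      by (intro mult_left_mono) auto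
    also have "\<dots> = M * norm y" by simp
    finally show ?thesis using True by (simp add: diff_quotient_def abs_mult)
  next
    case False
    have "norm ((1 / real (Suc k)) *\<^sub>R y) \<le> norm y"
      by (simp add: divide_le_eq mult_left_le mult_le_cancel_left1)
    then have "norm (x + (1 / real (Suc k)) *\<^sub>R y) > R"
      using False norm_triangle_ineq2[of x "- ((1 / real (Suc k)) *\<^sub>R y)"] by simp
    moreover have "norm x > R" using False norm_ge_zero[of y] by linarith
    ultimately have "f (x + (1 / real (Suc k)) *\<^sub>R y) = 0" "f x = 0" using R(4) by auto
    then show ?thesis by (simp add: diff_quotient_def R(2))
  qed
  then show ?thesis using that[of "M * norm y"] R(2) by auto
qed

section \<open>Translation invariance and integration by parts\<close>

lemma C1_compact_borel [measurable]:
  "C1_compact f \<Longrightarrow> f \<in> borel_measurable borel" "C1_compact f \<Longrightarrow> gradient f \<in> borel_measurable borel"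
  by (auto intro: borel_measurable_continuous_onI C1_compact_continuous continuous_on_gradient)

lemma integrable_C1_compact: "C1_compact f \<Longrightarrow> integrable lborel f"
proof -
  assume f: "C1_compact f"
  obtain R M where "\<And>x. R < norm x \<Longrightarrow> f x = 0" using C1_compact_bounds[OF f] by metis
  then have eq: "f x = indicator (cball 0 R) x *\<^sub>R f x" for x
    by (cases "norm x \<le> R") (auto simp: not_le)
  have "integrable lborel (\<lambda>x. indicator (cball 0 R) x *\<^sub>R f x)"
    using C1_compact_continuous[OF f] by (intro borel_integrable_compact) (auto intro: continuous_on_subset)
  then show ?thesis using eq by (metis (no_types, lifting) ext)
qed

lemma lborel_translation:
  fixes f :: "'a::euclidean_space \<Rightarrow> real"
  assumes [measurable]: "f \<in> borel_measurable borel"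
  shows "integral\<^sup>L lborel (\<lambda>x. f (x + c)) = integral\<^sup>L lborel f"
    and "integrable lborel (\<lambda>x. f (x + c)) \<longleftrightarrow> integrable lborel f"
proof -
  have "integral\<^sup>L lborel f = integral\<^sup>L (distr lborel borel ((+) c)) f" by (simp add: lborel_distr_plus)
  also have "\<dots> = integral\<^sup>L lborel (\<lambda>x. f (x + c))"
    by (subst integral_distr) (auto simp: add.commute)
  finally show "integral\<^sup>L lborel (\<lambda>x. f (x + c)) = integral\<^sup>L lborel f" by simp
  have "integrable lborel f \<longleftrightarrow> integrable (distr lborel borel ((+) c)) f" by (simp add: lborel_distr_plus)
  also have "\<dots> \<longleftrightarrow> integrable lborel (\<lambda>x. f (x + c))"
    by (subst integrable_distr_eq) (auto simp: add.commute)
  finally show "integrable lborel (\<lambda>x. f (x + c)) \<longleftrightarrow> integrable lborel f" by simp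
qed

lemma nn_integral_lborel_translation:
  fixes f :: "'a::euclidean_space \<Rightarrow> ennreal"
  assumes [measurable]: "f \<in> borel_measurable borel"
  shows "(\<integral>\<^sup>+x. f (x + c) \<partial>lborel) = (\<integral>\<^sup>+x. f x \<partial>lborel)"
proof -
  have "(\<integral>\<^sup>+x. f x \<partial>lborel) = integral\<^sup>N (distr lborel borel ((+) c)) f" by (simp add: lborel_distr_plus)
  also have "\<dots> = (\<integral>\<^sup>+x. f (x + c) \<partial>lborel)"
    by (subst nn_integral_distr) (auto simp: add.commute)
  finally show ?thesis by simp
qed

text \<open>By translation invariance every difference quotient has integral 0, and dominated
  convergence passes this on to the directional derivative.\<close>

lemma integral_gradient_eq_0:
  assumes f: "C1_compact f"
  shows "integral\<^sup>L lborel (\<lambda>x. gradient f x \<bullet> y) = 0"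
proof -
  note [measurable] = C1_compact_borel[OF f]
  obtain R M where M: "0 \<le> M" "\<And>k x. \<bar>diff_quotient f y k x\<bar> \<le> M * indicator (cball 0 R) x"
    using diff_quotient_bounds[OF f, of y] by metis
  have "integrable lborel (\<lambda>x. indicator (cball 0 R) x *\<^sub>R M)"
    by (intro borel_integrable_compact) auto
  then have int: "integrable lborel (\<lambda>x. M * indicator (cball 0 R) x)" by (simp add: mult.commute)
  have "(\<lambda>k. integral\<^sup>L lborel (diff_quotient f y k)) \<longlonglongrightarrow> integral\<^sup>L lborel (\<lambda>x. gradient f x \<bullet> y)"
  proof (rule integral_dominated_convergence[OF _ _ int])
    show "diff_quotient f y k \<in> borel_measurable lborel" for k
      unfolding diff_quotient_def[abs_def] by measurable
    show "AE x in lborel. (\<lambda>k. diff_quotient f y k x) \<longlonglongrightarrow> gradient f x \<bullet> y"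
      using diff_quotient_tendsto[OF f] by auto
    show "\<And>k. AE x in lborel. norm (diff_quotient f y k x) \<le> M * indicator (cball 0 R) x"
      using M by auto
  qed measurable
  moreover have "integral\<^sup>L lborel (diff_quotient f y k) = 0" for k
    unfolding diff_quotient_def[abs_def]
    using integrable_C1_compact[OF f] lborel_translation[of f "(1 / real (Suc k)) *\<^sub>R y"]
    by (simp add: Bochner_Integration.integral_diff)
  ultimately show ?thesis by (simp add: LIMSEQ_const_iff)
qed

lemma gradient_component: "gradient f x \<bullet> axis i 1 = partial_deriv i f x"
  by (simp add: gradient_def inner_axis)

text \<open>The product rule applied to the vanishing integral of a partial derivative of
  \<open>f * g\<close>. Each term has the compact support of one undifferentiated factor, whence its
  integrability.\<close>

lemma integration_by_parts:
  assumes f: "C1_compact f" and g: "C1_compact g"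
  shows "integral\<^sup>L lborel (\<lambda>x. f x * partial_deriv i g x) = - integral\<^sup>L lborel (\<lambda>x. partial_deriv i f x * g x)"
proof -
  note [measurable] = C1_compact_borel[OF f] C1_compact_borel[OF g]
  have pd: "partial_deriv i h = (\<lambda>x. gradient h x \<bullet> axis i 1)" for h :: "real^'a \<Rightarrow> real"
    by (simp add: gradient_component)
  obtain R1 M1 where 1: "\<And>x. R1 < norm x \<Longrightarrow> f x = 0" using C1_compact_bounds[OF f] by metis
  obtain R2 M2 where 2: "\<And>x. R2 < norm x \<Longrightarrow> g x = 0" using C1_compact_bounds[OF g] by metis
  have "integrable lborel (\<lambda>x. indicator (cball 0 R1) x *\<^sub>R (f x * partial_deriv i g x))"
    using C1_compact_continuous[OF f] g
    by (intro borel_integrable_compact continuous_intros) (auto simp: C1_compact_def intro: continuous_on_subset)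
  moreover have "(\<lambda>x. indicator (cball 0 R1) x *\<^sub>R (f x * partial_deriv i g x)) = (\<lambda>x. f x * partial_deriv i g x)"
  proof
    fix x show "indicator (cball 0 R1) x *\<^sub>R (f x * partial_deriv i g x) = f x * partial_deriv i g x"
      using 1[of x] by (cases "norm x \<le> R1") (simp_all add: not_le)
  qed
  ultimately have i1: "integrable lborel (\<lambda>x. f x * partial_deriv i g x)" by (simp only:)
  have "integrable lborel (\<lambda>x. indicator (cball 0 R2) x *\<^sub>R (partial_deriv i f x * g x))"
    using C1_compact_continuous[OF g] f
    by (intro borel_integrable_compact continuous_intros) (auto simp: C1_compact_def intro: continuous_on_subset)
  moreover have "(\<lambda>x. indicator (cball 0 R2) x *\<^sub>R (partial_deriv i f x * g x)) = (\<lambda>x. partial_deriv i f x * g x)"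
  proof
    fix x show "indicator (cball 0 R2) x *\<^sub>R (partial_deriv i f x * g x) = partial_deriv i f x * g x"
      using 2[of x] by (cases "norm x \<le> R2") (simp_all add: not_le)
  qed
  ultimately have i2: "integrable lborel (\<lambda>x. partial_deriv i f x * g x)" by (simp only:)
  have "gradient (\<lambda>x. f x * g x) x \<bullet> axis i 1 = f x * partial_deriv i g x + partial_deriv i f x * g x" for x
    unfolding gradient_component using f g by (intro partial_deriv_mult) (auto simp: C1_compact_def)
  then have "0 = integral\<^sup>L lborel (\<lambda>x. f x * partial_deriv i g x + partial_deriv i f x * g x)"
    using integral_gradient_eq_0[OF C1_compact_mult[OF f g], of "axis i 1"] by simp
  then show ?thesis using i1 i2 by simp
qed

section \<open>Weak gradients up to null sets\<close>

lemma measurable_lebesgue_on_AE_cong: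
  fixes f g :: "real ^ 'n::finite \<Rightarrow> 'b::euclidean_space"
  assumes "S \<in> sets lebesgue" "f \<in> borel_measurable (lebesgue_on S)" "AE x in lebesgue_on S. f x = g x"
  shows "g \<in> borel_measurable (lebesgue_on S)"
proof -
  have "(\<lambda>x. if x \<in> S then f x else 0) \<in> borel_measurable lebesgue"
    using assms borel_measurable_if_lebesgue_on[of S UNIV f] by (simp add: lebesgue_on_UNIV_eq)
  moreover have "AE x in lebesgue. (if x \<in> S then f x else 0) = (if x \<in> S then g x else 0)"
    using assms by (auto simp: AE_restrict_space_iff elim: eventually_mono)
  ultimately have "(\<lambda>x. if x \<in> S then g x else 0) \<in> borel_measurable lebesgue"
    by (rule borel_measurable_AE)
  then show ?thesis
    using assms borel_measurable_if_lebesgue_on[of S UNIV g] by (simp add: lebesgue_on_UNIV_eq)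
qed

lemma AE_lebesgue_on_subset:
  assumes "S \<in> sets lebesgue" "T \<in> sets lebesgue" "S \<subseteq> T" "AE x in lebesgue_on T. P x"
  shows "AE x in lebesgue_on S. P x"
  using assms by (auto simp: AE_restrict_space_iff elim!: eventually_mono)

text \<open>Elements of \<open>aefun\<close> are accessed through an arbitrary representative, so
  weak gradients have to survive changes on null sets.\<close>

lemma weak_gradient_AE_cong:
  assumes \<Omega>: "open \<Omega>" and wg: "weak_gradient \<Omega> u g"
    and u: "AE x in lebesgue_on \<Omega>. u x = u' x" and g: "AE x in lebesgue_on \<Omega>. g x = g' x"
  shows "weak_gradient \<Omega> u' g'"
proof -
  have S: "\<Omega> \<in> sets lebesgue" using \<Omega> by auto
  have meas: "u \<in> borel_measurable (lebesgue_on \<Omega>)" "g \<in> borel_measurable (lebesgue_on \<Omega>)"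
    using wg by (auto simp: weak_gradient_def)
  have meas': "u' \<in> borel_measurable (lebesgue_on \<Omega>)" "g' \<in> borel_measurable (lebesgue_on \<Omega>)"
    using measurable_lebesgue_on_AE_cong[OF S meas(1) u] measurable_lebesgue_on_AE_cong[OF S meas(2) g] .
  have int: "integrable (lebesgue_on C) u'" "integrable (lebesgue_on C) g'" if C: "compact C" "C \<subseteq> \<Omega>" for C
  proof -
    have CS: "C \<in> sets lebesgue" using C lmeasurable_compact fmeasurableD by blast
    have *: "f' \<in> borel_measurable (lebesgue_on C)" if "f' \<in> borel_measurable (lebesgue_on \<Omega>)"
      for f' :: "real^'a \<Rightarrow> 'c::euclidean_space"
      using measurable_restrict_mono[OF that C(2)] by simp
    have "AE x in lebesgue_on C. u x = u' x" "AE x in lebesgue_on C. g x = g' x"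
      using AE_lebesgue_on_subset[OF CS S C(2)] u g by auto
    moreover have "integrable (lebesgue_on C) u" "integrable (lebesgue_on C) g"
      using wg C by (auto simp: weak_gradient_def)
    ultimately show "integrable (lebesgue_on C) u'" "integrable (lebesgue_on C) g'"
      using integrable_cong_AE_imp[of "lebesgue_on C" u u'] integrable_cong_AE_imp[of "lebesgue_on C" g g']
        *[OF meas'(1)] *[OF meas'(2)] by blast+
  qed
  have pdm: "partial_deriv i \<phi> \<in> borel_measurable (lebesgue_on \<Omega>)" "\<phi> \<in> borel_measurable (lebesgue_on \<Omega>)"
    if "\<phi> \<in> test_functions \<Omega>" for \<phi> i
    using test_functions_C1_compact[OF that] C1_compact_continuous
    by (auto simp: C1_compact_def intro!: continuous_imp_measurable_on_sets_lebesgue S intro: continuous_on_subset)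
  have comp: "(\<lambda>x. h x $ i) \<in> borel_measurable (lebesgue_on \<Omega>)" if "h \<in> borel_measurable (lebesgue_on \<Omega>)"
    for h :: "real^'a \<Rightarrow> real^'a" and i
    using borel_measurable_inner[OF that measurable_const[of "axis i 1"]] by (simp add: inner_axis)
  have "(\<integral>x. u' x * partial_deriv i \<phi> x \<partial>lebesgue_on \<Omega>) = - (\<integral>x. g' x $ i * \<phi> x \<partial>lebesgue_on \<Omega>)"
    if \<phi>: "\<phi> \<in> test_functions \<Omega>" for \<phi> i
  proof -
    have "(\<integral>x. u' x * partial_deriv i \<phi> x \<partial>lebesgue_on \<Omega>) = (\<integral>x. u x * partial_deriv i \<phi> x \<partial>lebesgue_on \<Omega>)"
      using u by (intro integral_cong_AE borel_measurable_times meas meas' pdm \<phi>) (auto elim: eventually_mono)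
    also have "\<dots> = - (\<integral>x. g x $ i * \<phi> x \<partial>lebesgue_on \<Omega>)"
      using wg \<phi> by (auto simp: weak_gradient_def)
    also have "(\<integral>x. g x $ i * \<phi> x \<partial>lebesgue_on \<Omega>) = (\<integral>x. g' x $ i * \<phi> x \<partial>lebesgue_on \<Omega>)"
      using g by (intro integral_cong_AE borel_measurable_times comp meas meas' pdm \<phi>) (auto elim: eventually_mono)
    finally show ?thesis .
  qed
  then show ?thesis using meas' int by (auto simp: weak_gradient_def)
qed

lemma test_function_eq_0: "\<phi> \<in> test_functions \<Omega> \<Longrightarrow> x \<notin> \<Omega> \<Longrightarrow> \<phi> x = 0"
  unfolding test_functions_def using closure_subset[of "{x. \<phi> x \<noteq> 0}"] by auto

lemma partial_deriv_test_function_eq_0: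
  "\<phi> \<in> test_functions \<Omega> \<Longrightarrow> x \<notin> closure {x. \<phi> x \<noteq> 0} \<Longrightarrow> partial_deriv i \<phi> x = 0"
  using gradient_eq_0_outside[of x \<phi>] by (simp add: gradient_def vec_eq_iff)

lemma integral_lebesgue_on_eq_lborel:
  fixes f :: "real ^ 'n::finite \<Rightarrow> real"
  assumes "open \<Omega>" "f \<in> borel_measurable borel" "\<And>x. x \<notin> \<Omega> \<Longrightarrow> f x = 0"
  shows "integral\<^sup>L (lebesgue_on \<Omega>) f = integral\<^sup>L lborel f"
proof -
  have "(\<lambda>x. indicator \<Omega> x *\<^sub>R f x) = f"
  proof
    fix x show "indicator \<Omega> x *\<^sub>R f x = f x" using assms(3)[of x] by (cases "x \<in> \<Omega>") simp_all
  qed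
  then show ?thesis
    using assms(1,2) integral_restrict_space[of \<Omega> lebesgue f] integral_completion[of f lborel] by simp
qed

text \<open>Both functions vanish off the domain, so the identity is integration by parts on the
  whole space and produces no boundary terms.\<close>

lemma weak_gradient_test_function:
  assumes \<Omega>: "open \<Omega>" and \<phi>: "\<phi> \<in> test_functions \<Omega>"
  shows "weak_gradient \<Omega> \<phi> (gradient \<phi>)"
  unfolding weak_gradient_def
proof (intro conjI allI impI ballI)
  have c1: "C1_compact \<phi>" by (rule test_functions_C1_compact[OF \<phi>])
  note [measurable] = C1_compact_borel[OF c1]
  have cont: "continuous_on C \<phi>" "continuous_on C (gradient \<phi>)" for C
    using C1_compact_continuous[OF c1] continuous_on_gradient[OF c1] by (auto intro: continuous_on_subset)
  show "\<phi> \<in> borel_measurable (lebesgue_on \<Omega>)" "gradient \<phi> \<in> borel_measurable (lebesgue_on \<Omega>)"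
    using cont \<Omega> by (auto intro: continuous_imp_measurable_on_sets_lebesgue)
  show "integrable (lebesgue_on C) \<phi>" "integrable (lebesgue_on C) (gradient \<phi>)" if "compact C \<and> C \<subseteq> \<Omega>" for C
  proof -
    have "integrable lborel (\<lambda>x. indicator C x *\<^sub>R \<phi> x)" "integrable lborel (\<lambda>x. indicator C x *\<^sub>R gradient \<phi> x)"
      using that cont by (intro borel_integrable_compact; simp)+
    moreover have "C \<in> sets lebesgue" using that lmeasurable_compact fmeasurableD by blast
    moreover have [measurable]: "C \<in> sets borel" using that by (auto intro: borel_closed compact_imp_closed)
    ultimately show "integrable (lebesgue_on C) \<phi>" "integrable (lebesgue_on C) (gradient \<phi>)"
      by (simp_all add: integrable_restrict_space integrable_completion)
  qed
  fix \<psi> i assume \<psi>: "\<psi> \<in> test_functions \<Omega>"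
  have c2: "C1_compact \<psi>" by (rule test_functions_C1_compact[OF \<psi>])
  note [measurable] = C1_compact_borel[OF c2]
  have pd [measurable]: "partial_deriv i \<phi> \<in> borel_measurable borel" "partial_deriv i \<psi> \<in> borel_measurable borel"
    using c1 c2 by (auto simp: C1_compact_def intro: borel_measurable_continuous_onI)
  have "(\<integral>x. \<phi> x * partial_deriv i \<psi> x \<partial>lebesgue_on \<Omega>) = integral\<^sup>L lborel (\<lambda>x. \<phi> x * partial_deriv i \<psi> x)"
    using \<Omega> test_function_eq_0[OF \<phi>] by (intro integral_lebesgue_on_eq_lborel) auto
  also have "\<dots> = - integral\<^sup>L lborel (\<lambda>x. partial_deriv i \<phi> x * \<psi> x)"
    by (rule integration_by_parts[OF c1 c2])
  also have "integral\<^sup>L lborel (\<lambda>x. partial_deriv i \<phi> x * \<psi> x) = (\<integral>x. partial_deriv i \<phi> x * \<psi> x \<partial>lebesgue_on \<Omega>)"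
    using \<Omega> test_function_eq_0[OF \<psi>] by (intro integral_lebesgue_on_eq_lborel[symmetric]) auto
  finally show "(\<integral>x. \<phi> x * partial_deriv i \<psi> x \<partial>lebesgue_on \<Omega>) = - (\<integral>x. gradient \<phi> x $ i * \<psi> x \<partial>lebesgue_on \<Omega>)"
    by (simp add: gradient_def)
qed

section \<open>Bump functions and the fundamental lemma of the calculus of variations\<close>

text \<open>The powers of \<open>1 / x\<close> are carried along because derivatives of
  \<open>exp (- 1 / x)\<close> are combinations of these functions; every one of them is flat at
  0.\<close>

definition flat :: "nat \<Rightarrow> real \<Rightarrow> real" where
  "flat k x = (if x \<le> 0 then 0 else inverse x ^ k * exp (- inverse x))"

lemma flat_tendsto_0: "(flat k \<longlongrightarrow> 0) (at 0)"
proof (rule filterlim_split_at)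
  show "(flat k \<longlongrightarrow> 0) (at_left 0)"
    by (rule tendsto_eventually) (auto simp: flat_def eventually_at_left_field intro: exI[of _ "-1"])
  have "((\<lambda>x. inverse x ^ k / exp (inverse x)) \<longlongrightarrow> 0) (at_right (0::real))"
    by (rule filterlim_compose[OF tendsto_power_div_exp_0 filterlim_inverse_at_top_right])
  moreover have "eventually (\<lambda>x. inverse x ^ k / exp (inverse x) = flat k x) (at_right 0)"
    unfolding eventually_at_right_field by (intro exI[of _ 1]) (auto simp: flat_def exp_minus divide_inverse)
  ultimately show "(flat k \<longlongrightarrow> 0) (at_right 0)" by (rule Lim_transform_eventually)
qed

lemma flat_has_derivative:
  "(flat k has_field_derivative (flat (k + 2) x - real k * flat (k + 1) x)) (at x)"
proof -
  consider "x < 0" | "x = 0" | "0 < x" by linarith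
  then show ?thesis
  proof cases
    case 1
    have "((\<lambda>_. 0) has_field_derivative 0) (at x)" by simp
    then have "(flat k has_field_derivative 0) (at x)"
      by (rule has_field_derivative_transform_within_open[of _ _ _ "{..<0}"]) (use 1 in \<open>auto simp: flat_def\<close>)
    then show ?thesis using 1 by (simp add: flat_def)
  next
    case 2
    \<comment> \<open>At 0 the difference quotient of \<open>flat k\<close> is
      \<open>flat (k + 1)\<close> itself, so differentiability is the limit already shown, with
      \<open>k + 1\<close> for \<open>k\<close>.\<close>
    have "eventually (\<lambda>t. flat (k + 1) t = (flat k t - flat k 0) / (t - 0)) (at 0)"
      by (rule eventuallyI) (simp add: flat_def divide_inverse)
    then have "((\<lambda>t. (flat k t - flat k 0) / (t - 0)) \<longlongrightarrow> 0) (at 0)"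
      by (rule Lim_transform_eventually[OF flat_tendsto_0])
    then show ?thesis using 2 by (simp add: has_field_derivative_iff flat_def)
  next
    case 3
    \<comment> \<open>The exponent \<open>k - 1\<close> is truncated at \<open>k = 0\<close>, where
      the factor \<open>real k\<close> annihilates the term.\<close>
    have pw: "real k * inverse x ^ (k - 1) * inverse x = real k * inverse x ^ k" by (cases k) auto
    have "((\<lambda>x. inverse x ^ k * exp (- inverse x)) has_field_derivative
        (real k * inverse x ^ (k - 1) * inverse x * (- inverse x)) * exp (- inverse x)
          + inverse x ^ k * (exp (- inverse x) * (inverse x * inverse x))) (at x)"
      using 3 by (auto intro!: derivative_eq_intros simp: power2_eq_square)
    also have "(real k * inverse x ^ (k - 1) * inverse x * (- inverse x)) * exp (- inverse x)
          + inverse x ^ k * (exp (- inverse x) * (inverse x * inverse x))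
        = inverse x ^ (k + 2) * exp (- inverse x) - real k * (inverse x ^ (k + 1) * exp (- inverse x))"
      unfolding pw by (simp add: algebra_simps)
    finally have "((\<lambda>x. inverse x ^ k * exp (- inverse x)) has_field_derivative
        (inverse x ^ (k + 2) * exp (- inverse x) - real k * (inverse x ^ (k + 1) * exp (- inverse x)))) (at x)" .
    then have "(flat k has_field_derivative
        (inverse x ^ (k + 2) * exp (- inverse x) - real k * (inverse x ^ (k + 1) * exp (- inverse x)))) (at x)"
      by (rule has_field_derivative_transform_within_open[of _ _ _ "{0<..}"]) (use 3 in \<open>auto simp: flat_def\<close>)
    then show ?thesis using 3 by (simp add: flat_def)
  qed
qed

text \<open>The algebra generated by constants and flat functions of affine functions of one
  coordinate. It contains the bump functions and is the family closed under partial derivatives that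
  proves them smooth.\<close>

inductive_set flat_algebra :: "(real ^ 'n::finite \<Rightarrow> real) set" where
  flat: "(\<lambda>x. flat k (c * x $ j + d)) \<in> flat_algebra"
| const: "(\<lambda>x. c) \<in> flat_algebra"
| add: "f \<in> flat_algebra \<Longrightarrow> g \<in> flat_algebra \<Longrightarrow> (\<lambda>x. f x + g x) \<in> flat_algebra"
| mult: "f \<in> flat_algebra \<Longrightarrow> g \<in> flat_algebra \<Longrightarrow> (\<lambda>x. f x * g x) \<in> flat_algebra"

lemma flat_algebra_deriv:
  fixes f :: "real ^ 'n::finite \<Rightarrow> real"
  assumes "f \<in> flat_algebra"
  shows "(\<forall>x. f differentiable at x) \<and> (\<forall>i. partial_deriv i f \<in> flat_algebra)"
  using assms
proof induction
  case (flat k c j d)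
  let ?D = "\<lambda>x. flat (k + 2) (c * x $ j + d) - real k * flat (k + 1) (c * x $ j + d)"
  have der: "((\<lambda>x::real^'n. flat k (c * x $ j + d)) has_derivative (\<lambda>h. c * h $ j * ?D x)) (at x)" for x
    by (rule DERIV_compose_FDERIV[OF flat_has_derivative])
      (auto intro!: derivative_eq_intros bounded_linear_imp_has_derivative[OF bounded_linear_vec_nth])
  have "partial_deriv i (\<lambda>x::real^'n. flat k (c * x $ j + d))
      = (\<lambda>x. (if i = j then c else 0) * (flat (k + 2) (c * x $ j + d) + (- real k) * flat (k + 1) (c * x $ j + d)))" for i
    by (rule ext) (auto simp: partial_deriv_eq[OF der] axis_def)
  then have "partial_deriv i (\<lambda>x::real^'n. flat k (c * x $ j + d)) \<in> flat_algebra" for i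
    by (simp only:) (intro flat_algebra.intros)
  then show ?case using der by (auto simp: differentiable_def)
next
  case (const c)
  have "partial_deriv i (\<lambda>x::real^'n. c) = (\<lambda>_. 0)" for i
    by (rule ext) (simp add: partial_deriv_eq[OF has_derivative_const])
  then show ?case by (auto intro: flat_algebra.const)
next
  case (add f g)
  have "partial_deriv i (\<lambda>x. f x + g x) = (\<lambda>x. partial_deriv i f x + partial_deriv i g x)" for i
    using add by (intro ext partial_deriv_add) auto
  then show ?case using add by (auto intro: differentiable_add flat_algebra.add)
next
  case (mult f g)
  have "partial_deriv i (\<lambda>x. f x * g x) = (\<lambda>x. f x * partial_deriv i g x + partial_deriv i f x * g x)" for i
    using mult by (intro ext partial_deriv_mult) auto
  moreover have "(\<lambda>x. f x * partial_deriv i g x + partial_deriv i f x * g x) \<in> flat_algebra" for i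
    using mult by (intro flat_algebra.add flat_algebra.mult) auto
  ultimately show ?case using mult by (auto intro: differentiable_mult)
qed

lemma flat_algebra_prod: "finite J \<Longrightarrow> (\<And>j. j \<in> J \<Longrightarrow> f j \<in> flat_algebra) \<Longrightarrow> (\<lambda>x. \<Prod>j\<in>J. f j x) \<in> flat_algebra"
  by (induction J rule: finite_induct) (auto intro: flat_algebra.const flat_algebra.mult)

text \<open>Since \<open>flat 0 x = exp (- 1 / x)\<close> for \<open>x > 0\<close>, rescaling the argument amounts to taking roots
  and makes the bump functions converge to the indicator function of the box.\<close>

definition box_bump :: "real ^ 'n::finite \<Rightarrow> real ^ 'n \<Rightarrow> nat \<Rightarrow> real ^ 'n \<Rightarrow> real" where
  "box_bump a b k x = (\<Prod>j\<in>UNIV. flat 0 (real (Suc k) * (x $ j - a $ j)) * flat 0 (real (Suc k) * (b $ j - x $ j)))"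

lemma flat_0_bounds: "0 \<le> flat 0 x" "flat 0 x \<le> 1"
  by (auto simp: flat_def)

lemma box_bump_bounds: "0 \<le> box_bump a b k x" "box_bump a b k x \<le> 1"
  unfolding box_bump_def
  by (auto intro!: prod_nonneg prod_le_1 mult_nonneg_nonneg mult_le_one simp: flat_0_bounds)

lemma box_bump_eq_0: "x \<notin> box a b \<Longrightarrow> box_bump a b k x = 0"
  by (auto simp: box_bump_def mem_box_cart flat_def not_less mult_le_0_iff)

lemma box_bump_tendsto: "(\<lambda>k. box_bump a b k x) \<longlonglongrightarrow> indicator (box a b) x"
proof (cases "x \<in> box a b")
  case True
  have *: "(\<lambda>k. flat 0 (real (Suc k) * t)) \<longlonglongrightarrow> 1" if "0 < t" for t
  proof -
    have "(\<lambda>k. exp (- (inverse (real (Suc k)) * inverse t))) \<longlonglongrightarrow> exp (- (0 * inverse t))"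
      by (intro tendsto_intros LIMSEQ_inverse_real_of_nat)
    moreover have "flat 0 (real (Suc k) * t) = exp (- (inverse (real (Suc k)) * inverse t))" for k
      using that by (simp add: flat_def mult_le_0_iff)
    ultimately show ?thesis by simp
  qed
  have "(\<lambda>k. box_bump a b k x) \<longlonglongrightarrow> (\<Prod>j\<in>(UNIV::'a set). 1 * 1)"
    unfolding box_bump_def using True by (intro tendsto_prod tendsto_mult *) (auto simp: mem_box_cart)
  then show ?thesis using True by simp
qed (simp add: box_bump_eq_0)

lemma box_bump_test_function:
  assumes "cbox a b \<subseteq> \<Omega>"
  shows "box_bump a b k \<in> test_functions \<Omega>"
proof -
  have "(\<lambda>x. flat 0 (real (Suc k) * x $ j + (- real (Suc k) * a $ j)) *
      flat 0 ((- real (Suc k)) * x $ j + (real (Suc k) * b $ j))) \<in> flat_algebra" for j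
    by (intro flat_algebra.intros)
  then have "(\<lambda>x. \<Prod>j\<in>UNIV. flat 0 (real (Suc k) * x $ j + (- real (Suc k) * a $ j)) *
      flat 0 ((- real (Suc k)) * x $ j + (real (Suc k) * b $ j))) \<in> flat_algebra"
    by (intro flat_algebra_prod) auto
  also have "(\<lambda>x. \<Prod>j\<in>UNIV. flat 0 (real (Suc k) * x $ j + (- real (Suc k) * a $ j)) *
      flat 0 ((- real (Suc k)) * x $ j + (real (Suc k) * b $ j))) = box_bump a b k"
    by (rule ext) (simp add: box_bump_def algebra_simps)
  finally have "C_class l (box_bump a b k)" for l
    using flat_algebra_deriv by (intro C_class_of_closed_family[where S = flat_algebra]) auto
  moreover have sub: "closure {x. box_bump a b k x \<noteq> 0} \<subseteq> cbox a b"
    using box_bump_eq_0 box_subset_cbox[of a b] by (intro closure_minimal) (auto, blast)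
  moreover have "bounded {x. box_bump a b k x \<noteq> 0}"
    using sub closure_subset bounded_cbox[of a b] by (metis bounded_subset)
  ultimately show ?thesis using assms by (auto simp: test_functions_def)
qed

text \<open>The bumps converge to the indicator of the open box and are dominated by that of the
  closed one, on which \<open>w\<close> is integrable. The faces between the two boxes are null
  sets.\<close>

lemma fundamental_lemma_box:
  fixes w :: "real ^ 'n::finite \<Rightarrow> real"
  assumes \<Omega>: "open \<Omega>" and box: "cbox a b \<subseteq> \<Omega>" and w: "w \<in> borel_measurable (lebesgue_on \<Omega>)"
    and int: "integrable (lebesgue_on (cbox a b)) w"
    and zero: "\<And>\<phi>. \<phi> \<in> test_functions \<Omega> \<Longrightarrow> (\<integral>x. w x * \<phi> x \<partial>lebesgue_on \<Omega>) = 0"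
  shows "integral (cbox a b) w = 0"
proof -
  have S [measurable]: "\<Omega> \<in> sets lebesgue" using \<Omega> by auto
  have int': "integrable lebesgue (\<lambda>x. indicator (cbox a b) x *\<^sub>R w x)"
    using int by (subst (asm) integrable_restrict_space) auto
  have w' [measurable]: "(\<lambda>x. indicator \<Omega> x *\<^sub>R w x) \<in> borel_measurable lebesgue"
    using w by (subst (asm) borel_measurable_restrict_space_iff) auto
  have "(\<lambda>k. \<integral>x. indicator \<Omega> x *\<^sub>R (w x * box_bump a b k x) \<partial>lebesgue)
      \<longlonglongrightarrow> (\<integral>x. indicator (box a b) x *\<^sub>R w x \<partial>lebesgue)"
  proof (rule integral_dominated_convergence[OF _ _ integrable_norm[OF int']])
    have bm [measurable]: "box_bump a b k \<in> borel_measurable lebesgue" for k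
      using C1_compact_borel(1)[OF test_functions_C1_compact[OF box_bump_test_function[OF box]]]
      by (simp add: measurable_completion)
    show "(\<lambda>x. indicator \<Omega> x *\<^sub>R (w x * box_bump a b k x)) \<in> borel_measurable lebesgue" for k
      using borel_measurable_times[OF w' bm[of k]] by (simp add: mult.assoc)
    have "(\<lambda>x. indicator (box a b) x * (indicator \<Omega> x *\<^sub>R w x)) \<in> borel_measurable lebesgue"
      by (intro borel_measurable_times borel_measurable_indicator w') auto
    moreover have "(\<lambda>x. indicator (box a b) x * (indicator \<Omega> x *\<^sub>R w x)) = (\<lambda>x. indicator (box a b) x *\<^sub>R w x)"
      using box box_subset_cbox[of a b] by (auto simp: fun_eq_iff indicator_def)
    ultimately show "(\<lambda>x. indicator (box a b) x *\<^sub>R w x) \<in> borel_measurable lebesgue" by simp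
    show "AE x in lebesgue. (\<lambda>k. indicator \<Omega> x *\<^sub>R (w x * box_bump a b k x)) \<longlonglongrightarrow> indicator (box a b) x *\<^sub>R w x"
    proof (rule AE_I2)
      fix x
      have "(\<lambda>k. indicator \<Omega> x *\<^sub>R (w x * box_bump a b k x)) \<longlonglongrightarrow> indicator \<Omega> x *\<^sub>R (w x * indicator (box a b) x)"
        by (intro tendsto_intros box_bump_tendsto)
      moreover have "indicator \<Omega> x *\<^sub>R (w x * indicator (box a b) x) = indicator (box a b) x *\<^sub>R w x"
        using box box_subset_cbox[of a b] by (auto simp: indicator_def)
      ultimately show "(\<lambda>k. indicator \<Omega> x *\<^sub>R (w x * box_bump a b k x)) \<longlonglongrightarrow> indicator (box a b) x *\<^sub>R w x"
        by (simp only:)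
    qed
    show "AE x in lebesgue. norm (indicator \<Omega> x *\<^sub>R (w x * box_bump a b k x)) \<le> norm (indicator (cbox a b) x *\<^sub>R w x)" for k
    proof (rule AE_I2)
      fix x
      show "norm (indicator \<Omega> x *\<^sub>R (w x * box_bump a b k x)) \<le> norm (indicator (cbox a b) x *\<^sub>R w x)"
      proof (cases "x \<in> box a b")
        case True
        then have x: "x \<in> \<Omega>" "x \<in> cbox a b" using box box_subset_cbox[of a b] by auto
        have "\<bar>w x\<bar> * box_bump a b k x \<le> \<bar>w x\<bar>"
          using box_bump_bounds[of a b k x] by (intro mult_left_le) auto
        then show ?thesis using x box_bump_bounds[of a b k x] by (simp add: abs_mult)
      qed (simp add: box_bump_eq_0)
    qed
  qed
  moreover have "(\<integral>x. indicator \<Omega> x *\<^sub>R (w x * box_bump a b k x) \<partial>lebesgue) = 0" for k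
    using zero[OF box_bump_test_function[OF box, of k]] integral_restrict_space[of \<Omega> lebesgue "\<lambda>x. w x * box_bump a b k x"]
    by simp
  ultimately have 0: "(\<integral>x. indicator (box a b) x *\<^sub>R w x \<partial>lebesgue) = 0" by (simp add: LIMSEQ_const_iff)
  have neg: "AE x in lebesgue. x \<notin> cbox a b - box a b"
    unfolding eventually_ae_filter_negligible using negligible_frontier_interval[of a b] by auto
  have "integral (cbox a b) w = (\<integral>x. w x \<partial>lebesgue_on (cbox a b))"
    using int by (intro lebesgue_integral_eq_integral[symmetric]) auto
  also have "\<dots> = (\<integral>x. indicator (cbox a b) x *\<^sub>R w x \<partial>lebesgue)"
    by (rule integral_restrict_space) auto
  also have "\<dots> = (\<integral>x. indicator (box a b) x *\<^sub>R w x \<partial>lebesgue)"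
  proof (rule integral_cong_AE)
    show cm: "(\<lambda>x. indicator (cbox a b) x *\<^sub>R w x) \<in> borel_measurable lebesgue" using int' by simp
    have "(\<lambda>x. indicator (box a b) x * (indicator (cbox a b) x *\<^sub>R w x)) \<in> borel_measurable lebesgue"
      by (intro borel_measurable_times borel_measurable_indicator cm) auto
    moreover have "(\<lambda>x. indicator (box a b) x * (indicator (cbox a b) x *\<^sub>R w x)) = (\<lambda>x. indicator (box a b) x *\<^sub>R w x)"
      using box_subset_cbox[of a b] by (auto simp: fun_eq_iff indicator_def)
    ultimately show "(\<lambda>x. indicator (box a b) x *\<^sub>R w x) \<in> borel_measurable lebesgue" by simp
    show "AE x in lebesgue. indicator (cbox a b) x *\<^sub>R w x = indicator (box a b) x *\<^sub>R w x"
      using neg by eventually_elim (use box_subset_cbox[of a b] in \<open>auto simp: indicator_def\<close>)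
  qed
  finally show ?thesis using 0 by simp
qed

text \<open>The integrals of \<open>w\<close> over all small cubes vanish, and almost everywhere
  \<open>w\<close> is the limit of its means over such cubes. Countably many boxes cover the
  domain.\<close>

lemma fundamental_lemma:
  fixes w :: "real ^ 'n::finite \<Rightarrow> real"
  assumes \<Omega>: "open \<Omega>" and w: "w \<in> borel_measurable (lebesgue_on \<Omega>)"
    and int: "\<And>C. compact C \<Longrightarrow> C \<subseteq> \<Omega> \<Longrightarrow> integrable (lebesgue_on C) w"
    and zero: "\<And>\<phi>. \<phi> \<in> test_functions \<Omega> \<Longrightarrow> (\<integral>x. w x * \<phi> x \<partial>lebesgue_on \<Omega>) = 0"
  shows "AE x in lebesgue_on \<Omega>. w x = 0"
proof -
  have S [measurable]: "\<Omega> \<in> sets lebesgue" using \<Omega> by auto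
  have box: "AE x in lebesgue. x \<in> cbox A B \<longrightarrow> w x = 0" if AB: "cbox A B \<subseteq> \<Omega>" for A B
  proof -
    \<comment> \<open>\<open>w\<close> is only locally integrable; cutting it off to the box makes
      it integrable on the whole space.\<close>
    define f where "f x = (if x \<in> cbox A B then w x else 0)" for x
    have "integrable lebesgue (\<lambda>x. indicator (cbox A B) x *\<^sub>R w x)"
      using int[OF compact_cbox AB] by (subst (asm) integrable_restrict_space) auto
    moreover have "(\<lambda>x. indicator (cbox A B) x *\<^sub>R w x) = f" by (auto simp: f_def fun_eq_iff)
    ultimately have "integrable (lebesgue_on UNIV) f" by (simp add: lebesgue_on_UNIV_eq)
    then have fint: "f integrable_on UNIV" by (auto dest: integrable_on_lebesgue_on)
    then have "f integrable_on cbox a b" for a b by (rule integrable_on_subcbox) auto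
    \<comment> \<open>Lebesgue differentiation along cubes with lower corner
      \<open>x\<close>.\<close>
    then obtain N where N: "negligible N" "\<And>x e. x \<notin> N \<Longrightarrow> 0 < e \<Longrightarrow>
        \<exists>d>0. \<forall>h. 0 < h \<and> h < d \<longrightarrow> norm (integral (cbox x (x + h *\<^sub>R One)) f /\<^sub>R h ^ DIM(real^'n) - f x) < e"
      using integrable_ccontinuous_explicit[of f] by metis
    have f0: "f x = 0" if xN: "x \<notin> N" and x: "x \<in> box A B" for x
    proof (rule ccontr)
      assume "f x \<noteq> 0"
      then have "norm (f x) > 0" by simp
      then obtain d where d: "d > 0" "\<And>h. 0 < h \<Longrightarrow> h < d \<Longrightarrow>
          norm (integral (cbox x (x + h *\<^sub>R One)) f /\<^sub>R h ^ DIM(real^'n) - f x) < norm (f x)"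
        using N(2)[OF xN] by metis
      obtain e where e: "e > 0" "ball x e \<subseteq> box A B" using x open_box open_contains_ball by blast
      define n where "n = norm (One :: real^'n)"
      \<comment> \<open>Below \<open>d\<close> for the differentiation estimate, and so small that
        the cube with side \<open>h\<close> and corner \<open>x\<close> stays in the ball of radius
        \<open>e\<close>.\<close>
      define h where "h = min (d / 2) (e / (2 * (n + 1)))"
      have n: "n \<ge> 0" by (simp add: n_def)
      have h: "0 < h" "h < d" using d e n by (auto simp: h_def)
      have "h * n < e"
      proof -
        have "h \<le> e / (2 * (n + 1))" by (simp add: h_def)
        then have "h * (n + 1) \<le> e / 2" using n by (simp add: field_simps)
        moreover have "h * n \<le> h * (n + 1)" using h by simp
        ultimately show ?thesis using e by linarith
      qed
      have Q: "cbox x (x + h *\<^sub>R One) \<subseteq> box A B"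
      proof
        fix y assume y: "y \<in> cbox x (x + h *\<^sub>R One)"
        have "norm (y - x) \<le> norm (h *\<^sub>R (One :: real^'n))"
        proof (rule norm_le_componentwise)
          fix i :: "real^'n" assume "i \<in> Basis"
          then show "\<bar>(y - x) \<bullet> i\<bar> \<le> \<bar>(h *\<^sub>R One) \<bullet> i\<bar>"
            using y h by (auto simp: mem_box inner_diff_left inner_add_left)
        qed
        also have "\<dots> = h * n" using h by (simp add: n_def)
        finally have "y \<in> ball x e" using \<open>h * n < e\<close> by (simp add: dist_norm norm_minus_commute)
        then show "y \<in> box A B" using e by auto
      qed
      then have Q': "cbox x (x + h *\<^sub>R One) \<subseteq> cbox A B" using box_subset_cbox[of A B] by auto
      have "integral (cbox x (x + h *\<^sub>R One)) f = integral (cbox x (x + h *\<^sub>R One)) w"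
        using Q' by (intro integral_cong) (auto simp: f_def)
      also have "\<dots> = 0"
        using Q' AB int by (intro fundamental_lemma_box[OF \<Omega> _ w _ zero]) auto
      finally show False using d(2)[OF h] by simp
    qed
    \<comment> \<open>A point on a face has no cube inside the box to compare with, so the faces
      join the exceptional null set.\<close>
    have "AE x in lebesgue. x \<notin> N \<and> x \<notin> cbox A B - box A B"
      unfolding eventually_ae_filter_negligible
      using N(1) negligible_frontier_interval[of A B] by (intro exI[of _ "N \<union> (cbox A B - box A B)"]) auto
    then show ?thesis
    proof eventually_elim
      case (elim x)
      show ?case
      proof
        assume "x \<in> cbox A B"
        then show "w x = 0" using f0[of x] elim by (auto simp: f_def)
      qed
    qed
  qed
  obtain D where D: "countable D" "D \<subseteq> Pow \<Omega>" "\<And>X. X \<in> D \<Longrightarrow> \<exists>a b. X = cbox a b" "\<Union>D = \<Omega>"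
    using open_countable_Union_open_cbox[OF \<Omega>] by metis
  have "AE x in lebesgue. \<forall>X\<in>D. x \<in> X \<longrightarrow> w x = 0"
  proof (subst AE_ball_countable[OF D(1)], intro ballI)
    fix X assume "X \<in> D"
    then obtain a b where "X = cbox a b" "cbox a b \<subseteq> \<Omega>" using D by blast
    then show "AE x in lebesgue. x \<in> X \<longrightarrow> w x = 0" using box by simp
  qed
  then show ?thesis
    using D(4) by (subst AE_restrict_space_iff) (auto elim!: eventually_mono)
qed

section \<open>The double phase Sobolev spaces\<close>

lemma integrable_times_compact_support:
  fixes u \<psi> :: "real ^ 'n::finite \<Rightarrow> real"
  assumes \<Omega>: "open \<Omega>" and C: "compact C" "C \<subseteq> \<Omega>" and u: "integrable (lebesgue_on C) u"
    and \<psi>: "continuous_on UNIV \<psi>" "\<And>x. x \<notin> C \<Longrightarrow> \<psi> x = 0"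
  shows "integrable (lebesgue_on \<Omega>) (\<lambda>x. u x * \<psi> x)"
proof -
  have S: "\<Omega> \<in> sets lebesgue" using \<Omega> by auto
  have CS: "C \<in> sets lebesgue" using C lmeasurable_compact fmeasurableD by blast
  have "compact ((\<lambda>x. \<bar>\<psi> x\<bar>) ` C)"
    using \<psi>(1) C by (intro compact_continuous_image continuous_intros) (auto intro: continuous_on_subset)
  then have "bdd_above ((\<lambda>x. \<bar>\<psi> x\<bar>) ` C)" by (intro bounded_imp_bdd_above compact_imp_bounded)
  then obtain M where M: "\<And>x. x \<in> C \<Longrightarrow> \<bar>\<psi> x\<bar> \<le> M" unfolding bdd_above_def by blast
  have u': "integrable lebesgue (\<lambda>x. indicator C x *\<^sub>R u x)"
    using u CS by (subst (asm) integrable_restrict_space) auto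
  have \<psi>m: "\<psi> \<in> borel_measurable lebesgue"
    using \<psi>(1) by (intro measurable_completion) (simp add: borel_measurable_continuous_onI)
  have "integrable lebesgue (\<lambda>x. (indicator C x *\<^sub>R u x) * \<psi> x)"
  proof (rule Bochner_Integration.integrable_bound[OF integrable_mult_right[OF u', of M]])
    show "(\<lambda>x. (indicator C x *\<^sub>R u x) * \<psi> x) \<in> borel_measurable lebesgue"
      using u' \<psi>m by (intro borel_measurable_times) auto
    show "AE x in lebesgue. norm ((indicator C x *\<^sub>R u x) * \<psi> x) \<le> norm (M * (indicator C x *\<^sub>R u x))"
    proof (rule AE_I2)
      fix x
      show "norm ((indicator C x *\<^sub>R u x) * \<psi> x) \<le> norm (M * (indicator C x *\<^sub>R u x))"
        using M[of x] mult_right_mono[of "\<bar>\<psi> x\<bar>" "\<bar>M\<bar>" "\<bar>u x\<bar>"]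
        by (cases "x \<in> C") (auto simp: abs_mult mult.commute)
    qed
  qed
  moreover have "(\<lambda>x. (indicator C x *\<^sub>R u x) * \<psi> x) = (\<lambda>x. indicator \<Omega> x *\<^sub>R (u x * \<psi> x))"
  proof
    fix x show "(indicator C x *\<^sub>R u x) * \<psi> x = indicator \<Omega> x *\<^sub>R (u x * \<psi> x)"
      using C(2) \<psi>(2)[of x] by (cases "x \<in> C") auto
  qed
  ultimately show ?thesis using S by (subst integrable_restrict_space) auto
qed

section \<open>Linearity and uniqueness of weak gradients\<close>

lemma weak_gradientD:
  assumes "weak_gradient \<Omega> u g"
  shows "u \<in> borel_measurable (lebesgue_on \<Omega>)" "g \<in> borel_measurable (lebesgue_on \<Omega>)"
    and "\<And>C. compact C \<Longrightarrow> C \<subseteq> \<Omega> \<Longrightarrow> integrable (lebesgue_on C) u"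
    and "\<And>C. compact C \<Longrightarrow> C \<subseteq> \<Omega> \<Longrightarrow> integrable (lebesgue_on C) g"
    and "\<And>\<phi> i. \<phi> \<in> test_functions \<Omega> \<Longrightarrow>
      (\<integral>x. u x * partial_deriv i \<phi> x \<partial>lebesgue_on \<Omega>) = - (\<integral>x. g x $ i * \<phi> x \<partial>lebesgue_on \<Omega>)"
  using assms by (auto simp: weak_gradient_def)

lemma vec_nth_measurable [measurable]:
  fixes g :: "'a \<Rightarrow> real ^ 'n::finite"
  assumes "g \<in> borel_measurable M"
  shows "(\<lambda>x. g x $ i) \<in> borel_measurable M"
  using borel_measurable_inner[OF assms measurable_const[of "axis i 1"]] by (simp add: inner_axis)

lemma integrable_vec_nth:
  fixes g :: "'a \<Rightarrow> real ^ 'n::finite"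
  assumes "integrable M g"
  shows "integrable M (\<lambda>x. g x $ i)"
  by (rule integrable_bounded_linear[OF bounded_linear_vec_nth assms])

lemma weak_gradient_integrable:
  assumes \<Omega>: "open \<Omega>" and wg: "weak_gradient \<Omega> u g" and \<phi>: "\<phi> \<in> test_functions \<Omega>"
  shows "integrable (lebesgue_on \<Omega>) (\<lambda>x. u x * partial_deriv i \<phi> x)"
    and "integrable (lebesgue_on \<Omega>) (\<lambda>x. g x $ i * \<phi> x)"
proof -
  let ?C = "closure {x. \<phi> x \<noteq> 0}"
  have C: "compact ?C" "?C \<subseteq> \<Omega>" using \<phi> by (auto simp: test_functions_def)
  have c1: "C1_compact \<phi>" by (rule test_functions_C1_compact[OF \<phi>])
  show "integrable (lebesgue_on \<Omega>) (\<lambda>x. u x * partial_deriv i \<phi> x)"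
    using c1 by (intro integrable_times_compact_support[OF \<Omega> C weak_gradientD(3)[OF wg C]]
        partial_deriv_test_function_eq_0[OF \<phi>]) (simp add: C1_compact_def)
  show "integrable (lebesgue_on \<Omega>) (\<lambda>x. g x $ i * \<phi> x)"
    using closure_subset[of "{x. \<phi> x \<noteq> 0}"]
    by (intro integrable_times_compact_support[OF \<Omega> C integrable_vec_nth[OF weak_gradientD(4)[OF wg C]]]
        C1_compact_continuous[OF c1]) auto
qed

lemma weak_gradient_add:
  assumes \<Omega>: "open \<Omega>" and u: "weak_gradient \<Omega> u g" and v: "weak_gradient \<Omega> v h"
  shows "weak_gradient \<Omega> (\<lambda>x. u x + v x) (\<lambda>x. g x + h x)"
  unfolding weak_gradient_def
proof (intro conjI allI impI ballI)
  fix \<phi> i assume \<phi>: "\<phi> \<in> test_functions \<Omega>"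
  show "(\<integral>x. (u x + v x) * partial_deriv i \<phi> x \<partial>lebesgue_on \<Omega>) = - (\<integral>x. (g x + h x) $ i * \<phi> x \<partial>lebesgue_on \<Omega>)"
    using weak_gradient_integrable[OF \<Omega> u \<phi>, of i] weak_gradient_integrable[OF \<Omega> v \<phi>, of i]
      weak_gradientD(5)[OF u \<phi>, of i] weak_gradientD(5)[OF v \<phi>, of i]
    by (simp add: distrib_right)
qed (use weak_gradientD[OF u] weak_gradientD[OF v] in auto)

lemma weak_gradient_cmult:
  assumes u: "weak_gradient \<Omega> u g"
  shows "weak_gradient \<Omega> (\<lambda>x. c * u x) (\<lambda>x. c *\<^sub>R g x)"
  unfolding weak_gradient_def
proof (intro conjI allI impI ballI)
  fix \<phi> i assume \<phi>: "\<phi> \<in> test_functions \<Omega>"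
  show "(\<integral>x. (c * u x) * partial_deriv i \<phi> x \<partial>lebesgue_on \<Omega>) = - (\<integral>x. (c *\<^sub>R g x) $ i * \<phi> x \<partial>lebesgue_on \<Omega>)"
    using weak_gradientD(5)[OF u \<phi>, of i] by (simp add: mult.assoc)
qed (use weak_gradientD[OF u] in auto)

text \<open>The fundamental lemma applied to the components of the difference. It makes the choice
  in \<open>grad\<close> harmless: integrals and norms do not see which weak gradient was
  taken.\<close>

lemma weak_gradient_unique:
  assumes \<Omega>: "open \<Omega>" and g: "weak_gradient \<Omega> u g" and h: "weak_gradient \<Omega> u h"
  shows "AE x in lebesgue_on \<Omega>. g x = h x"
proof -
  have "AE x in lebesgue_on \<Omega>. g x $ i - h x $ i = 0" for i
  proof (rule fundamental_lemma[OF \<Omega>])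
    note [measurable] = weak_gradientD(2)[OF g] weak_gradientD(2)[OF h]
    show "(\<lambda>x. g x $ i - h x $ i) \<in> borel_measurable (lebesgue_on \<Omega>)" by measurable
    show "integrable (lebesgue_on C) (\<lambda>x. g x $ i - h x $ i)" if "compact C" "C \<subseteq> \<Omega>" for C
      using weak_gradientD(4)[OF g that] weak_gradientD(4)[OF h that]
      by (intro Bochner_Integration.integrable_diff integrable_vec_nth)
    fix \<phi> assume \<phi>: "\<phi> \<in> test_functions \<Omega>"
    show "(\<integral>x. (g x $ i - h x $ i) * \<phi> x \<partial>lebesgue_on \<Omega>) = 0"
      using weak_gradient_integrable(2)[OF \<Omega> g \<phi>, of i] weak_gradient_integrable(2)[OF \<Omega> h \<phi>, of i]
        weak_gradientD(5)[OF g \<phi>, of i] weak_gradientD(5)[OF h \<phi>, of i]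
      by (simp add: left_diff_distrib)
  qed
  then have "AE x in lebesgue_on \<Omega>. \<forall>i. g x $ i - h x $ i = 0" by (simp add: AE_all_countable)
  then show ?thesis by eventually_elim (simp add: vec_eq_iff)
qed

section \<open>Representatives of classes of functions\<close>

lemma abs_rep_aefun: "abs_aefun (rep_aefun u) = u"
  by (rule Quotient3_abs_rep[OF Quotient3_aefun])

lemma aefun_eq_iff: "u = v \<longleftrightarrow> (AE x in lebesgue. rep_aefun u x = rep_aefun v x)"
  using aefun.abs_eq_iff[of "rep_aefun u" "rep_aefun v"] by (simp add: abs_rep_aefun)

lemma rep_aefun_plus: "AE x in lebesgue. rep_aefun (u + v) x = rep_aefun u x + rep_aefun v x"
  using rep_abs_aefun[of "\<lambda>x. rep_aefun u x + rep_aefun v x"] plus_aefun.abs_eq[of "rep_aefun u" "rep_aefun v"]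
  by (simp add: abs_rep_aefun)

lemma rep_aefun_scaleR: "AE x in lebesgue. rep_aefun (c *\<^sub>R u) x = c * rep_aefun u x"
  using rep_abs_aefun[of "\<lambda>x. c * rep_aefun u x"] scaleR_aefun.abs_eq[of c "rep_aefun u"]
  by (simp add: abs_rep_aefun)

lemma rep_aefun_zero: "AE x in lebesgue. rep_aefun 0 x = 0"
  using rep_abs_aefun[of "\<lambda>x. 0"] by (simp add: zero_aefun_def)

lemma abs_aefun_plus: "abs_aefun f + abs_aefun g = abs_aefun (\<lambda>x. f x + g x)"
  by (rule plus_aefun.abs_eq)

lemma abs_aefun_scaleR: "c *\<^sub>R abs_aefun f = abs_aefun (\<lambda>x. c * f x)"
  using scaleR_aefun.abs_eq[of c f] by simp

lemma zero_test_function: "(\<lambda>_. 0) \<in> test_functions (\<Omega> :: (real ^ 'n::finite) set)"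
proof -
  have "C_class k (\<lambda>_ :: real ^ 'n. 0)" for k
    using flat_algebra_deriv by (intro C_class_of_closed_family[where S = flat_algebra] flat_algebra.const) auto
  then show ?thesis by (simp add: test_functions_def)
qed

context double_phase_domain
begin

lemma grad_weak_gradient: "weak_gradient \<Omega> (rep_aefun u) g \<Longrightarrow> weak_gradient \<Omega> (rep_aefun u) (grad \<Omega> u)"
  unfolding grad_def by (rule someI[of "weak_gradient \<Omega> (rep_aefun u)"])

lemma grad_AE_eq: "weak_gradient \<Omega> (rep_aefun u) g \<Longrightarrow> AE x in lebesgue_on \<Omega>. grad \<Omega> u x = g x"
  by (rule weak_gradient_unique[OF open_\<Omega> grad_weak_gradient])

lemma W1D:
  assumes "u \<in> W1 \<Omega> G"
  shows "finite_modular \<Omega> G (rep_aefun u)" "AE x in lebesgue. x \<notin> \<Omega> \<longrightarrow> rep_aefun u x = 0"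
    "weak_gradient \<Omega> (rep_aefun u) (grad \<Omega> u)" "finite_modular \<Omega> G (\<lambda>x. norm (grad \<Omega> u x))"
  using assms grad_weak_gradient by (auto simp: W1_def L_space_def)

lemma W1_lincomb:
  assumes u: "u \<in> W1 \<Omega> G" and v: "v \<in> W1 \<Omega> G"
  shows "weak_gradient \<Omega> (rep_aefun (u + v)) (\<lambda>x. grad \<Omega> u x + grad \<Omega> v x)"
    "weak_gradient \<Omega> (rep_aefun (c *\<^sub>R u)) (\<lambda>x. c *\<^sub>R grad \<Omega> u x)"
proof -
  have "AE x in lebesgue_on \<Omega>. rep_aefun u x + rep_aefun v x = rep_aefun (u + v) x"
    using AE_\<Omega>I[OF rep_aefun_plus[of u v]] by (auto elim: eventually_mono)
  from weak_gradient_AE_cong[OF open_\<Omega> weak_gradient_add[OF open_\<Omega> W1D(3)[OF u] W1D(3)[OF v]] this]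
  show "weak_gradient \<Omega> (rep_aefun (u + v)) (\<lambda>x. grad \<Omega> u x + grad \<Omega> v x)" by simp
  have "AE x in lebesgue_on \<Omega>. c * rep_aefun u x = rep_aefun (c *\<^sub>R u) x"
    using AE_\<Omega>I[OF rep_aefun_scaleR[of c u]] by (auto elim: eventually_mono)
  from weak_gradient_AE_cong[OF open_\<Omega> weak_gradient_cmult[OF W1D(3)[OF u]] this]
  show "weak_gradient \<Omega> (rep_aefun (c *\<^sub>R u)) (\<lambda>x. c *\<^sub>R grad \<Omega> u x)" by simp
qed

lemma grad_plus:
  assumes "u \<in> W1 \<Omega> G" "v \<in> W1 \<Omega> G"
  shows "AE x in lebesgue_on \<Omega>. grad \<Omega> (u + v) x = grad \<Omega> u x + grad \<Omega> v x"
  by (rule grad_AE_eq[OF W1_lincomb(1)[OF assms]])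

lemma grad_scaleR:
  assumes "u \<in> W1 \<Omega> G"
  shows "AE x in lebesgue_on \<Omega>. grad \<Omega> (c *\<^sub>R u) x = c *\<^sub>R grad \<Omega> u x"
  by (rule grad_AE_eq[OF W1_lincomb(2)[OF assms assms]])

text \<open>The bounds are imposed on any weak gradient at hand, since the values of
  \<open>grad\<close> are known only up to null sets.\<close>

lemma W1I:
  assumes "weak_gradient \<Omega> (rep_aefun u) g" "finite_modular \<Omega> G f" "finite_modular \<Omega> G f'"
    "AE x in lebesgue_on \<Omega>. \<bar>rep_aefun u x\<bar> \<le> \<bar>f x\<bar>" "AE x in lebesgue_on \<Omega>. norm (g x) \<le> \<bar>f' x\<bar>"
    "AE x in lebesgue. x \<notin> \<Omega> \<longrightarrow> rep_aefun u x = 0"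
  shows "u \<in> W1 \<Omega> G"
proof -
  have wg: "weak_gradient \<Omega> (rep_aefun u) (grad \<Omega> u)" by (rule grad_weak_gradient[OF assms(1)])
  note [measurable] = weak_gradientD(1,2)[OF wg]
  have "finite_modular \<Omega> G (rep_aefun u)"
    by (rule finite_modular_mono[OF assms(2) _ assms(4)]) measurable
  moreover have "finite_modular \<Omega> G (\<lambda>x. norm (grad \<Omega> u x))"
  proof (rule finite_modular_mono[OF assms(3)])
    show "AE x in lebesgue_on \<Omega>. \<bar>norm (grad \<Omega> u x)\<bar> \<le> \<bar>f' x\<bar>"
      using assms(5) grad_AE_eq[OF assms(1)] by eventually_elim simp
  qed measurable
  ultimately show ?thesis unfolding W1_def L_space_def using wg assms(6) by blast
qed

lemma W1_plus:
  assumes u: "u \<in> W1 \<Omega> G" and v: "v \<in> W1 \<Omega> G"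
  shows "u + v \<in> W1 \<Omega> G"
proof (rule W1I[OF W1_lincomb(1)[OF u v]])
  show "finite_modular \<Omega> G (\<lambda>x. rep_aefun u x + rep_aefun v x)"
    "finite_modular \<Omega> G (\<lambda>x. norm (grad \<Omega> u x) + norm (grad \<Omega> v x))"
    using u v by (auto intro: finite_modular_add W1D)
  show "AE x in lebesgue_on \<Omega>. \<bar>rep_aefun (u + v) x\<bar> \<le> \<bar>rep_aefun u x + rep_aefun v x\<bar>"
    using AE_\<Omega>I[OF rep_aefun_plus[of u v]] by eventually_elim simp
  show "AE x in lebesgue_on \<Omega>. norm (grad \<Omega> u x + grad \<Omega> v x) \<le> \<bar>norm (grad \<Omega> u x) + norm (grad \<Omega> v x)\<bar>"
    by (rule AE_I2) (use norm_triangle_ineq in \<open>auto intro: order_trans\<close>)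
  show "AE x in lebesgue. x \<notin> \<Omega> \<longrightarrow> rep_aefun (u + v) x = 0"
    using W1D(2)[OF u] W1D(2)[OF v] rep_aefun_plus[of u v] by eventually_elim simp
qed

lemma W1_scaleR:
  assumes u: "u \<in> W1 \<Omega> G"
  shows "c *\<^sub>R u \<in> W1 \<Omega> G"
proof (rule W1I[OF W1_lincomb(2)[OF u u]])
  show "finite_modular \<Omega> G (\<lambda>x. c * rep_aefun u x)" "finite_modular \<Omega> G (\<lambda>x. c * norm (grad \<Omega> u x))"
    using u by (auto intro: finite_modular_scale W1D)
  show "AE x in lebesgue_on \<Omega>. \<bar>rep_aefun (c *\<^sub>R u) x\<bar> \<le> \<bar>c * rep_aefun u x\<bar>"
    using AE_\<Omega>I[OF rep_aefun_scaleR[of c u]] by eventually_elim simp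
  show "AE x in lebesgue_on \<Omega>. norm (c *\<^sub>R grad \<Omega> u x) \<le> \<bar>c * norm (grad \<Omega> u x)\<bar>"
    by (rule AE_I2) (simp add: abs_mult)
  show "AE x in lebesgue. x \<notin> \<Omega> \<longrightarrow> rep_aefun (c *\<^sub>R u) x = 0"
    using W1D(2)[OF u] rep_aefun_scaleR[of c u] by eventually_elim simp
qed

lemma W1_bounded:
  assumes wg: "weak_gradient \<Omega> (rep_aefun u) g" and B: "AE x in lebesgue_on \<Omega>. \<bar>rep_aefun u x\<bar> \<le> B"
      "AE x in lebesgue_on \<Omega>. norm (g x) \<le> B"
    and 0: "AE x in lebesgue. x \<notin> \<Omega> \<longrightarrow> rep_aefun u x = 0"
  shows "u \<in> W1 \<Omega> G"
proof (rule W1I[OF wg _ _ _ _ 0])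
  show "finite_modular \<Omega> G (\<lambda>_. B)" "finite_modular \<Omega> G (\<lambda>_. B)"
    by (auto intro: finite_modular_bounded[of _ "\<bar>B\<bar>"])
  show "AE x in lebesgue_on \<Omega>. \<bar>rep_aefun u x\<bar> \<le> \<bar>B\<bar>" using B(1) by eventually_elim simp
  show "AE x in lebesgue_on \<Omega>. norm (g x) \<le> \<bar>B\<bar>" using B(2) by eventually_elim simp
qed

lemma
  assumes \<phi>: "\<phi> \<in> test_functions \<Omega>"
  shows test_function_in_W1: "abs_aefun \<phi> \<in> W1 \<Omega> G"
    and test_function_grad: "AE x in lebesgue_on \<Omega>. grad \<Omega> (abs_aefun \<phi>) x = gradient \<phi> x"
proof -
  have "AE x in lebesgue_on \<Omega>. \<phi> x = rep_aefun (abs_aefun \<phi>) x"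
    using AE_\<Omega>I[OF rep_abs_aefun[of \<phi>]] by (auto elim: eventually_mono)
  then have wg: "weak_gradient \<Omega> (rep_aefun (abs_aefun \<phi>)) (gradient \<phi>)"
    using weak_gradient_AE_cong[OF open_\<Omega> weak_gradient_test_function[OF open_\<Omega> \<phi>]] by simp
  then show "AE x in lebesgue_on \<Omega>. grad \<Omega> (abs_aefun \<phi>) x = gradient \<phi> x" by (rule grad_AE_eq)
  obtain R M where M: "\<And>x. \<bar>\<phi> x\<bar> \<le> M" "\<And>x. norm (gradient \<phi> x) \<le> M"
    using C1_compact_bounds[OF test_functions_C1_compact[OF \<phi>]] by metis
  show "abs_aefun \<phi> \<in> W1 \<Omega> G"
  proof (rule W1_bounded[OF wg])
    show "AE x in lebesgue_on \<Omega>. \<bar>rep_aefun (abs_aefun \<phi>) x\<bar> \<le> M"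
      using AE_\<Omega>I[OF rep_abs_aefun[of \<phi>]] by eventually_elim (use M in simp)
    show "AE x in lebesgue. x \<notin> \<Omega> \<longrightarrow> rep_aefun (abs_aefun \<phi>) x = 0"
      using rep_abs_aefun[of \<phi>] by eventually_elim (use test_function_eq_0[OF \<phi>] in simp)
  qed (use M in simp)
qed

lemma zero_in_W1: "0 \<in> W1 \<Omega> G"
  using test_function_in_W1[OF zero_test_function] by (simp add: zero_aefun_def)

lemma subspace_W1: "subspace (W1 \<Omega> G)"
  by (rule subspaceI) (auto intro: zero_in_W1 W1_plus W1_scaleR)

section \<open>Norm properties\<close>

lemma L_norm_nonneg: "u \<in> W1 \<Omega> G \<Longrightarrow> 0 \<le> L_norm \<Omega> G u"
  unfolding L_norm_def by (intro luxemburg_nonneg W1D)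

lemma grad_norm_nonneg: "u \<in> W1 \<Omega> G \<Longrightarrow> 0 \<le> grad_norm \<Omega> G u"
  unfolding grad_norm_def by (intro luxemburg_nonneg W1D)

lemma L_norm_scaleR: "u \<in> W1 \<Omega> G \<Longrightarrow> L_norm \<Omega> G (c *\<^sub>R u) = \<bar>c\<bar> * L_norm \<Omega> G u"
proof -
  assume u: "u \<in> W1 \<Omega> G"
  have "L_norm \<Omega> G (c *\<^sub>R u) = luxemburg \<Omega> G (\<lambda>x. c * rep_aefun u x)"
    unfolding L_norm_def using AE_\<Omega>I[OF rep_aefun_scaleR[of c u]] by (intro luxemburg_cong) (auto elim: eventually_mono)
  then show ?thesis using luxemburg_scale[OF W1D(1)[OF u]] by (simp add: L_norm_def)
qed

lemma grad_norm_scaleR: "u \<in> W1 \<Omega> G \<Longrightarrow> grad_norm \<Omega> G (c *\<^sub>R u) = \<bar>c\<bar> * grad_norm \<Omega> G u"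
proof -
  assume u: "u \<in> W1 \<Omega> G"
  have "grad_norm \<Omega> G (c *\<^sub>R u) = luxemburg \<Omega> G (\<lambda>x. c * norm (grad \<Omega> u x))"
    unfolding grad_norm_def using grad_scaleR[OF u, of c] by (intro luxemburg_cong) (auto simp: abs_mult elim: eventually_mono)
  then show ?thesis using luxemburg_scale[OF W1D(4)[OF u]] by (simp add: grad_norm_def)
qed

lemma L_norm_triangle:
  "u \<in> W1 \<Omega> G \<Longrightarrow> v \<in> W1 \<Omega> G \<Longrightarrow> L_norm \<Omega> G (u + v) \<le> L_norm \<Omega> G u + L_norm \<Omega> G v"
proof -
  assume u: "u \<in> W1 \<Omega> G" and v: "v \<in> W1 \<Omega> G"
  have "L_norm \<Omega> G (u + v) = luxemburg \<Omega> G (\<lambda>x. rep_aefun u x + rep_aefun v x)"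
    unfolding L_norm_def using AE_\<Omega>I[OF rep_aefun_plus[of u v]] by (intro luxemburg_cong) (auto elim: eventually_mono)
  then show ?thesis using luxemburg_triangle[OF W1D(1)[OF u] W1D(1)[OF v]] by (simp add: L_norm_def)
qed

lemma grad_norm_triangle:
  "u \<in> W1 \<Omega> G \<Longrightarrow> v \<in> W1 \<Omega> G \<Longrightarrow> grad_norm \<Omega> G (u + v) \<le> grad_norm \<Omega> G u + grad_norm \<Omega> G v"
proof -
  assume u: "u \<in> W1 \<Omega> G" and v: "v \<in> W1 \<Omega> G"
  have "AE x in lebesgue_on \<Omega>. \<bar>norm (grad \<Omega> (u + v) x)\<bar> \<le> \<bar>norm (grad \<Omega> u x) + norm (grad \<Omega> v x)\<bar>"
    using grad_plus[OF u v] by eventually_elim (simp add: norm_triangle_ineq)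
  then have "grad_norm \<Omega> G (u + v) \<le> luxemburg \<Omega> G (\<lambda>x. norm (grad \<Omega> u x) + norm (grad \<Omega> v x))"
    unfolding grad_norm_def using u v by (intro luxemburg_mono finite_modular_add W1D) 
  then show ?thesis using luxemburg_triangle[OF W1D(4)[OF u] W1D(4)[OF v]] by (simp add: grad_norm_def)
qed

text \<open>The norm sees the domain only; outside of it the function vanishes as a member of
  \<open>L_space\<close>, so it is the zero class on the whole space.\<close>

lemma L_norm_eq_0D:
  assumes u: "u \<in> W1 \<Omega> G" and 0: "L_norm \<Omega> G u = 0"
  shows "u = 0"
proof -
  have "AE x in lebesgue. x \<in> \<Omega> \<longrightarrow> rep_aefun u x = 0"
    using luxemburg_eq_0D[OF W1D(1)[OF u]] 0 by (simp add: L_norm_def AE_\<Omega>_iff)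
  then have "AE x in lebesgue. rep_aefun u x = rep_aefun 0 x"
    using W1D(2)[OF u] rep_aefun_zero by eventually_elim auto
  then show ?thesis by (simp add: aefun_eq_iff)
qed

lemma norm_on_W1: "norm_on (W1 \<Omega> G) (W1_norm \<Omega> G)"
  unfolding norm_on_def
proof (intro conjI ballI allI)
  fix u v c assume u: "u \<in> W1 \<Omega> G"
  note nn = L_norm_nonneg[OF u] grad_norm_nonneg[OF u]
  show "0 \<le> W1_norm \<Omega> G u" using nn by (simp add: W1_norm_def)
  show "W1_norm \<Omega> G (c *\<^sub>R u) = \<bar>c\<bar> * W1_norm \<Omega> G u"
    using u by (simp add: W1_norm_def L_norm_scaleR grad_norm_scaleR distrib_left)
  show "W1_norm \<Omega> G u = 0 \<longleftrightarrow> u = 0"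
  proof
    assume "W1_norm \<Omega> G u = 0"
    then show "u = 0" using nn L_norm_eq_0D[OF u] by (simp add: W1_norm_def)
  next
    assume "u = 0"
    then show "W1_norm \<Omega> G u = 0"
      using L_norm_scaleR[OF u, of 0] grad_norm_scaleR[OF u, of 0] by (simp add: W1_norm_def)
  qed
  assume v: "v \<in> W1 \<Omega> G"
  show "W1_norm \<Omega> G (u + v) \<le> W1_norm \<Omega> G u + W1_norm \<Omega> G v"
    using L_norm_triangle[OF u v] grad_norm_triangle[OF u v] by (simp add: W1_norm_def)
qed

sublocale W1: normed_subspace "W1 \<Omega> G" "W1_norm \<Omega> G"
  by (unfold_locales) (rule subspace_W1 norm_on_W1)+

section \<open>The closure of the test functions\<close>

lemma W0_iff:
  "u \<in> W0 \<Omega> G \<longleftrightarrow> u \<in> W1 \<Omega> G \<and> (\<forall>e>0. \<exists>\<phi>\<in>test_functions \<Omega>. W1_norm \<Omega> G (abs_aefun \<phi> - u) < e)"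
  unfolding W0_def by (subst W1.in_closure_of_iff) (auto intro: test_function_in_W1)

lemma W0_subset_W1: "W0 \<Omega> G \<subseteq> W1 \<Omega> G"
  by (auto simp: W0_iff)

lemma test_function_in_W0: "\<phi> \<in> test_functions \<Omega> \<Longrightarrow> abs_aefun \<phi> \<in> W0 \<Omega> G"
  unfolding W0_iff using test_function_in_W1 W1.N_zero by (metis diff_self)

lemma subspace_W0: "subspace (W0 \<Omega> G)"
proof (rule subspaceI)
  show "0 \<in> W0 \<Omega> G"
    using test_function_in_W0[OF zero_test_function] by (simp add: zero_aefun_def)
next
  fix u v assume u: "u \<in> W0 \<Omega> G" and v: "v \<in> W0 \<Omega> G"
  have W: "u \<in> W1 \<Omega> G" "v \<in> W1 \<Omega> G" using u v W0_subset_W1 by auto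
  show "u + v \<in> W0 \<Omega> G"
    unfolding W0_iff
  proof (intro conjI allI impI)
    show "u + v \<in> W1 \<Omega> G" using W by (rule W1_plus)
    fix e :: real assume "0 < e"
    then obtain f g where f: "f \<in> test_functions \<Omega>" "W1_norm \<Omega> G (abs_aefun f - u) < e / 2"
      and g: "g \<in> test_functions \<Omega>" "W1_norm \<Omega> G (abs_aefun g - v) < e / 2"
      using u v unfolding W0_iff by (meson half_gt_zero)
    have "W1_norm \<Omega> G ((abs_aefun f - u) + (abs_aefun g - v)) < e"
      using W1.N_triangle[of "abs_aefun f - u" "abs_aefun g - v"] f g W test_function_in_W1
      by (force intro: W1.diff_mem)
    moreover have "(abs_aefun f - u) + (abs_aefun g - v) = abs_aefun (\<lambda>x. f x + g x) - (u + v)"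
      unfolding abs_aefun_plus[symmetric] by simp
    ultimately show "\<exists>\<phi>\<in>test_functions \<Omega>. W1_norm \<Omega> G (abs_aefun \<phi> - (u + v)) < e"
      using test_functions_add[OF f(1) g(1)] by (metis (no_types, lifting))
  qed
next
  fix c u assume u: "u \<in> W0 \<Omega> G"
  have W: "u \<in> W1 \<Omega> G" using u W0_subset_W1 by auto
  show "c *\<^sub>R u \<in> W0 \<Omega> G"
    unfolding W0_iff
  proof (intro conjI allI impI)
    show "c *\<^sub>R u \<in> W1 \<Omega> G" using W by (rule W1_scaleR)
    fix e :: real assume e: "0 < e"
    \<comment> \<open>\<open>\<bar>c\<bar> + 1\<close> replaces \<open>\<bar>c\<bar>\<close> as a
      divisor so that \<open>c = 0\<close> is included.\<close>
    have c: "0 < \<bar>c\<bar> + 1" by simp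
    then have "0 < e / (\<bar>c\<bar> + 1)" using e by simp
    then obtain f where f: "f \<in> test_functions \<Omega>" "W1_norm \<Omega> G (abs_aefun f - u) < e / (\<bar>c\<bar> + 1)"
      using u unfolding W0_iff by blast
    have fu: "abs_aefun f - u \<in> W1 \<Omega> G" using f W test_function_in_W1 by (auto intro: W1.diff_mem)
    have "\<bar>c\<bar> * W1_norm \<Omega> G (abs_aefun f - u) \<le> (\<bar>c\<bar> + 1) * W1_norm \<Omega> G (abs_aefun f - u)"
      using W1.N_nonneg[OF fu] by (intro mult_right_mono) auto
    also have "\<dots> < e" using f(2) c by (simp only: pos_less_divide_eq mult.commute)
    finally have "W1_norm \<Omega> G (c *\<^sub>R (abs_aefun f - u)) < e" using W1.N_scaleR[OF fu] by simp
    moreover have "c *\<^sub>R (abs_aefun f - u) = abs_aefun (\<lambda>x. c * f x) - c *\<^sub>R u"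
      unfolding abs_aefun_scaleR[symmetric] by (rule scaleR_diff_right)
    ultimately show "\<exists>\<phi>\<in>test_functions \<Omega>. W1_norm \<Omega> G (abs_aefun \<phi> - c *\<^sub>R u) < e"
      using test_functions_cmult[OF f(1)] by (metis (no_types, lifting))
  qed
qed

lemma norm_on_W0: "norm_on (W0 \<Omega> G) (W1_norm \<Omega> G)"
  using norm_on_W1 unfolding norm_on_def by (simp add: W0_subset_W1[THEN subsetD])

sublocale W0: normed_subspace "W0 \<Omega> G" "W1_norm \<Omega> G"
  by (unfold_locales) (rule subspace_W0 norm_on_W0)+

end

section \<open>A Sobolev inequality\<close>

text \<open>Jensen's inequality with equal weights \<open>1 / N\<close> at the points
  \<open>N * z j\<close>.\<close>

lemma powr_sum_average_le:
  fixes z :: "nat \<Rightarrow> real"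
  assumes p: "1 \<le> p" and N: "0 < N"
  shows "\<bar>\<Sum>j<N. z j\<bar> powr p \<le> (\<Sum>j<N. \<bar>real N * z j\<bar> powr p) / real N"
proof -
  have cvx: "convex_on {0..} (\<lambda>x::real. x powr p)"
    unfolding convex_on_def using powr_convex_combination[OF p] by auto
  have "\<bar>\<Sum>j<N. z j\<bar> \<le> (\<Sum>j<N. (1 / real N) *\<^sub>R \<bar>real N * z j\<bar>)"
    using N sum_abs[of z "{..<N}"] by (simp add: abs_mult)
  then have "\<bar>\<Sum>j<N. z j\<bar> powr p \<le> (\<Sum>j<N. (1 / real N) *\<^sub>R \<bar>real N * z j\<bar>) powr p"
    using p by (intro powr_mono2) auto
  also have "\<dots> \<le> (\<Sum>j<N. (1 / real N) * \<bar>real N * z j\<bar> powr p)"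
    using N by (intro convex_on_sum[OF _ _ cvx]) auto
  finally show ?thesis by (simp add: sum_divide_distrib)
qed

text \<open>Walking from \<open>x\<close> to \<open>x + y\<close> in \<open>k + 1\<close> equal
  steps writes the increment as a mean of difference quotients at translated points.\<close>

lemma telescope_translation:
  fixes \<phi> :: "real ^ 'n::finite \<Rightarrow> real"
  shows "\<phi> (x + y) - \<phi> x = (\<Sum>j<Suc k. diff_quotient \<phi> y k (x + (real j / real (Suc k)) *\<^sub>R y) / real (Suc k))"
proof -
  let ?f = "\<lambda>j. \<phi> (x + (real j / real (Suc k)) *\<^sub>R y)"
  have "diff_quotient \<phi> y k (x + (real j / real (Suc k)) *\<^sub>R y) / real (Suc k) = ?f (Suc j) - ?f j" for j
  proof -
    have eq: "x + (real j / real (Suc k)) *\<^sub>R y + (1 / real (Suc k)) *\<^sub>R y = x + (real (Suc j) / real (Suc k)) *\<^sub>R y"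
      by (simp add: add_divide_distrib add.assoc flip: scaleR_add_left)
    show ?thesis by (simp only: diff_quotient_def eq) simp
  qed
  then have "(\<Sum>j<Suc k. diff_quotient \<phi> y k (x + (real j / real (Suc k)) *\<^sub>R y) / real (Suc k))
      = (\<Sum>j<Suc k. ?f (Suc j) - ?f j)" by simp
  also have "\<dots> = ?f (Suc k) - ?f 0" by (rule sum_lessThan_telescope)
  finally show ?thesis by simp
qed

text \<open>By Jensen's inequality the increment is bounded by a mean of translated difference
  quotients, whose integrals all coincide. The resulting bound holds for every \<open>k\<close>, and
  letting \<open>k\<close> grow turns the quotients into directional derivatives.\<close>

lemma nn_integral_translation_le:
  fixes \<phi> :: "real ^ 'n::finite \<Rightarrow> real"
  assumes \<phi>: "C1_compact \<phi>" and p: "1 \<le> p"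
  shows "(\<integral>\<^sup>+x. ennreal (\<bar>\<phi> (x + y) - \<phi> x\<bar> powr p) \<partial>lborel)
    \<le> ennreal (norm y powr p) * (\<integral>\<^sup>+x. ennreal (norm (gradient \<phi> x) powr p) \<partial>lborel)"
proof -
  note [measurable] = C1_compact_borel[OF \<phi>]
  have dqm [measurable]: "diff_quotient \<phi> y k \<in> borel_measurable borel" for k
    unfolding diff_quotient_def[abs_def] by measurable
  define D where "D k x = ennreal (\<bar>diff_quotient \<phi> y k x\<bar> powr p)" for k x
  have Dm [measurable]: "D k \<in> borel_measurable borel" for k unfolding D_def[abs_def] by measurable
  have le: "(\<integral>\<^sup>+x. ennreal (\<bar>\<phi> (x + y) - \<phi> x\<bar> powr p) \<partial>lborel) \<le> (\<integral>\<^sup>+x. D k x \<partial>lborel)" for k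
  proof -
    let ?N = "Suc k"
    have "(\<integral>\<^sup>+x. ennreal (\<bar>\<phi> (x + y) - \<phi> x\<bar> powr p) \<partial>lborel)
        \<le> (\<integral>\<^sup>+x. ennreal (1 / real ?N) * (\<Sum>j<?N. D k (x + (real j / real ?N) *\<^sub>R y)) \<partial>lborel)"
    proof (rule nn_integral_mono)
      fix x
      let ?z = "\<lambda>j. diff_quotient \<phi> y k (x + (real j / real ?N) *\<^sub>R y) / real ?N"
      have "\<bar>\<phi> (x + y) - \<phi> x\<bar> powr p \<le> (\<Sum>j<?N. \<bar>real ?N * ?z j\<bar> powr p) / real ?N"
        unfolding telescope_translation[of \<phi> x y k] by (rule powr_sum_average_le[OF p]) simp
      also have "\<dots> = (1 / real ?N) * (\<Sum>j<?N. \<bar>diff_quotient \<phi> y k (x + (real j / real ?N) *\<^sub>R y)\<bar> powr p)"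
        by simp
      finally show "ennreal (\<bar>\<phi> (x + y) - \<phi> x\<bar> powr p) \<le> ennreal (1 / real ?N) * (\<Sum>j<?N. D k (x + (real j / real ?N) *\<^sub>R y))"
        unfolding D_def by (subst sum_ennreal, simp, subst ennreal_mult[symmetric])
          (auto intro!: ennreal_leI sum_nonneg simp del: sum.lessThan_Suc of_nat_Suc)
    qed
    also have "\<dots> = ennreal (1 / real ?N) * (\<Sum>j<?N. \<integral>\<^sup>+x. D k (x + (real j / real ?N) *\<^sub>R y) \<partial>lborel)"
      by (subst nn_integral_cmult, measurable, subst nn_integral_sum, measurable)
    also have "\<dots> = ennreal (1 / real ?N) * (of_nat ?N * (\<integral>\<^sup>+x. D k x \<partial>lborel))"
      by (subst nn_integral_lborel_translation) (simp_all add: Dm del: of_nat_Suc)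
    also have "\<dots> = (ennreal (1 / real ?N) * ennreal (real ?N)) * (\<integral>\<^sup>+x. D k x \<partial>lborel)"
      by (simp only: mult.assoc ennreal_of_nat_eq_real_of_nat)
    also have "ennreal (1 / real ?N) * ennreal (real ?N) = 1"
      by (subst ennreal_mult[symmetric]) auto
    finally show ?thesis by simp
  qed
  obtain R M where M: "0 \<le> M" "\<And>k x. \<bar>diff_quotient \<phi> y k x\<bar> \<le> M * indicator (cball 0 R) x"
    using diff_quotient_bounds[OF \<phi>, of y] by metis
  have "(\<lambda>k. \<integral>\<^sup>+x. D k x \<partial>lborel) \<longlonglongrightarrow> (\<integral>\<^sup>+x. ennreal (\<bar>gradient \<phi> x \<bullet> y\<bar> powr p) \<partial>lborel)"
  proof (rule nn_integral_dominated_convergence[where w = "\<lambda>x. ennreal (M powr p) * indicator (cball 0 R) x"])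
    show "AE x in lborel. D k x \<le> ennreal (M powr p) * indicator (cball 0 R) x" for k
    proof (rule AE_I2)
      fix x
      have "\<bar>diff_quotient \<phi> y k x\<bar> powr p \<le> (M * indicator (cball 0 R) x) powr p"
        using M p by (intro powr_mono2) auto
      then show "D k x \<le> ennreal (M powr p) * indicator (cball 0 R) x"
        unfolding D_def by (cases "x \<in> cball 0 R") (auto intro: ennreal_leI)
    qed
    show "(\<integral>\<^sup>+x. ennreal (M powr p) * indicator (cball 0 R) x \<partial>(lborel :: (real^'n) measure)) < \<infinity>"
      using emeasure_compact_finite[OF compact_cball, of "0::real^'n" R]
      by (subst nn_integral_cmult) (auto simp: ennreal_mult_less_top intro!: borel_measurable_indicator)
    show "AE x in lborel. (\<lambda>k. D k x) \<longlonglongrightarrow> ennreal (\<bar>gradient \<phi> x \<bullet> y\<bar> powr p)"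
    proof (rule AE_I2)
      fix x
      have "(\<lambda>k. \<bar>diff_quotient \<phi> y k x\<bar>) \<longlonglongrightarrow> \<bar>gradient \<phi> x \<bullet> y\<bar>"
        by (rule tendsto_rabs[OF diff_quotient_tendsto[OF \<phi>]])
      then have "(\<lambda>k. \<bar>diff_quotient \<phi> y k x\<bar> powr p) \<longlonglongrightarrow> \<bar>gradient \<phi> x \<bullet> y\<bar> powr p"
        using p by (intro tendsto_powr') simp_all
      then show "(\<lambda>k. D k x) \<longlonglongrightarrow> ennreal (\<bar>gradient \<phi> x \<bullet> y\<bar> powr p)"
        unfolding D_def by (rule tendsto_ennrealI)
    qed
    show "D k \<in> borel_measurable lborel" for k by simp
    show "(\<lambda>x. ennreal (\<bar>gradient \<phi> x \<bullet> y\<bar> powr p)) \<in> borel_measurable lborel" by measurable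
    show "(\<lambda>x. ennreal (M powr p) * indicator (cball 0 R) x) \<in> borel_measurable (lborel :: (real^'n) measure)"
      by (intro borel_measurable_times_ennreal borel_measurable_const borel_measurable_indicator) auto
  qed
  then have "(\<integral>\<^sup>+x. ennreal (\<bar>\<phi> (x + y) - \<phi> x\<bar> powr p) \<partial>lborel) \<le> (\<integral>\<^sup>+x. ennreal (\<bar>gradient \<phi> x \<bullet> y\<bar> powr p) \<partial>lborel)"
    by (rule LIMSEQ_le_const) (use le in blast)
  also have "\<dots> \<le> (\<integral>\<^sup>+x. ennreal (norm y powr p) * ennreal (norm (gradient \<phi> x) powr p) \<partial>lborel)"
  proof (rule nn_integral_mono)
    fix x
    have "\<bar>gradient \<phi> x \<bullet> y\<bar> powr p \<le> (norm (gradient \<phi> x) * norm y) powr p"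
      using p Cauchy_Schwarz_ineq2 by (intro powr_mono2) auto
    then show "ennreal (\<bar>gradient \<phi> x \<bullet> y\<bar> powr p) \<le> ennreal (norm y powr p) * ennreal (norm (gradient \<phi> x) powr p)"
      by (subst ennreal_mult[symmetric]) (auto simp: powr_mult mult.commute intro: ennreal_leI)
  qed
  also have "\<dots> = ennreal (norm y powr p) * (\<integral>\<^sup>+x. ennreal (norm (gradient \<phi> x) powr p) \<partial>lborel)"
    by (rule nn_integral_cmult) measurable
  finally show ?thesis .
qed

lemma powr_add_le: "0 \<le> p \<Longrightarrow> \<bar>x\<bar> powr p \<le> 2 powr p * (\<bar>x - y\<bar> powr p + \<bar>y\<bar> powr p)" for x y p :: real
proof -
  assume p: "0 \<le> p"
  define m where "m = max \<bar>x - y\<bar> \<bar>y\<bar>"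
  have "\<bar>x\<bar> \<le> 2 * m" unfolding m_def max_def by argo
  then have "\<bar>x\<bar> powr p \<le> (2 * m) powr p" using p by (intro powr_mono2) auto
  also have "\<dots> = 2 powr p * m powr p" by (simp add: powr_mult)
  also have "m powr p \<le> \<bar>x - y\<bar> powr p + \<bar>y\<bar> powr p" by (auto simp: m_def max_def)
  finally show ?thesis by simp
qed

text \<open>Compare \<open>\<phi>\<close> with its averages over cubes of side \<open>\<rho>\<close>: these averages are small compared
  with \<open>l\<close> once \<open>\<rho>\<close> is large, and the difference is controlled by the gradient.\<close>

lemma superlevel_integral_le:
  fixes \<phi> :: "real ^ 'n::finite \<Rightarrow> real"
  assumes \<phi>: "C1_compact \<phi>" and p: "1 \<le> p" and B: "0 < B" and l: "0 < l"
    and M: "(\<integral>\<^sup>+x. ennreal (\<bar>\<phi> x\<bar> powr p) \<partial>lborel) \<le> ennreal B"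
    and A: "(\<integral>\<^sup>+x. ennreal (norm (gradient \<phi> x) powr p) \<partial>lborel) \<le> ennreal B"
    and \<rho>: "0 < \<rho>" "\<rho> ^ CARD('n) * l powr p = 2 * 2 powr p * B"
  shows "(\<integral>\<^sup>+x. ennreal (\<bar>\<phi> x\<bar> powr p) * indicator {x. l < \<bar>\<phi> x\<bar>} x \<partial>lborel)
    \<le> ennreal (2 * 2 powr p * ((\<rho> * CARD('n)) powr p * B))"
proof -
  let ?n = "CARD('n)"
  note [measurable] = C1_compact_borel[OF \<phi>]
  define Q :: "(real ^ 'n) set" where "Q = cbox 0 (\<rho> *\<^sub>R One)"
  have Qm [measurable]: "Q \<in> sets borel" by (simp add: Q_def)
  have "emeasure lborel Q = ennreal (\<Prod>b\<in>(Basis :: (real^'n) set). \<rho>)"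
    unfolding Q_def using \<rho> by (subst emeasure_lborel_cbox) (auto simp: inner_simps cong: prod.cong)
  then have Qvol: "emeasure lborel Q = ennreal (\<rho> ^ ?n)" by (simp add: DIM_cart)
  have Qnorm: "norm y \<le> \<rho> * ?n" if "y \<in> Q" for y
  proof -
    have "norm y \<le> (\<Sum>b\<in>Basis. \<bar>y \<bullet> b\<bar>)" by (rule norm_le_l1)
    also have "\<dots> \<le> (\<Sum>b\<in>(Basis :: (real^'n) set). \<rho>)"
      using that by (intro sum_mono) (auto simp: Q_def mem_box)
    finally show ?thesis by (simp add: DIM_cart mult.commute)
  qed
  \<comment> \<open>The oscillation of \<open>\<phi>\<close> over the cube with corner
    \<open>x\<close>. Exchanging the integrals reduces its total to the translation estimate for
    each fixed \<open>y\<close> in \<open>Q\<close>.\<close>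
  define F where "F x = (\<integral>\<^sup>+y. ennreal (\<bar>\<phi> (x + y) - \<phi> x\<bar> powr p) * indicator Q y \<partial>lborel)" for x
  have "(\<integral>\<^sup>+x. F x \<partial>lborel) = (\<integral>\<^sup>+y. \<integral>\<^sup>+x. ennreal (\<bar>\<phi> (x + y) - \<phi> x\<bar> powr p) * indicator Q y \<partial>lborel \<partial>lborel)"
    unfolding F_def by (rule lborel_pair.Fubini') measurable
  also have "\<dots> \<le> (\<integral>\<^sup>+y. ennreal ((\<rho> * ?n) powr p * B) * indicator Q y \<partial>(lborel :: (real^'n) measure))"
  proof (rule nn_integral_mono)
    fix y :: "real^'n"
    have "(\<integral>\<^sup>+x. ennreal (\<bar>\<phi> (x + y) - \<phi> x\<bar> powr p) * indicator Q y \<partial>lborel)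
        = (\<integral>\<^sup>+x. ennreal (\<bar>\<phi> (x + y) - \<phi> x\<bar> powr p) \<partial>lborel) * indicator Q y"
      by (rule nn_integral_multc) measurable
    also have "\<dots> \<le> ennreal ((\<rho> * ?n) powr p * B) * indicator Q y"
    proof (cases "y \<in> Q")
      case True
      have "(\<integral>\<^sup>+x. ennreal (\<bar>\<phi> (x + y) - \<phi> x\<bar> powr p) \<partial>lborel)
          \<le> ennreal (norm y powr p) * (\<integral>\<^sup>+x. ennreal (norm (gradient \<phi> x) powr p) \<partial>lborel)"
        by (rule nn_integral_translation_le[OF \<phi> p])
      also have "\<dots> \<le> ennreal ((\<rho> * ?n) powr p) * ennreal B"
        using A Qnorm[OF True] p by (intro mult_mono ennreal_leI powr_mono2) auto
      finally show ?thesis using True B by (simp add: ennreal_mult)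
    qed simp
    finally show "(\<integral>\<^sup>+x. ennreal (\<bar>\<phi> (x + y) - \<phi> x\<bar> powr p) * indicator Q y \<partial>lborel)
        \<le> ennreal ((\<rho> * ?n) powr p * B) * indicator Q y" .
  qed
  also have "\<dots> = ennreal ((\<rho> * ?n) powr p * B) * ennreal (\<rho> ^ ?n)"
    using Qvol by (subst nn_integral_cmult) auto
  finally have F: "(\<integral>\<^sup>+x. F x \<partial>lborel) \<le> ennreal ((\<rho> * ?n) powr p * B) * ennreal (\<rho> ^ ?n)" .
  have Fm [measurable]: "F \<in> borel_measurable borel"
    unfolding F_def[abs_def] using lborel.borel_measurable_nn_integral by measurable
  define c where "c = 2 * 2 powr p / \<rho> ^ ?n"
  have c: "0 \<le> c" "c * \<rho> ^ ?n = 2 * 2 powr p" using \<rho> by (auto simp: c_def)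
  have pw: "ennreal (\<bar>\<phi> x\<bar> powr p) * indicator {x. l < \<bar>\<phi> x\<bar>} x \<le> ennreal c * F x" for x
  proof (cases "l < \<bar>\<phi> x\<bar>")
    case True
    define X where "X = \<rho> ^ ?n * \<bar>\<phi> x\<bar> powr p"
    have X0: "0 \<le> X" using \<rho> by (simp add: X_def)
    have "ennreal X = (\<integral>\<^sup>+y. ennreal (\<bar>\<phi> x\<bar> powr p) * indicator Q y \<partial>lborel)"
      using Qvol \<rho> by (subst nn_integral_cmult) (auto simp: X_def ennreal_mult mult.commute)
    \<comment> \<open>The indicator is dropped from the last term, which becomes a translate of the
      whole integral of \<open>\<phi>\<close> and is therefore at most \<open>B\<close> for every
      \<open>x\<close>.\<close>
    also have "\<dots> \<le> (\<integral>\<^sup>+y. ennreal (2 powr p) * (ennreal (\<bar>\<phi> (x + y) - \<phi> x\<bar> powr p) * indicator Q y + ennreal (\<bar>\<phi> (y + x)\<bar> powr p)) \<partial>lborel)"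
    proof (rule nn_integral_mono)
      fix y
      have "ennreal (\<bar>\<phi> x\<bar> powr p) \<le> ennreal (2 powr p) * (ennreal (\<bar>\<phi> (x + y) - \<phi> x\<bar> powr p) + ennreal (\<bar>\<phi> (y + x)\<bar> powr p))"
        using powr_add_le[of p "\<phi> x" "\<phi> (x + y)"] p
        by (subst ennreal_plus[symmetric], simp, simp, subst ennreal_mult[symmetric])
          (auto intro!: ennreal_leI simp: add.commute abs_minus_commute)
      then show "ennreal (\<bar>\<phi> x\<bar> powr p) * indicator Q y \<le>
          ennreal (2 powr p) * (ennreal (\<bar>\<phi> (x + y) - \<phi> x\<bar> powr p) * indicator Q y + ennreal (\<bar>\<phi> (y + x)\<bar> powr p))"
        by (cases "y \<in> Q") auto
    qed
    also have "\<dots> = ennreal (2 powr p) * (F x + (\<integral>\<^sup>+y. ennreal (\<bar>\<phi> (y + x)\<bar> powr p) \<partial>lborel))"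
      unfolding F_def by (subst nn_integral_cmult, measurable, subst nn_integral_add) auto
    also have "(\<integral>\<^sup>+y. ennreal (\<bar>\<phi> (y + x)\<bar> powr p) \<partial>lborel) = (\<integral>\<^sup>+y. ennreal (\<bar>\<phi> y\<bar> powr p) \<partial>lborel)"
      by (rule nn_integral_lborel_translation) measurable
    also have "ennreal (2 powr p) * (F x + \<dots>) \<le> ennreal (2 powr p) * (F x + ennreal B)"
      using M by (intro mult_left_mono add_left_mono) auto
    finally have XF: "ennreal X \<le> ennreal (2 powr p) * (F x + ennreal B)" .
    have "l powr p \<le> \<bar>\<phi> x\<bar> powr p" using True l p by (intro powr_mono2) auto
    \<comment> \<open>This is where the choice of \<open>\<rho>\<close> acts: the summand with
      \<open>B\<close> is at most half of \<open>X\<close> and can be absorbed, leaving only the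
      oscillation.\<close>
    then have "2 * (2 powr p * B) \<le> X"
      using \<rho> mult_left_mono[of "l powr p" "\<bar>\<phi> x\<bar> powr p" "\<rho> ^ ?n"] by (simp add: X_def)
    then have "ennreal (\<bar>\<phi> x\<bar> powr p) \<le> ennreal c * F x"
    proof (cases "F x")
      case (real f)
      have "X \<le> 2 powr p * (f + B)"
        using XF real B by (simp add: ennreal_plus[symmetric] ennreal_mult[symmetric] del: ennreal_plus)
      then have "X \<le> 2 * 2 powr p * f"
        using \<open>2 * (2 powr p * B) \<le> X\<close> by (simp add: distrib_left)
      then have "\<bar>\<phi> x\<bar> powr p \<le> c * f"
        using \<rho>(1) by (simp add: X_def c_def field_simps)
      then show ?thesis using real c by (simp add: ennreal_mult[symmetric] ennreal_leI)
    next
      case top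
      then show ?thesis using \<rho> by (simp add: c_def ennreal_mult_top)
    qed
    then show ?thesis using True by simp
  qed simp
  have "(\<integral>\<^sup>+x. ennreal (\<bar>\<phi> x\<bar> powr p) * indicator {x. l < \<bar>\<phi> x\<bar>} x \<partial>lborel) \<le> (\<integral>\<^sup>+x. ennreal c * F x \<partial>lborel)"
    using pw by (rule nn_integral_mono)
  also have "\<dots> = ennreal c * (\<integral>\<^sup>+x. F x \<partial>lborel)" by (rule nn_integral_cmult) simp
  also have "\<dots> \<le> ennreal c * (ennreal ((\<rho> * ?n) powr p * B) * ennreal (\<rho> ^ ?n))"
    using F by (intro mult_left_mono) auto
  also have "\<dots> = ennreal (c * \<rho> ^ ?n * ((\<rho> * ?n) powr p * B))"
    using c(1) B \<rho>(1) by (simp add: ennreal_mult[symmetric] mult_ac)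
  finally show ?thesis by (simp only: c(2))
qed

text \<open>For \<open>t > 1\<close> the single term with \<open>2 ^ k < t \<le> 2 ^ (k + 1)\<close>
  suffices, because \<open>t powr (s - p)\<close> is at most
  \<open>2 powr ((k + 1) * (s - p))\<close>.\<close>

lemma powr_dyadic_le:
  fixes t p s :: real
  assumes t: "0 \<le> t" and s: "p \<le> s"
  shows "ennreal (t powr s) \<le> ennreal (t powr p) +
    (\<Sum>k. ennreal (2 powr ((real k + 1) * (s - p))) * (ennreal (t powr p) * indicator {t. 2 ^ k < t} t))"
proof (cases "t \<le> 1")
  case True
  then have "t powr s \<le> t powr p" using t s by (intro powr_mono') auto
  then show ?thesis by (intro add_increasing2) (auto intro: ennreal_leI)
next
  case False
  define m where "m = (LEAST m. t \<le> 2 ^ m)"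
  have ex: "\<exists>m. t \<le> 2 ^ m" using real_arch_pow[of 2 t] by (auto intro: less_imp_le)
  then have m: "t \<le> 2 ^ m" unfolding m_def by (rule LeastI_ex)
  then have "m \<noteq> 0" using False by (cases m) auto
  then obtain k where k: "m = Suc k" by (cases m) auto
  have tk: "2 ^ k < t" using not_less_Least[of k "\<lambda>m. t \<le> 2 ^ m"] k by (auto simp: m_def)
  have "t powr s = t powr (s - p) * t powr p" by (simp flip: powr_add)
  also have "\<dots> \<le> (2 ^ Suc k) powr (s - p) * t powr p"
    using m k t s by (intro mult_right_mono powr_mono2) auto
  also have "(2::real) ^ Suc k = 2 powr (real k + 1)" by (simp add: powr_add powr_realpow)
  also have "\<dots> powr (s - p) = 2 powr ((real k + 1) * (s - p))" by (rule powr_powr)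
  finally have "ennreal (t powr s) \<le> ennreal (2 powr ((real k + 1) * (s - p))) * (ennreal (t powr p) * indicator {t. 2 ^ k < t} t)"
    using tk by (simp add: ennreal_mult[symmetric] ennreal_leI)
  also have "\<dots> \<le> (\<Sum>k. ennreal (2 powr ((real k + 1) * (s - p))) * (ennreal (t powr p) * indicator {t. 2 ^ k < t} t))"
    using sum_le_suminf[OF summableI finite.insertI[OF finite.emptyI, of k],
        of "\<lambda>k. ennreal (2 powr ((real k + 1) * (s - p))) * (ennreal (t powr p) * indicator {t. 2 ^ k < t} t)"]
    by simp
  finally show ?thesis by (rule add_increasing[rotated]) simp
qed

text \<open>The superlevel bound is applied at the levels \<open>2 ^ k\<close> with the cube size
  adapted to each. The constant depends on \<open>\<phi>\<close> only through \<open>B\<close>,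
  which suffices since the functions it serves are bounded in norm beforehand.\<close>

lemma sobolev_inequality:
  fixes p s B :: real
  assumes p: "1 \<le> p" and s: "p \<le> s" "s < p + p * p / CARD('n)" and B: "0 < B"
  obtains C where "0 \<le> C" "\<And>\<phi> :: real ^ 'n::finite \<Rightarrow> real. C1_compact \<phi> \<Longrightarrow>
    (\<integral>\<^sup>+x. ennreal (\<bar>\<phi> x\<bar> powr p) \<partial>lborel) \<le> ennreal B \<Longrightarrow>
    (\<integral>\<^sup>+x. ennreal (norm (gradient \<phi> x) powr p) \<partial>lborel) \<le> ennreal B \<Longrightarrow>
    (\<integral>\<^sup>+x. ennreal (\<bar>\<phi> x\<bar> powr s) \<partial>lborel) \<le> ennreal C"
proof -
  let ?n = "real CARD('n)"
  have n: "0 < ?n" by simp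
  define E where "E = 2 * 2 powr p * B"
  have E: "0 < E" using B by (simp add: E_def)
  \<comment> \<open>Solves \<open>\<rho> k ^ n * (2 ^ k) powr p = E\<close>, the condition on the
    cube at level \<open>2 ^ k\<close>.\<close>
  define \<rho> where "\<rho> k = (E * 2 powr (- (p * real k))) powr (1 / ?n)" for k :: nat
  define c where "c k = 2 powr ((real k + 1) * (s - p)) * (2 * 2 powr p * ((\<rho> k * ?n) powr p * B))" for k :: nat
  \<comment> \<open>The ratio of consecutive bounds \<open>c k\<close>: the dyadic weight gains
    \<open>2 powr (s - p)\<close> per level, the superlevel bound loses
    \<open>2 powr (p * p / n)\<close>. The assumption on \<open>s\<close> says that it is below
    1.\<close>
  define q where "q = 2 powr (s - p - p * p / ?n)"
  define K where "K = 2 powr (s - p) * E * ?n powr p * E powr (p / ?n)"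
  have ceq: "c k = K * q ^ k" for k
  proof -
    have "\<rho> k powr p = E powr (p / ?n) * 2 powr (- (p * p / ?n) * real k)"
      by (simp add: \<rho>_def powr_mult powr_powr) (simp add: field_simps)
    moreover have "q ^ k = 2 powr ((s - p) * real k) * 2 powr (- (p * p / ?n) * real k)"
      unfolding q_def powr_add[symmetric] powr_power[symmetric] 
      by (simp add: powr_realpow[symmetric] powr_powr algebra_simps)
    moreover have "2 powr ((real k + 1) * (s - p)) = 2 powr (s - p) * 2 powr ((s - p) * real k)"
      unfolding powr_add[symmetric] by (simp add: algebra_simps)
    ultimately show ?thesis by (simp add: c_def K_def E_def powr_mult)
  qed
  have q: "0 < q" "q < 1"
    using s by (auto simp: q_def intro: powr_less_one)
  have K: "0 \<le> K" using E by (simp add: K_def)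
  define C where "C = B + K * (1 / (1 - q))"
  have csum: "(\<Sum>k. ennreal (c k)) = ennreal (K * (1 / (1 - q)))"
  proof -
    have "(\<lambda>k. K * q ^ k) sums (K * (1 / (1 - q)))" using q by (intro sums_mult geometric_sums) auto
    then have "(\<lambda>k. c k) sums (K * (1 / (1 - q)))" by (simp only: ceq)
    moreover have "0 \<le> c k" for k using K q by (simp add: ceq)
    ultimately show ?thesis by (simp add: suminf_ennreal2 sums_iff)
  qed
  show ?thesis
  proof (rule that[of C])
    show "0 \<le> C" using B K q by (simp add: C_def)
    fix \<phi> :: "real ^ 'n \<Rightarrow> real"
    assume \<phi>: "C1_compact \<phi>" and M: "(\<integral>\<^sup>+x. ennreal (\<bar>\<phi> x\<bar> powr p) \<partial>lborel) \<le> ennreal B"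
      and A: "(\<integral>\<^sup>+x. ennreal (norm (gradient \<phi> x) powr p) \<partial>lborel) \<le> ennreal B"
    note [measurable] = C1_compact_borel[OF \<phi>]
    have tail: "(\<integral>\<^sup>+x. ennreal (2 powr ((real k + 1) * (s - p))) * (ennreal (\<bar>\<phi> x\<bar> powr p) * indicator {x. 2 ^ k < \<bar>\<phi> x\<bar>} x) \<partial>lborel)
        \<le> ennreal (c k)" for k :: nat
    proof -
      have "0 < \<rho> k" using E by (simp add: \<rho>_def)
      moreover have "\<rho> k ^ CARD('n) * (2 ^ k) powr p = 2 * 2 powr p * B"
      proof -
        have "\<rho> k ^ CARD('n) = E * 2 powr (- (p * real k))"
          using E n by (subst powr_realpow[symmetric]) (simp_all add: \<rho>_def powr_powr)
        moreover have "(2 ^ k) powr p = 2 powr (p * real k)"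
          by (simp add: powr_realpow[symmetric] powr_powr mult.commute)
        ultimately show ?thesis by (simp add: E_def powr_minus)
      qed
      ultimately have "(\<integral>\<^sup>+x. ennreal (\<bar>\<phi> x\<bar> powr p) * indicator {x. 2 ^ k < \<bar>\<phi> x\<bar>} x \<partial>lborel)
          \<le> ennreal (2 * 2 powr p * ((\<rho> k * CARD('n)) powr p * B))"
        by (intro superlevel_integral_le[OF \<phi> p B _ M A]) auto
      then have "ennreal (2 powr ((real k + 1) * (s - p))) * (\<integral>\<^sup>+x. ennreal (\<bar>\<phi> x\<bar> powr p) * indicator {x. 2 ^ k < \<bar>\<phi> x\<bar>} x \<partial>lborel)
          \<le> ennreal (2 powr ((real k + 1) * (s - p))) * ennreal (2 * 2 powr p * ((\<rho> k * CARD('n)) powr p * B))"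
        by (intro mult_left_mono) auto
      also have "\<dots> = ennreal (c k)" using B by (simp add: c_def ennreal_mult)
      finally show ?thesis by (subst nn_integral_cmult) auto
    qed
    have "(\<integral>\<^sup>+x. ennreal (\<bar>\<phi> x\<bar> powr s) \<partial>lborel) \<le> (\<integral>\<^sup>+x. ennreal (\<bar>\<phi> x\<bar> powr p) +
        (\<Sum>k. ennreal (2 powr ((real k + 1) * (s - p))) * (ennreal (\<bar>\<phi> x\<bar> powr p) * indicator {x. 2 ^ k < \<bar>\<phi> x\<bar>} x)) \<partial>lborel)"
    proof (rule nn_integral_mono)
      fix x show "ennreal (\<bar>\<phi> x\<bar> powr s) \<le> ennreal (\<bar>\<phi> x\<bar> powr p) +
        (\<Sum>k. ennreal (2 powr ((real k + 1) * (s - p))) * (ennreal (\<bar>\<phi> x\<bar> powr p) * indicator {x. 2 ^ k < \<bar>\<phi> x\<bar>} x))"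
        using powr_dyadic_le[of "\<bar>\<phi> x\<bar>" p s] s by (simp add: indicator_def)
    qed
    also have "\<dots> = (\<integral>\<^sup>+x. ennreal (\<bar>\<phi> x\<bar> powr p) \<partial>lborel) + (\<Sum>k. \<integral>\<^sup>+x.
        ennreal (2 powr ((real k + 1) * (s - p))) * (ennreal (\<bar>\<phi> x\<bar> powr p) * indicator {x. 2 ^ k < \<bar>\<phi> x\<bar>} x) \<partial>lborel)"
      by (subst nn_integral_add, measurable, subst nn_integral_suminf) auto
    also have "\<dots> \<le> ennreal B + (\<Sum>k. ennreal (c k))"
      using M tail by (intro add_mono suminf_le) auto
    also have "\<dots> = ennreal C"
      unfolding csum C_def using B K q by (subst ennreal_plus) auto
    finally show "(\<integral>\<^sup>+x. ennreal (\<bar>\<phi> x\<bar> powr s) \<partial>lborel) \<le> ennreal C" .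
  qed
qed

section \<open>Transfer of eigenvalues along odd maps\<close>

lemma nn_integral_lebesgue_on_eq_lborel:
  fixes f :: "real ^ 'n::finite \<Rightarrow> ennreal"
  assumes "\<Omega> \<in> sets lebesgue" "\<And>x. x \<notin> \<Omega> \<Longrightarrow> f x = 0"
  shows "(\<integral>\<^sup>+x. f x \<partial>lebesgue_on \<Omega>) = (\<integral>\<^sup>+x. f x \<partial>lborel)"
proof -
  have "f x * indicator \<Omega> x = f x" for x using assms(2)[of x] by (cases "x \<in> \<Omega>") auto
  then show ?thesis using assms(1) by (simp add: nn_integral_restrict_space nn_integral_completion)
qed

context double_phase_domain
begin

section \<open>The Sobolev bound on the closure of the test functions\<close>

lemma L_norm_le_W1_norm: "u \<in> W1 \<Omega> G \<Longrightarrow> L_norm \<Omega> G u \<le> W1_norm \<Omega> G u"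
  using grad_norm_nonneg by (simp add: W1_norm_def)

lemma grad_norm_le_W1_norm: "u \<in> W1 \<Omega> G \<Longrightarrow> grad_norm \<Omega> G u \<le> W1_norm \<Omega> G u"
  using L_norm_nonneg by (simp add: W1_norm_def)

lemma test_function_powr_le:
  assumes \<phi>: "\<phi> \<in> test_functions \<Omega>" and B: "0 < B"
    and L: "L_norm \<Omega> G (abs_aefun \<phi>) \<le> B" and g: "grad_norm \<Omega> G (abs_aefun \<phi>) \<le> B"
  shows "(\<integral>\<^sup>+x. ennreal (\<bar>\<phi> x\<bar> powr r) \<partial>lborel) \<le> ennreal (B powr r)"
    "(\<integral>\<^sup>+x. ennreal (norm (gradient \<phi> x) powr r) \<partial>lborel) \<le> ennreal (B powr r)"
proof -
  have W: "abs_aefun \<phi> \<in> W1 \<Omega> G" by (rule test_function_in_W1[OF \<phi>])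
  have g0: "gradient \<phi> x = 0" if "x \<notin> \<Omega>" for x
    using that \<phi> gradient_eq_0_outside[of x \<phi>] by (auto simp: test_functions_def)
  have "(\<integral>\<^sup>+x. ennreal (\<bar>\<phi> x\<bar> powr r) \<partial>lborel) = (\<integral>\<^sup>+x. ennreal (\<bar>\<phi> x\<bar> powr r) \<partial>lebesgue_on \<Omega>)"
    by (rule nn_integral_lebesgue_on_eq_lborel[symmetric]) (simp_all add: test_function_eq_0[OF \<phi>])
  also have "\<dots> = (\<integral>\<^sup>+x. ennreal (\<bar>rep_aefun (abs_aefun \<phi>) x\<bar> powr r) \<partial>lebesgue_on \<Omega>)"
    using AE_\<Omega>I[OF rep_abs_aefun[of \<phi>]] by (intro nn_integral_cong_AE) (auto elim: eventually_mono)
  also have "\<dots> \<le> ennreal (B powr r)"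
    using nn_integral_powr_le[OF W1D(1)[OF W] B] L by (simp add: L_norm_def)
  finally show "(\<integral>\<^sup>+x. ennreal (\<bar>\<phi> x\<bar> powr r) \<partial>lborel) \<le> ennreal (B powr r)" .
  have "(\<integral>\<^sup>+x. ennreal (norm (gradient \<phi> x) powr r) \<partial>lborel) = (\<integral>\<^sup>+x. ennreal (norm (gradient \<phi> x) powr r) \<partial>lebesgue_on \<Omega>)"
    by (rule nn_integral_lebesgue_on_eq_lborel[symmetric]) (simp_all add: g0)
  also have "\<dots> = (\<integral>\<^sup>+x. ennreal (\<bar>norm (grad \<Omega> (abs_aefun \<phi>) x)\<bar> powr r) \<partial>lebesgue_on \<Omega>)"
    using test_function_grad[OF \<phi>] by (intro nn_integral_cong_AE) (auto elim: eventually_mono)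
  also have "\<dots> \<le> ennreal (B powr r)"
    using nn_integral_powr_le[OF W1D(4)[OF W] B] g by (simp add: grad_norm_def)
  finally show "(\<integral>\<^sup>+x. ennreal (norm (gradient \<phi> x) powr r) \<partial>lborel) \<le> ennreal (B powr r)" .
qed

text \<open>Norm convergence gives convergence in the mean of order \<open>r\<close>, hence almost
  everywhere along a subsequence. It prepares the use of Fatou's lemma.\<close>

lemma W0_AE_approximation:
  assumes u: "u \<in> W0 \<Omega> G"
  obtains \<phi> where "\<And>k. \<phi> k \<in> test_functions \<Omega>" "\<And>k. W1_norm \<Omega> G (abs_aefun (\<phi> k) - u) \<le> 1"
    "AE x in lebesgue_on \<Omega>. (\<lambda>k. \<phi> k x) \<longlonglongrightarrow> rep_aefun u x"
proof -
  have uW: "u \<in> W1 \<Omega> G" using u W0_subset_W1 by auto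
  have "\<exists>\<phi>\<in>test_functions \<Omega>. W1_norm \<Omega> G (abs_aefun \<phi> - u) < 1 / real (Suc k)" for k
    using u unfolding W0_iff by (metis of_nat_0_less_iff zero_less_Suc zero_less_divide_1_iff)
  then obtain \<psi> where \<psi>: "\<And>k. \<psi> k \<in> test_functions \<Omega>" "\<And>k. W1_norm \<Omega> G (abs_aefun (\<psi> k) - u) < 1 / real (Suc k)"
    by metis
  define v where "v k = abs_aefun (\<psi> k) - u" for k
  have vW: "v k \<in> W1 \<Omega> G" for k
    unfolding v_def using uW test_function_in_W1[OF \<psi>(1)] by (rule W1.diff_mem[rotated])
  have [measurable]: "rep_aefun (v k) \<in> borel_measurable (lebesgue_on \<Omega>)" for k
    using W1D(1)[OF vW[of k]] by (simp add: finite_modular_def)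
  define w where "w k x = \<bar>rep_aefun (v k) x\<bar> powr r" for k x
  have wm [measurable]: "w k \<in> borel_measurable (lebesgue_on \<Omega>)" for k unfolding w_def[abs_def] by measurable
  have wint: "(\<integral>\<^sup>+x. ennreal (w k x) \<partial>lebesgue_on \<Omega>) \<le> ennreal ((1 / real (Suc k)) powr r)" for k
    unfolding w_def
    using nn_integral_powr_le[OF W1D(1)[OF vW[of k]], of "1 / real (Suc k)"] L_norm_le_W1_norm[OF vW[of k]] \<psi>(2)[of k]
    by (simp add: v_def L_norm_def)
  have w0: "0 \<le> w k x" for k x by (simp add: w_def)
  have wI: "integrable (lebesgue_on \<Omega>) (w k)" for k
    using wint[of k] w0 by (intro integrableI_nonneg) (auto intro: le_less_trans)
  have wle: "(\<integral>x. norm (w k x) \<partial>lebesgue_on \<Omega>) \<le> (1 / real (Suc k)) powr r" for k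
  proof -
    have "(\<integral>x. norm (w k x) \<partial>lebesgue_on \<Omega>) = enn2real (\<integral>\<^sup>+x. ennreal (w k x) \<partial>lebesgue_on \<Omega>)"
      using w0 by (subst integral_eq_nn_integral) auto
    also have "\<dots> \<le> enn2real (ennreal ((1 / real (Suc k)) powr r))"
      using wint[of k] by (intro enn2real_mono) auto
    finally show ?thesis by simp
  qed
  have plim: "(\<lambda>k. (1 / real (Suc k)) powr r) \<longlonglongrightarrow> 0"
  proof -
    have "(\<lambda>k. 1 / real (Suc k)) \<longlonglongrightarrow> 0" using LIMSEQ_inverse_real_of_nat by (simp add: inverse_eq_divide)
    then have "(\<lambda>k. (1 / real (Suc k)) powr r) \<longlonglongrightarrow> 0 powr r"
      using r_gt_1 by (intro tendsto_powr') simp_all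
    then show ?thesis by simp
  qed
  have wlim: "(\<lambda>k. \<integral>x. norm (w k x) \<partial>lebesgue_on \<Omega>) \<longlonglongrightarrow> 0"
  proof (rule tendsto_sandwich[OF _ _ tendsto_const plim])
    show "eventually (\<lambda>k. 0 \<le> (\<integral>x. norm (w k x) \<partial>lebesgue_on \<Omega>)) sequentially"
      by (intro always_eventually allI integral_nonneg_AE) simp
    show "eventually (\<lambda>k. (\<integral>x. norm (w k x) \<partial>lebesgue_on \<Omega>) \<le> (1 / real (Suc k)) powr r) sequentially"
      by (intro always_eventually allI wle)
  qed
  from tendsto_L1_AE_subseq[OF wI wlim]
  obtain \<sigma> :: "nat \<Rightarrow> nat" where \<sigma>: "AE x in lebesgue_on \<Omega>. (\<lambda>k. w (\<sigma> k) x) \<longlonglongrightarrow> 0"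
    by blast
  have rep_v: "AE x in lebesgue_on \<Omega>. \<forall>k. \<psi> k x = rep_aefun (v k) x + rep_aefun u x"
  proof (subst AE_all_countable, intro allI)
    fix k
    show "AE x in lebesgue_on \<Omega>. \<psi> k x = rep_aefun (v k) x + rep_aefun u x"
      using AE_\<Omega>I[OF rep_abs_aefun[of "\<psi> k"]] AE_\<Omega>I[OF rep_aefun_plus[of "v k" u]]
      by eventually_elim (simp add: v_def)
  qed
  show ?thesis
  proof (rule that[of "\<lambda>k. \<psi> (\<sigma> k)"])
    fix k
    have "W1_norm \<Omega> G (abs_aefun (\<psi> (\<sigma> k)) - u) < 1 / real (Suc (\<sigma> k))" by (rule \<psi>(2))
    also have "\<dots> \<le> 1" by simp
    finally show "W1_norm \<Omega> G (abs_aefun (\<psi> (\<sigma> k)) - u) \<le> 1" by simp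
  next
    show "AE x in lebesgue_on \<Omega>. (\<lambda>k. \<psi> (\<sigma> k) x) \<longlonglongrightarrow> rep_aefun u x"
      using \<sigma> rep_v
    proof eventually_elim
      case (elim x)
      have "(\<lambda>k. w (\<sigma> k) x powr (1 / r)) \<longlonglongrightarrow> 0 powr (1 / r)"
        using elim(1) r_gt_1 w0 by (intro tendsto_powr') simp_all
      then have "(\<lambda>k. \<bar>rep_aefun (v (\<sigma> k)) x\<bar>) \<longlonglongrightarrow> 0"
        using r_gt_1 by (simp add: w_def powr_powr)
      then have "(\<lambda>k. rep_aefun (v (\<sigma> k)) x + rep_aefun u x) \<longlonglongrightarrow> 0 + rep_aefun u x"
        by (intro tendsto_add tendsto_const) (simp add: tendsto_rabs_zero_iff)
      then show ?case using elim(2) by simp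
    qed
  qed (rule \<psi>(1))
qed

text \<open>Fatou's lemma along almost everywhere convergent test functions. Their norms exceed
  those of \<open>u\<close> by at most 1, which is why the inequality is invoked with
  \<open>B + 1\<close>.\<close>

lemma sobolev_W0:
  assumes S: "r \<le> S" "S < r + r * r / CARD('n)" and B: "0 < B"
  obtains C where "0 \<le> C" "\<And>u. u \<in> W0 \<Omega> G \<Longrightarrow> L_norm \<Omega> G u \<le> B \<Longrightarrow> grad_norm \<Omega> G u \<le> B \<Longrightarrow>
    (\<integral>\<^sup>+x. ennreal (\<bar>rep_aefun u x\<bar> powr S) \<partial>lebesgue_on \<Omega>) \<le> ennreal C"
proof -
  have r1: "1 \<le> r" and B1: "0 < B + 1" and B1p: "0 < (B + 1) powr r" using r_gt_1 B by auto
  obtain C where C: "0 \<le> C" "\<And>\<phi> :: real ^ 'n::finite \<Rightarrow> real. C1_compact \<phi> \<Longrightarrow>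
    (\<integral>\<^sup>+x. ennreal (\<bar>\<phi> x\<bar> powr r) \<partial>lborel) \<le> ennreal ((B + 1) powr r) \<Longrightarrow>
    (\<integral>\<^sup>+x. ennreal (norm (gradient \<phi> x) powr r) \<partial>lborel) \<le> ennreal ((B + 1) powr r) \<Longrightarrow>
    (\<integral>\<^sup>+x. ennreal (\<bar>\<phi> x\<bar> powr S) \<partial>lborel) \<le> ennreal C"
    using sobolev_inequality[OF r1 S B1p] by metis
  show ?thesis
  proof (rule that[OF C(1)])
    fix u assume u: "u \<in> W0 \<Omega> G" and L: "L_norm \<Omega> G u \<le> B" and g: "grad_norm \<Omega> G u \<le> B"
    have uW: "u \<in> W1 \<Omega> G" using u W0_subset_W1 by auto
    obtain \<phi> where \<phi>: "\<And>k. \<phi> k \<in> test_functions \<Omega>" "\<And>k. W1_norm \<Omega> G (abs_aefun (\<phi> k) - u) \<le> 1"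
      and lim: "AE x in lebesgue_on \<Omega>. (\<lambda>k. \<phi> k x) \<longlonglongrightarrow> rep_aefun u x"
      by (rule W0_AE_approximation[OF u]) (rule that)
    have c1: "C1_compact (\<phi> k)" for k by (rule test_functions_C1_compact[OF \<phi>(1)])
    have \<phi>m: "\<phi> k \<in> borel_measurable (lebesgue_on \<Omega>)" for k
      using weak_gradientD(1)[OF weak_gradient_test_function[OF open_\<Omega> \<phi>(1)]] .
    have bound: "(\<integral>\<^sup>+x. ennreal (\<bar>\<phi> k x\<bar> powr S) \<partial>lebesgue_on \<Omega>) \<le> ennreal C" for k
    proof -
      have vW: "abs_aefun (\<phi> k) - u \<in> W1 \<Omega> G"
        using uW test_function_in_W1[OF \<phi>(1)] by (rule W1.diff_mem[rotated])
      have "L_norm \<Omega> G (abs_aefun (\<phi> k)) \<le> B + 1" "grad_norm \<Omega> G (abs_aefun (\<phi> k)) \<le> B + 1"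
        using L_norm_triangle[OF vW uW] grad_norm_triangle[OF vW uW] \<phi>(2)[of k] L g
          L_norm_le_W1_norm[OF vW] grad_norm_le_W1_norm[OF vW] by auto
      from test_function_powr_le[OF \<phi>(1) B1 this]
      have "(\<integral>\<^sup>+x. ennreal (\<bar>\<phi> k x\<bar> powr S) \<partial>lborel) \<le> ennreal C" by (intro C(2) c1)
      then show ?thesis
        by (subst nn_integral_lebesgue_on_eq_lborel) (simp_all add: test_function_eq_0[OF \<phi>(1)])
    qed
    have "(\<integral>\<^sup>+x. ennreal (\<bar>rep_aefun u x\<bar> powr S) \<partial>lebesgue_on \<Omega>)
        = (\<integral>\<^sup>+x. liminf (\<lambda>k. ennreal (\<bar>\<phi> k x\<bar> powr S)) \<partial>lebesgue_on \<Omega>)"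
    proof (rule nn_integral_cong_AE)
      show "AE x in lebesgue_on \<Omega>. ennreal (\<bar>rep_aefun u x\<bar> powr S) = liminf (\<lambda>k. ennreal (\<bar>\<phi> k x\<bar> powr S))"
        using lim
      proof eventually_elim
        case (elim x)
        have "(\<lambda>k. \<bar>\<phi> k x\<bar> powr S) \<longlonglongrightarrow> \<bar>rep_aefun u x\<bar> powr S"
          using S r_gt_1 by (intro tendsto_powr' tendsto_rabs elim tendsto_const) simp
        then have "(\<lambda>k. ennreal (\<bar>\<phi> k x\<bar> powr S)) \<longlonglongrightarrow> ennreal (\<bar>rep_aefun u x\<bar> powr S)"
          by (rule tendsto_ennrealI)
        then show ?case by (rule lim_imp_Liminf[OF sequentially_bot, symmetric])
      qed
    qed
    also have "\<dots> \<le> liminf (\<lambda>k. \<integral>\<^sup>+x. ennreal (\<bar>\<phi> k x\<bar> powr S) \<partial>lebesgue_on \<Omega>)"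
      using \<phi>m by (intro nn_integral_liminf) auto
    also have "\<dots> \<le> ennreal C"
    proof -
      have "liminf (\<lambda>k. \<integral>\<^sup>+x. ennreal (\<bar>\<phi> k x\<bar> powr S) \<partial>lebesgue_on \<Omega>) \<le> limsup (\<lambda>k. \<integral>\<^sup>+x. ennreal (\<bar>\<phi> k x\<bar> powr S) \<partial>lebesgue_on \<Omega>)"
        by (rule Liminf_le_Limsup) simp
      also have "\<dots> \<le> ennreal C" using bound by (intro Limsup_bounded always_eventually) auto
      finally show ?thesis .
    qed
    finally show "(\<integral>\<^sup>+x. ennreal (\<bar>rep_aefun u x\<bar> powr S) \<partial>lebesgue_on \<Omega>) \<le> ennreal C" .
  qed
qed

text \<open>Finitely many test functions have bounded gradients, so one \<open>M\<close> serves all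
  coefficients in the unit interval up to sign. The bound refers to no integrand and hence is
  uniform in the exponents.\<close>

lemma test_span_gradient_bound:
  assumes "finite F" "F \<subseteq> abs_aefun ` test_functions \<Omega>"
  shows "\<exists>M\<ge>0. \<forall>c. (\<forall>f\<in>F. \<bar>c f\<bar> \<le> 1) \<longrightarrow>
    (AE x in lebesgue_on \<Omega>. norm (grad \<Omega> (\<Sum>f\<in>F. c f *\<^sub>R f) x) \<le> M)"
  using assms
proof (induction F rule: finite_induct)
  case empty
  have "AE x in lebesgue_on \<Omega>. norm (grad \<Omega> 0 x) \<le> 0"
    using grad_scaleR[OF zero_in_W1, of 0] by (auto elim: eventually_mono)
  then show ?case by auto
next
  case (insert g F)
  then obtain M where M: "0 \<le> M" "\<And>c. (\<forall>f\<in>F. \<bar>c f\<bar> \<le> 1) \<Longrightarrow>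
    (AE x in lebesgue_on \<Omega>. norm (grad \<Omega> (\<Sum>f\<in>F. c f *\<^sub>R f) x) \<le> M)" by auto
  obtain \<phi> where \<phi>: "g = abs_aefun \<phi>" "\<phi> \<in> test_functions \<Omega>" using insert by auto
  obtain R M' where M': "0 \<le> M'" "\<And>x. norm (gradient \<phi> x) \<le> M'"
    using C1_compact_bounds[OF test_functions_C1_compact[OF \<phi>(2)]] by metis
  have gW: "g \<in> W1 \<Omega> G" using test_function_in_W1[OF \<phi>(2)] \<phi>(1) by simp
  have FW: "(\<Sum>f\<in>F. c f *\<^sub>R f) \<in> W1 \<Omega> G" for c
    using insert test_function_in_W1 by (intro subspace_sum[OF subspace_W1] W1_scaleR) auto
  have "AE x in lebesgue_on \<Omega>. norm (grad \<Omega> (\<Sum>f\<in>insert g F. c f *\<^sub>R f) x) \<le> M' + M"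
    if c: "\<forall>f\<in>insert g F. \<bar>c f\<bar> \<le> 1" for c
  proof -
    have eq: "(\<Sum>f\<in>insert g F. c f *\<^sub>R f) = c g *\<^sub>R g + (\<Sum>f\<in>F. c f *\<^sub>R f)" using insert by simp
    have c': "\<forall>f\<in>F. \<bar>c f\<bar> \<le> 1" using c by auto
    show ?thesis
      using grad_plus[OF W1_scaleR[OF gW] FW, of "c g" c] grad_scaleR[OF gW, of "c g"] M(2)[OF c']
        test_function_grad[OF \<phi>(2)]
    proof eventually_elim
      case (elim x)
      have "grad \<Omega> (\<Sum>f\<in>insert g F. c f *\<^sub>R f) x = c g *\<^sub>R gradient \<phi> x + grad \<Omega> (\<Sum>f\<in>F. c f *\<^sub>R f) x"
        unfolding eq using elim by (simp add: \<phi>(1))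
      then have "norm (grad \<Omega> (\<Sum>f\<in>insert g F. c f *\<^sub>R f) x) \<le> norm (c g *\<^sub>R gradient \<phi> x) + norm (grad \<Omega> (\<Sum>f\<in>F. c f *\<^sub>R f) x)"
        by (simp only: norm_triangle_ineq)
      also have "norm (c g *\<^sub>R gradient \<phi> x) \<le> 1 * M'"
        unfolding norm_scaleR using c M' by (intro mult_mono) auto
      finally show ?case using elim by simp
    qed
  qed
  then show ?case using M(1) M'(1) by (intro exI[of _ "M' + M"]) auto
qed

lemma index_set_W_family:
  assumes "K \<in> W_family i \<Omega> G m"
  shows "index_set (W0_topology \<Omega> G) K" "K \<subseteq> W0 \<Omega> G" "\<And>u. u \<in> K \<Longrightarrow> L_norm \<Omega> G u = 1"
    "enat m \<le> i (W0_topology \<Omega> G) K"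
proof -
  have "L_norm \<Omega> G 0 = 0" using L_norm_scaleR[OF zero_in_W1, of 0] by simp
  then show "index_set (W0_topology \<Omega> G) K" "K \<subseteq> W0 \<Omega> G" "\<And>u. u \<in> K \<Longrightarrow> L_norm \<Omega> G u = 1"
    "enat m \<le> i (W0_topology \<Omega> G) K"
    using assms by (auto simp: W_family_def index_set_def)
qed

text \<open>\<open>L_norm\<close> is Lipschitz continuous for the Sobolev norm and positive on
  \<open>K\<close>; compactness of \<open>K\<close> is not involved, as continuity is local.\<close>

lemma normalization_continuous:
  assumes K: "K \<subseteq> W0 \<Omega> G" and pos: "\<And>u. u \<in> K \<Longrightarrow> 0 < L_norm \<Omega> G u"
  shows "continuous_map (subtopology (W0_topology \<Omega> G) K) (W0_topology \<Omega> G) (\<lambda>u. (1 / L_norm \<Omega> G u) *\<^sub>R u)"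
  unfolding W0_topology_def
proof (rule continuous_map_normed_subspaces[OF W0.normed_subspace_axioms W0.normed_subspace_axioms K])
  show "(1 / L_norm \<Omega> G u) *\<^sub>R u \<in> W0 \<Omega> G" if "u \<in> K" for u
    using K that by (intro W0.scale_mem) auto
  fix u and e :: real assume u: "u \<in> K" and e: "0 < e"
  let ?l = "L_norm \<Omega> G" and ?N = "W1_norm \<Omega> G"
  have uW: "u \<in> W0 \<Omega> G" "u \<in> W1 \<Omega> G" using u K W0_subset_W1 by auto
  have l: "0 < ?l u" using pos u by auto
  \<comment> \<open>A local Lipschitz constant of the normalization at \<open>u\<close>, valid where
    \<open>L_norm\<close> of \<open>v\<close> is at least half that of \<open>u\<close>; the first
    entry of the minimum defining \<open>d\<close> ensures the latter.\<close>
  define b where "b = (2 / ?l u) * (1 + ?N u / ?l u)"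
  have b: "0 < b" unfolding b_def using l W0.N_nonneg[OF uW(1)] by (intro mult_pos_pos add_pos_nonneg) auto
  define d where "d = min (?l u / 2) (e / b)"
  have d: "0 < d" using l e b by (simp add: d_def)
  have "?N ((1 / ?l v) *\<^sub>R v - (1 / ?l u) *\<^sub>R u) < e" if v: "v \<in> K" "?N (v - u) < d" for v
  proof -
    have vW: "v \<in> W0 \<Omega> G" "v \<in> W1 \<Omega> G" using v K W0_subset_W1 by auto
    have dW: "v - u \<in> W0 \<Omega> G" "v - u \<in> W1 \<Omega> G" using uW vW by (auto intro: W0.diff_mem W1.diff_mem)
    have dW': "u - v \<in> W1 \<Omega> G" using uW vW by (auto intro: W1.diff_mem)
    have N0: "0 \<le> ?N (v - u)" by (rule W0.N_nonneg[OF dW(1)])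
    have "?l v \<le> ?l u + ?N (v - u)" "?l u \<le> ?l v + ?N (v - u)"
      using L_norm_triangle[OF dW(2) uW(2)] L_norm_triangle[OF dW' vW(2)] L_norm_le_W1_norm[OF dW(2)]
        L_norm_le_W1_norm[OF dW'] W0.N_commute[OF uW(1) vW(1)] by auto
    then have ll: "\<bar>?l u - ?l v\<bar> \<le> ?N (v - u)" by linarith
    have lv: "?l u / 2 \<le> ?l v" using ll v(2) by (simp add: d_def min_less_iff_conj) argo
    have lv0: "0 < ?l v" using lv l by linarith
    have eq: "(1 / ?l v) *\<^sub>R v - (1 / ?l u) *\<^sub>R u = (1 / ?l v) *\<^sub>R (v - u) + ((?l u - ?l v) / (?l v * ?l u)) *\<^sub>R u"
    proof -
      have "(?l u - ?l v) / (?l v * ?l u) = 1 / ?l v - 1 / ?l u" using l lv0 by (simp add: field_simps)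
      then show ?thesis by (simp only:) (simp add: scaleR_diff_left scaleR_diff_right)
    qed
    have "?N ((1 / ?l v) *\<^sub>R v - (1 / ?l u) *\<^sub>R u) \<le> ?N ((1 / ?l v) *\<^sub>R (v - u)) + ?N (((?l u - ?l v) / (?l v * ?l u)) *\<^sub>R u)"
      unfolding eq by (intro W0.N_triangle W0.scale_mem dW uW)
    also have "\<dots> = (1 / ?l v) * (?N (v - u) + \<bar>?l u - ?l v\<bar> * (?N u / ?l u))"
      using l lv0 by (simp add: W0.N_scaleR[OF dW(1)] W0.N_scaleR[OF uW(1)] abs_mult distrib_left)
    also have "\<dots> \<le> (1 / ?l v) * (?N (v - u) + ?N (v - u) * (?N u / ?l u))"
      using ll l lv0 W0.N_nonneg[OF uW(1)] by (intro mult_left_mono add_left_mono mult_right_mono) auto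
    also have "\<dots> = (1 / ?l v) * (?N (v - u) * (1 + ?N u / ?l u))" by (simp add: algebra_simps)
    also have "\<dots> \<le> (2 / ?l u) * (?N (v - u) * (1 + ?N u / ?l u))"
    proof (rule mult_right_mono)
      show "1 / ?l v \<le> 2 / ?l u" using lv l lv0 by (simp add: field_simps)
      show "0 \<le> ?N (v - u) * (1 + ?N u / ?l u)"
        using N0 l W0.N_nonneg[OF uW(1)] by (intro mult_nonneg_nonneg add_nonneg_nonneg) auto
    qed
    also have "\<dots> = ?N (v - u) * b" by (simp add: b_def)
    also have "\<dots> < e" using v(2) b by (simp add: d_def pos_less_divide_eq)
    finally show ?thesis .
  qed
  then show "\<exists>d>0. \<forall>v\<in>K. ?N (v - u) < d \<longrightarrow> ?N ((1 / ?l v) *\<^sub>R v - (1 / ?l u) *\<^sub>R u) < e"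
    using d by blast
qed

end

section \<open>Competitors as images under odd maps\<close>

lemma index_set_image:
  assumes K: "index_set T K" and cont: "continuous_map (subtopology T K) S \<pi>"
    and "\<And>u. u \<in> K \<Longrightarrow> \<pi> u \<noteq> 0" "\<And>u. u \<in> K \<Longrightarrow> \<pi> (- u) = - \<pi> u"
  shows "index_set S (\<pi> ` K)"
proof -
  have "compactin (subtopology T K) K" using K by (simp add: index_set_def compactin_subtopology)
  then have "compactin S (\<pi> ` K)" by (rule image_compactin[OF _ cont])
  moreover have neg: "- u \<in> K" if "u \<in> K" for u using K that by (auto simp: index_set_def)
  have "uminus ` \<pi> ` K = \<pi> ` K"
  proof (intro equalityI subsetI)
    fix v assume "v \<in> uminus ` \<pi> ` K"
    then obtain u where "u \<in> K" "v = - \<pi> u" by auto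
    then show "v \<in> \<pi> ` K" using neg assms(4) by (metis imageI)
  next
    fix v assume "v \<in> \<pi> ` K"
    then obtain u where u: "u \<in> K" "v = \<pi> u" by auto
    then have "v = - \<pi> (- u)" using assms(4) by simp
    then show "v \<in> uminus ` \<pi> ` K" using neg u by blast
  qed
  ultimately show ?thesis using K assms(3) by (auto simp: index_set_def)
qed

text \<open>The competitor is the image of \<open>K\<close> after normalization. Both maps are odd
  and continuous and avoid 0, so the index does not drop, while the quotient of the two norms is
  unchanged by normalization and stays at most \<open>c\<close>.\<close>

lemma eigenvalue_le_of_odd_map:
  assumes dom: "double_phase_domain \<Omega> a r s" "double_phase_domain \<Omega> a r' s'"
    and i: "i = genus \<or> topological_index i"
    and K: "K \<in> W_family i \<Omega> (double_phase a r s) m"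
    and \<pi>: "\<And>u. u \<in> K \<Longrightarrow> \<pi> u \<in> W0 \<Omega> (double_phase a r' s')" "\<And>u. u \<in> K \<Longrightarrow> \<pi> (- u) = - \<pi> u"
    and cont: "\<And>u e. u \<in> K \<Longrightarrow> 0 < e \<Longrightarrow> \<exists>d>0. \<forall>v\<in>K. W1_norm \<Omega> (double_phase a r s) (v - u) < d
        \<longrightarrow> W1_norm \<Omega> (double_phase a r' s') (\<pi> v - \<pi> u) < e"
    and pos: "\<And>u. u \<in> K \<Longrightarrow> 0 < L_norm \<Omega> (double_phase a r' s') (\<pi> u)"
    and le: "\<And>u. u \<in> K \<Longrightarrow> grad_norm \<Omega> (double_phase a r' s') (\<pi> u) \<le> c * L_norm \<Omega> (double_phase a r' s') (\<pi> u)"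
  shows "variational_eigenvalue i \<Omega> (double_phase a r' s') m \<le> ereal c"
proof -
  interpret A: double_phase_domain \<Omega> a r s by fact
  interpret B: double_phase_domain \<Omega> a r' s' by fact
  let ?T = "W0_topology \<Omega> A.G" and ?S = "W0_topology \<Omega> B.G"
  define \<nu> where "\<nu> u = (1 / L_norm \<Omega> B.G u) *\<^sub>R u" for u
  note KF = A.index_set_W_family[OF K]
  have tvs: "topological_vector_space ?T" "topological_vector_space ?S"
    unfolding W0_topology_def
    by (rule A.W0.topological_vector_space_norm_topology B.W0.topological_vector_space_norm_topology)+
  have c1: "continuous_map (subtopology ?T K) ?S \<pi>"
    unfolding W0_topology_def
    by (rule continuous_map_normed_subspaces[OF A.W0.normed_subspace_axioms B.W0.normed_subspace_axioms KF(2)])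
      (use \<pi> cont in auto)
  have L0: "L_norm \<Omega> B.G 0 = 0" using B.L_norm_scaleR[OF B.zero_in_W1, of 0] by simp
  have n1: "\<pi> u \<noteq> 0" if "u \<in> K" for u using pos[OF that] L0 by auto
  have K1: "index_set ?S (\<pi> ` K)" by (rule index_set_image[OF KF(1) c1 n1 \<pi>(2)])
  have i1: "i ?T K \<le> i ?S (\<pi> ` K)" by (rule index_mono_image[OF i tvs KF(1) c1 n1 \<pi>(2)])
  have sub: "\<pi> ` K \<subseteq> W0 \<Omega> B.G" using \<pi> by auto
  have c2: "continuous_map (subtopology ?S (\<pi> ` K)) ?S \<nu>"
    unfolding \<nu>_def using pos by (intro B.normalization_continuous[OF sub]) auto
  have W1: "v \<in> W1 \<Omega> B.G" if "v \<in> \<pi> ` K" for v using sub that B.W0_subset_W1 by auto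
  have n2: "\<nu> v \<noteq> 0" if "v \<in> \<pi> ` K" for v
  proof -
    from that obtain u where "u \<in> K" "v = \<pi> u" by blast
    then show ?thesis using pos[of u] n1[of u] by (simp add: \<nu>_def)
  qed
  have odd2: "\<nu> (- v) = - \<nu> v" if "v \<in> \<pi> ` K" for v
    using B.L_norm_scaleR[OF W1[OF that], of "-1"] by (simp add: \<nu>_def)
  have K2: "index_set ?S (\<nu> ` \<pi> ` K)" by (rule index_set_image[OF K1 c2 n2 odd2])
  have i2: "i ?S (\<pi> ` K) \<le> i ?S (\<nu> ` \<pi> ` K)" by (rule index_mono_image[OF i tvs(2,2) K1 c2 n2 odd2])
  have "\<nu> ` \<pi> ` K \<in> W_family i \<Omega> B.G m"
  proof -
    have "\<nu> v \<in> W0 \<Omega> B.G" if "v \<in> \<pi> ` K" for v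
      unfolding \<nu>_def using sub that by (intro B.W0.scale_mem) auto
    moreover have "L_norm \<Omega> B.G (\<nu> v) = 1" if "v \<in> \<pi> ` K" for v
    proof -
      from that obtain u where "u \<in> K" "v = \<pi> u" by blast
      then show ?thesis unfolding \<nu>_def using B.L_norm_scaleR[OF W1[OF that]] pos[of u] by simp
    qed
    ultimately show ?thesis
      using K2 i1 i2 KF(4) by (auto simp: W_family_def index_set_def)
  qed
  then have "variational_eigenvalue i \<Omega> B.G m \<le> (SUP u\<in>\<nu> ` \<pi> ` K. ereal (grad_norm \<Omega> B.G u))"
    unfolding variational_eigenvalue_def by (rule INF_lower)
  also have "\<dots> \<le> ereal c"
  proof (rule SUP_least)
    fix w assume "w \<in> \<nu> ` \<pi> ` K"
    then obtain u where u: "u \<in> K" "w = \<nu> (\<pi> u)" by auto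
    have "grad_norm \<Omega> B.G w = grad_norm \<Omega> B.G (\<pi> u) / L_norm \<Omega> B.G (\<pi> u)"
      unfolding u \<nu>_def using pos[OF u(1)] u by (subst B.grad_norm_scaleR[OF W1]) auto
    also have "\<dots> \<le> c" using le[OF u(1)] pos[OF u(1)] by (simp add: pos_divide_le_eq)
    finally show "ereal (grad_norm \<Omega> B.G w) \<le> ereal c" by simp
  qed
  finally show ?thesis .
qed

section \<open>Comparison of exponents\<close>

text \<open>The names \<open>lo\<close> and \<open>hi\<close> stand for the smaller and the larger
  exponents, later those of the limit and of the sequence. The bound \<open>A\<close> of the weight
  is explicit because the comparison constants contain it.\<close>

locale double_phase_pair =
  lo: double_phase_domain \<Omega> a r s + hi: double_phase_domain \<Omega> a r' s'
  for \<Omega> :: "(real ^ 'n::finite) set" and a :: "real ^ 'n \<Rightarrow> real" and r s r' s' :: real +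
  fixes A :: real
  assumes r_le: "r \<le> r'" and s_le: "s \<le> s'" and A: "\<And>x. x \<in> \<Omega> \<Longrightarrow> a x \<le> A" "0 \<le> A"
begin

text \<open>The integral over the domain of the constant error made in lowering both
  exponents.\<close>

definition \<eta> :: real where
  "\<eta> = ((1 - r / r') + A * (1 - s / s')) * measure lebesgue \<Omega>"

text \<open>The coefficient of the power \<open>S\<close> in the error made in raising both
  exponents, by interpolation with \<open>S\<close>.\<close>

definition \<kappa> :: "real \<Rightarrow> real" where
  "\<kappa> S = (r' - r) / (S - r) + A * ((s' - s) / (S - s))"

lemma emeasure_\<Omega>: "emeasure (lebesgue_on \<Omega>) \<Omega> = ennreal (measure lebesgue \<Omega>)"
proof -
  have "\<Omega> \<in> lmeasurable" using lo.open_\<Omega> lo.bounded_\<Omega> lmeasurable_open by blast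
  then show ?thesis using emeasure_eq_measure2[of \<Omega> lebesgue] by (subst emeasure_restrict_space) auto
qed

lemma \<eta>_nonneg: "0 \<le> \<eta>"
  unfolding \<eta>_def using r_le s_le A(2) lo.r_gt_1 lo.r_less_s
  by (intro mult_nonneg_nonneg add_nonneg_nonneg) auto

lemma modular_lo_le:
  assumes [measurable]: "f \<in> borel_measurable (lebesgue_on \<Omega>)"
  shows "modular \<Omega> lo.G f \<le> modular \<Omega> hi.G f + ennreal \<eta>"
proof -
  define e where "e = (1 - r / r') + A * (1 - s / s')"
  have e: "0 \<le> e" unfolding e_def using r_le s_le A(2) lo.r_gt_1 lo.r_less_s by (intro add_nonneg_nonneg mult_nonneg_nonneg) auto
  have "modular \<Omega> lo.G f \<le> (\<integral>\<^sup>+x. ennreal (hi.G x \<bar>f x\<bar>) + ennreal e \<partial>lebesgue_on \<Omega>)"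
    unfolding modular_def
  proof (rule nn_integral_mono)
    fix x assume "x \<in> space (lebesgue_on \<Omega>)"
    then have x: "x \<in> \<Omega>" by simp
    have s1: "\<bar>f x\<bar> powr s \<le> \<bar>f x\<bar> powr s' + (1 - s / s')" and r1: "\<bar>f x\<bar> powr r \<le> \<bar>f x\<bar> powr r' + (1 - r / r')"
      using r_le s_le lo.r_gt_1 lo.r_less_s by (auto intro!: powr_le_add_const)
    have "a x * \<bar>f x\<bar> powr s \<le> a x * (\<bar>f x\<bar> powr s' + (1 - s / s'))"
      using s1 lo.a_nonneg[OF x] by (intro mult_left_mono) auto
    also have "\<dots> \<le> a x * \<bar>f x\<bar> powr s' + A * (1 - s / s')"
      using A(1)[OF x] s_le lo.r_gt_1 lo.r_less_s unfolding distrib_left by (intro add_left_mono mult_right_mono) auto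
    finally have "lo.G x \<bar>f x\<bar> \<le> hi.G x \<bar>f x\<bar> + e" using r1 by (simp add: double_phase_def e_def)
    then have "ennreal (lo.G x \<bar>f x\<bar>) \<le> ennreal (hi.G x \<bar>f x\<bar> + e)" by (rule ennreal_leI)
    also have "\<dots> = ennreal (hi.G x \<bar>f x\<bar>) + ennreal e" by (rule ennreal_plus[OF hi.G_nonneg[OF x] e])
    finally show "ennreal (lo.G x \<bar>f x\<bar>) \<le> ennreal (hi.G x \<bar>f x\<bar>) + ennreal e" .
  qed
  also have "\<dots> = modular \<Omega> hi.G f + (\<integral>\<^sup>+x. ennreal e \<partial>lebesgue_on \<Omega>)"
    unfolding modular_def by (rule nn_integral_add) measurable
  also have "(\<integral>\<^sup>+x. ennreal e \<partial>lebesgue_on \<Omega>) = ennreal \<eta>"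
    using e by (simp add: emeasure_\<Omega> \<eta>_def e_def ennreal_mult)
  finally show ?thesis .
qed

lemma finite_modular_lo: "finite_modular \<Omega> hi.G f \<Longrightarrow> finite_modular \<Omega> lo.G f"
  using modular_lo_le[of f] by (auto simp: finite_modular_def intro: le_less_trans)

text \<open>Lowering exponents costs a bounded error pointwise, and on a set of finite measure this
  is an error \<open>\<eta>\<close> in the modular.\<close>

lemma luxemburg_lo_le:
  assumes f: "finite_modular \<Omega> hi.G f"
  shows "luxemburg \<Omega> lo.G f \<le> (1 + \<eta>) * luxemburg \<Omega> hi.G f"
proof -
  have fm: "f \<in> borel_measurable (lebesgue_on \<Omega>)" using f by (simp add: finite_modular_def)
  have pos: "0 < 1 + \<eta>" using \<eta>_nonneg by simp
  have "luxemburg \<Omega> lo.G f / (1 + \<eta>) \<le> luxemburg \<Omega> hi.G f"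
  proof (rule dense_ge)
    fix \<gamma> assume \<gamma>: "luxemburg \<Omega> hi.G f < \<gamma>"
    then have g0: "0 < \<gamma>" using hi.luxemburg_nonneg[OF f] by linarith
    have "modular \<Omega> lo.G (\<lambda>x. f x / \<gamma>) \<le> modular \<Omega> hi.G (\<lambda>x. f x / \<gamma>) + ennreal \<eta>"
      using fm by (intro modular_lo_le) auto
    also have "\<dots> \<le> 1 + ennreal \<eta>"
      by (intro add_right_mono hi.modular_divide_le_1_of_luxemburg_less[OF f \<gamma>])
    also have "\<dots> = ennreal (1 + \<eta>)" using \<eta>_nonneg by simp
    finally have "luxemburg \<Omega> lo.G f \<le> \<gamma> * (1 + \<eta>)"
      by (rule lo.luxemburg_le_of_modular_le[OF fm g0 \<eta>_nonneg])
    then show "luxemburg \<Omega> lo.G f / (1 + \<eta>) \<le> \<gamma>" using pos by (simp add: pos_divide_le_eq)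
  qed
  then show ?thesis using pos by (simp add: pos_divide_le_eq mult.commute)
qed

text \<open>Raising exponents is possible only with control of a still higher power
  \<open>S\<close>. That control comes from the Sobolev bound for functions and from the sup bound
  for gradients in the span of finitely many test functions.\<close>

lemma luxemburg_hi_le:
  assumes f: "finite_modular \<Omega> lo.G f" and \<gamma>: "0 < \<gamma>" "luxemburg \<Omega> lo.G f \<le> \<gamma>"
    and S: "r' \<le> S" "s' \<le> S" "r < S" "s < S"
    and C: "0 \<le> C" "(\<integral>\<^sup>+x. ennreal (\<bar>f x / \<gamma>\<bar> powr S) \<partial>lebesgue_on \<Omega>) \<le> ennreal C"
  shows "luxemburg \<Omega> hi.G f \<le> \<gamma> * (1 + \<kappa> S * C)"
proof -
  have [measurable]: "f \<in> borel_measurable (lebesgue_on \<Omega>)" using f by (simp add: finite_modular_def)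
  have \<kappa>: "0 \<le> \<kappa> S" unfolding \<kappa>_def using r_le s_le A(2) S by (intro add_nonneg_nonneg mult_nonneg_nonneg) auto
  have "modular \<Omega> hi.G (\<lambda>x. f x / \<gamma>)
      \<le> (\<integral>\<^sup>+x. ennreal (lo.G x \<bar>f x / \<gamma>\<bar>) + ennreal (\<kappa> S) * ennreal (\<bar>f x / \<gamma>\<bar> powr S) \<partial>lebesgue_on \<Omega>)"
    unfolding modular_def
  proof (rule nn_integral_mono)
    fix x assume "x \<in> space (lebesgue_on \<Omega>)"
    then have x: "x \<in> \<Omega>" by simp
    define t where "t = \<bar>f x / \<gamma>\<bar>"
    have r1: "t powr r' \<le> t powr r + (r' - r) / (S - r) * t powr S"
      using r_le S by (intro powr_le_add_powr) (auto simp: t_def)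
    have "a x * t powr s' \<le> a x * (t powr s + (s' - s) / (S - s) * t powr S)"
      using s_le S lo.a_nonneg[OF x] by (intro mult_left_mono powr_le_add_powr) (auto simp: t_def)
    also have "\<dots> \<le> a x * t powr s + A * ((s' - s) / (S - s) * t powr S)"
      using A(1)[OF x] s_le S unfolding distrib_left by (intro add_left_mono mult_right_mono mult_nonneg_nonneg) auto
    finally have "hi.G x t \<le> lo.G x t + \<kappa> S * t powr S"
      using r1 by (simp add: double_phase_def \<kappa>_def algebra_simps)
    then have "ennreal (hi.G x t) \<le> ennreal (lo.G x t + \<kappa> S * t powr S)" by (rule ennreal_leI)
    also have "\<dots> = ennreal (lo.G x t) + ennreal (\<kappa> S) * ennreal (t powr S)"
      using \<kappa> lo.G_nonneg[OF x] by (subst ennreal_plus) (auto simp: ennreal_mult)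
    finally show "ennreal (hi.G x \<bar>f x / \<gamma>\<bar>) \<le> ennreal (lo.G x \<bar>f x / \<gamma>\<bar>) + ennreal (\<kappa> S) * ennreal (\<bar>f x / \<gamma>\<bar> powr S)"
      by (simp only: t_def)
  qed
  also have "\<dots> = modular \<Omega> lo.G (\<lambda>x. f x / \<gamma>) + ennreal (\<kappa> S) * (\<integral>\<^sup>+x. ennreal (\<bar>f x / \<gamma>\<bar> powr S) \<partial>lebesgue_on \<Omega>)"
    unfolding modular_def by (subst nn_integral_add, measurable, subst nn_integral_cmult) auto
  also have "\<dots> \<le> 1 + ennreal (\<kappa> S) * ennreal C"
    using lo.luxemburg_le_iff[OF f \<gamma>(1)] \<gamma>(2) C(2) by (intro add_mono mult_left_mono) auto
  also have "\<dots> = ennreal (1 + \<kappa> S * C)" using \<kappa> C(1) by (simp add: ennreal_mult)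
  finally show ?thesis
    using \<kappa> C(1) by (intro hi.luxemburg_le_of_modular_le \<gamma>) auto
qed

lemma
  assumes u: "u \<in> W1 \<Omega> hi.G"
  shows W1_lo: "u \<in> W1 \<Omega> lo.G"
    and L_norm_lo_le: "L_norm \<Omega> lo.G u \<le> (1 + \<eta>) * L_norm \<Omega> hi.G u"
    and grad_norm_lo_le: "grad_norm \<Omega> lo.G u \<le> (1 + \<eta>) * grad_norm \<Omega> hi.G u"
    and W1_norm_lo_le: "W1_norm \<Omega> lo.G u \<le> (1 + \<eta>) * W1_norm \<Omega> hi.G u"
proof -
  note W = hi.W1D[OF u]
  show "u \<in> W1 \<Omega> lo.G" using W finite_modular_lo unfolding W1_def L_space_def by blast
  show L: "L_norm \<Omega> lo.G u \<le> (1 + \<eta>) * L_norm \<Omega> hi.G u"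
    unfolding L_norm_def by (rule luxemburg_lo_le[OF W(1)])
  show g: "grad_norm \<Omega> lo.G u \<le> (1 + \<eta>) * grad_norm \<Omega> hi.G u"
    unfolding grad_norm_def by (rule luxemburg_lo_le[OF W(4)])
  show "W1_norm \<Omega> lo.G u \<le> (1 + \<eta>) * W1_norm \<Omega> hi.G u"
    using L g by (simp add: W1_norm_def distrib_left)
qed

text \<open>The approximating test functions may be kept, since the norm for the smaller exponents
  is dominated by that for the larger ones.\<close>

lemma W0_lo:
  assumes u: "u \<in> W0 \<Omega> hi.G"
  shows "u \<in> W0 \<Omega> lo.G"
  unfolding lo.W0_iff
proof (intro conjI allI impI)
  have uW: "u \<in> W1 \<Omega> hi.G" using u hi.W0_subset_W1 by auto
  then show "u \<in> W1 \<Omega> lo.G" by (rule W1_lo)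
  fix e :: real assume e: "0 < e"
  have pos: "0 < 1 + \<eta>" using \<eta>_nonneg by simp
  then have "0 < e / (1 + \<eta>)" using e by simp
  then obtain \<phi> where \<phi>: "\<phi> \<in> test_functions \<Omega>" "W1_norm \<Omega> hi.G (abs_aefun \<phi> - u) < e / (1 + \<eta>)"
    using u unfolding hi.W0_iff by blast
  have "W1_norm \<Omega> lo.G (abs_aefun \<phi> - u) \<le> (1 + \<eta>) * W1_norm \<Omega> hi.G (abs_aefun \<phi> - u)"
    using uW hi.test_function_in_W1[OF \<phi>(1)] by (intro W1_norm_lo_le hi.W1.diff_mem)
  also have "\<dots> < e" using \<phi>(2) pos by (simp add: pos_less_divide_eq mult.commute)
  finally show "\<exists>\<phi>\<in>test_functions \<Omega>. W1_norm \<Omega> lo.G (abs_aefun \<phi> - u) < e" using \<phi>(1) by blast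
qed

text \<open>The odd map is the inclusion. Gradient norms grow by at most \<open>1 + \<eta>\<close>;
  the point is that the \<open>lo\<close> norm of the functions in \<open>K\<close>, normalized for
  \<open>hi\<close>, is at least \<open>1 - \<epsilon>\<close>.\<close>

lemma eigenvalue_lo_le:
  assumes i: "i = genus \<or> topological_index i"
    and hi_less: "variational_eigenvalue i \<Omega> hi.G m < ereal c"
    and S: "r' \<le> S" "s' \<le> S" "r < S" "s < S"
    and \<epsilon>: "0 < \<epsilon>" "\<epsilon> \<le> 1 / 2" and \<eta>1: "\<eta> \<le> 1" and B: "1 \<le> B" "4 * c \<le> B"
    and C: "0 \<le> C" "\<And>u. u \<in> W0 \<Omega> lo.G \<Longrightarrow> L_norm \<Omega> lo.G u \<le> B \<Longrightarrow> grad_norm \<Omega> lo.G u \<le> B \<Longrightarrow>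
      (\<integral>\<^sup>+x. ennreal (\<bar>rep_aefun u x\<bar> powr S) \<partial>lebesgue_on \<Omega>) \<le> ennreal C"
    and small: "(1 - \<epsilon>) * (1 + \<kappa> S * C) < 1"
  shows "variational_eigenvalue i \<Omega> lo.G m \<le> ereal ((1 + \<eta>) * c / (1 - \<epsilon>))"
proof -
  obtain K where K: "K \<in> W_family i \<Omega> hi.G m" and Kc: "(SUP u\<in>K. ereal (grad_norm \<Omega> hi.G u)) < ereal c"
    using hi_less unfolding variational_eigenvalue_def by (auto simp: INF_less_iff)
  note KF = hi.index_set_W_family[OF K]
  have gc: "grad_norm \<Omega> hi.G u \<le> c" if "u \<in> K" for u
  proof -
    have "ereal (grad_norm \<Omega> hi.G u) \<le> (SUP u\<in>K. ereal (grad_norm \<Omega> hi.G u))" using that by (rule SUP_upper)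
    then show ?thesis using Kc by (metis ereal_less_eq(3) less_imp_le order_trans)
  qed
  have uW: "u \<in> W1 \<Omega> hi.G" "u \<in> W1 \<Omega> lo.G" "u \<in> W0 \<Omega> lo.G" if "u \<in> K" for u
    using that KF(2) hi.W0_subset_W1 W1_lo W0_lo by auto
  obtain u0 where u0: "u0 \<in> K" using KF(1) by (auto simp: index_set_def)
  have c0: "0 \<le> c" using hi.grad_norm_nonneg[OF uW(1)[OF u0]] gc[OF u0] by linarith
  have g1: "0 < 1 - \<epsilon>" using \<epsilon> by simp
  have glo: "grad_norm \<Omega> lo.G u \<le> (1 + \<eta>) * c" if "u \<in> K" for u
    using grad_norm_lo_le[OF uW(1)[OF that]] mult_left_mono[OF gc[OF that], of "1 + \<eta>"] \<eta>_nonneg by linarith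
  have L: "1 - \<epsilon> \<le> L_norm \<Omega> lo.G u" if u: "u \<in> K" for u
  proof (rule ccontr)
    assume "\<not> 1 - \<epsilon> \<le> L_norm \<Omega> lo.G u"
    then have less: "L_norm \<Omega> lo.G u \<le> 1 - \<epsilon>" by simp
    \<comment> \<open>If the \<open>lo\<close> norm of \<open>u\<close> were at most
      \<open>1 - \<epsilon>\<close>, then \<open>v\<close> would lie in the \<open>lo\<close> unit
      ball, where the constant \<open>C\<close> applies.\<close>
    define v where "v = (1 / (1 - \<epsilon>)) *\<^sub>R u"
    have vW: "v \<in> W0 \<Omega> lo.G" unfolding v_def by (intro lo.W0.scale_mem uW u)
    have "L_norm \<Omega> lo.G v \<le> B"
    proof -
      have "L_norm \<Omega> lo.G v = L_norm \<Omega> lo.G u / (1 - \<epsilon>)"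
        unfolding v_def using g1 by (subst lo.L_norm_scaleR[OF uW(2)[OF u]]) auto
      also have "\<dots> \<le> 1" using less g1 by simp
      finally show ?thesis using B by simp
    qed
    \<comment> \<open>The 4 in \<open>4 * c \<le> B\<close> is a product: one factor 2 bounds
      \<open>1 / (1 - \<epsilon>)\<close>, the other \<open>1 + \<eta>\<close>.\<close>
    moreover have "grad_norm \<Omega> lo.G v \<le> B"
    proof -
      have "grad_norm \<Omega> lo.G v = (1 / (1 - \<epsilon>)) * grad_norm \<Omega> lo.G u"
        unfolding v_def using g1 by (subst lo.grad_norm_scaleR[OF uW(2)[OF u]]) auto
      also have "\<dots> \<le> 2 * (2 * c)"
      proof (rule mult_mono)
        show "1 / (1 - \<epsilon>) \<le> 2" using \<epsilon> by (simp add: field_simps)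
        show "grad_norm \<Omega> lo.G u \<le> 2 * c"
          using glo[OF u] mult_right_mono[of "1 + \<eta>" 2 c] \<eta>1 c0 by linarith
      qed (use lo.grad_norm_nonneg[OF uW(2)[OF u]] in auto)
      finally show ?thesis using B by simp
    qed
    ultimately have "(\<integral>\<^sup>+x. ennreal (\<bar>rep_aefun v x\<bar> powr S) \<partial>lebesgue_on \<Omega>) \<le> ennreal C" using C(2) vW by blast
    moreover have "(\<integral>\<^sup>+x. ennreal (\<bar>rep_aefun v x\<bar> powr S) \<partial>lebesgue_on \<Omega>)
        = (\<integral>\<^sup>+x. ennreal (\<bar>rep_aefun u x / (1 - \<epsilon>)\<bar> powr S) \<partial>lebesgue_on \<Omega>)"
      using lo.AE_\<Omega>I[OF rep_aefun_scaleR[of "1 / (1 - \<epsilon>)" u]]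
      by (intro nn_integral_cong_AE) (auto simp: v_def elim: eventually_mono)
    \<comment> \<open>The \<open>hi\<close> norm of \<open>u\<close> would then be below 1 by the
      smallness assumption, although it equals 1.\<close>
    ultimately have "luxemburg \<Omega> hi.G (rep_aefun u) \<le> (1 - \<epsilon>) * (1 + \<kappa> S * C)"
      using less lo.W1D(1)[OF uW(2)[OF u]] C(1) by (intro luxemburg_hi_le[OF _ g1 _ S]) (auto simp: L_norm_def)
    then show False using small KF(3)[OF u] by (simp add: L_norm_def)
  qed
  show ?thesis
  proof (rule eigenvalue_le_of_odd_map[OF hi.double_phase_domain_axioms lo.double_phase_domain_axioms i K, where \<pi> = "\<lambda>u. u"])
    fix u assume u: "u \<in> K"
    show "u \<in> W0 \<Omega> lo.G" by (rule uW(3)[OF u])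
    show "0 < L_norm \<Omega> lo.G u" using L[OF u] g1 by linarith
    have "(1 + \<eta>) * c / (1 - \<epsilon>) * (1 - \<epsilon>) \<le> (1 + \<eta>) * c / (1 - \<epsilon>) * L_norm \<Omega> lo.G u"
      using L[OF u] g1 c0 \<eta>_nonneg by (intro mult_left_mono) auto
    then show "grad_norm \<Omega> lo.G u \<le> (1 + \<eta>) * c / (1 - \<epsilon>) * L_norm \<Omega> lo.G u"
      using glo[OF u] g1 by simp
    fix e :: real assume e: "0 < e"
    have pos: "0 < 1 + \<eta>" using \<eta>_nonneg by simp
    have "W1_norm \<Omega> lo.G (v - u) < e" if v: "v \<in> K" "W1_norm \<Omega> hi.G (v - u) < e / (1 + \<eta>)" for v
    proof -
      have "W1_norm \<Omega> lo.G (v - u) \<le> (1 + \<eta>) * W1_norm \<Omega> hi.G (v - u)"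
        by (intro W1_norm_lo_le hi.W1.diff_mem uW u v)
      also have "\<dots> < e" using v(2) pos by (simp add: pos_less_divide_eq mult.commute)
      finally show ?thesis .
    qed
    then show "\<exists>d>0. \<forall>v\<in>K. W1_norm \<Omega> hi.G (v - u) < d \<longrightarrow> W1_norm \<Omega> lo.G (v - u) < e"
      using e pos by (intro exI[of _ "e / (1 + \<eta>)"]) auto
  qed auto
qed

text \<open>The odd map replaces \<open>u\<close> by its combination of test functions, which lies
  in the \<open>hi\<close> space even if \<open>u\<close> does not. Its \<open>hi\<close> gradient
  norm is controlled by the common bound \<open>M\<close>, and its \<open>hi\<close> norm from below
  by comparison with the \<open>lo\<close> norm.\<close>

lemma eigenvalue_hi_le:
  fixes c :: "'n aefun \<Rightarrow> 'n aefun \<Rightarrow> real"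
  assumes i: "i = genus \<or> topological_index i"
    and K: "K \<in> W_family i \<Omega> lo.G m"
    and S: "r' \<le> S" "s' \<le> S" "r < S" "s < S"
    and F: "finite F" "F \<subseteq> abs_aefun ` test_functions \<Omega>"
    and c_odd: "\<And>f u. u \<in> K \<Longrightarrow> c f (- u) = - c f u"
    and c_cont: "\<And>f u d. u \<in> K \<Longrightarrow> 0 < d \<Longrightarrow> \<exists>\<delta>>0. \<forall>v\<in>K. W1_norm \<Omega> lo.G (v - u) < \<delta> \<longrightarrow> \<bar>c f v - c f u\<bar> < d"
    and close: "\<And>u. u \<in> K \<Longrightarrow> W1_norm \<Omega> lo.G ((\<Sum>f\<in>F. c f u *\<^sub>R f) - u) \<le> \<delta>"
    and M: "\<And>u. u \<in> K \<Longrightarrow> AE x in lebesgue_on \<Omega>. norm (grad \<Omega> (\<Sum>f\<in>F. c f u *\<^sub>R f) x) \<le> M"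
    and c0: "0 \<le> c0" "\<And>u. u \<in> K \<Longrightarrow> grad_norm \<Omega> lo.G u \<le> c0"
    and \<delta>: "0 < \<delta>" "\<delta> < 1"
  shows "variational_eigenvalue i \<Omega> hi.G m
    \<le> ereal ((c0 + \<delta>) * (1 + \<kappa> S * ((M / (c0 + \<delta>)) powr S * measure lebesgue \<Omega>)) * (1 + \<eta>) / (1 - \<delta>))"
proof -
  note KF = lo.index_set_W_family[OF K]
  define \<pi> where "\<pi> u = (\<Sum>f\<in>F. c f u *\<^sub>R f)" for u
  define \<gamma> where "\<gamma> = c0 + \<delta>"
  \<comment> \<open>The integral over the domain of \<open>(M / \<gamma>) powr S\<close>, which
    bounds that of the gradient divided by \<open>\<gamma>\<close>.\<close>
  define C where "C = (M / \<gamma>) powr S * measure lebesgue \<Omega>"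
  have \<gamma>: "0 < \<gamma>" using c0 \<delta> by (simp add: \<gamma>_def)
  have C: "0 \<le> C" by (simp add: C_def)
  have FW: "f \<in> W0 \<Omega> hi.G" if "f \<in> F" for f using that F hi.test_function_in_W0 by auto
  have \<pi>W0: "\<pi> u \<in> W0 \<Omega> hi.G" for u
    unfolding \<pi>_def using FW by (intro subspace_sum[OF hi.subspace_W0] hi.W0.scale_mem) auto
  have \<pi>W: "\<pi> u \<in> W1 \<Omega> hi.G" "\<pi> u \<in> W1 \<Omega> lo.G" for u
    using \<pi>W0[of u] hi.W0_subset_W1 W1_lo by auto
  have KW: "u \<in> W1 \<Omega> lo.G" if "u \<in> K" for u using that KF(2) lo.W0_subset_W1 by auto
  have pos: "0 < 1 + \<eta>" using \<eta>_nonneg by simp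
  \<comment> \<open>Both estimates compare with \<open>u\<close> in the \<open>lo\<close> space,
    where closeness is available. The easy direction of the comparison, from \<open>lo\<close> to
    \<open>hi\<close>, gives the lower bound for the \<open>hi\<close> norm.\<close>
  have L: "1 - \<delta> \<le> (1 + \<eta>) * L_norm \<Omega> hi.G (\<pi> u)" and g: "grad_norm \<Omega> lo.G (\<pi> u) \<le> \<gamma>" if u: "u \<in> K" for u
  proof -
    have d: "\<pi> u - u \<in> W1 \<Omega> lo.G" "u - \<pi> u \<in> W1 \<Omega> lo.G" using KW[OF u] \<pi>W by (auto intro: lo.W1.diff_mem)
    have n: "W1_norm \<Omega> lo.G (\<pi> u - u) \<le> \<delta>" "W1_norm \<Omega> lo.G (u - \<pi> u) \<le> \<delta>"
      using close[OF u] lo.W1.N_commute[OF KW[OF u] \<pi>W(2)[of u]] by (auto simp: \<pi>_def)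
    have "1 \<le> L_norm \<Omega> lo.G (u - \<pi> u) + L_norm \<Omega> lo.G (\<pi> u)"
      using lo.L_norm_triangle[OF d(2) \<pi>W(2)[of u]] KF(3)[OF u] by simp
    then show "1 - \<delta> \<le> (1 + \<eta>) * L_norm \<Omega> hi.G (\<pi> u)"
      using lo.L_norm_le_W1_norm[OF d(2)] n(2) L_norm_lo_le[OF \<pi>W(1)[of u]] by linarith
    show "grad_norm \<Omega> lo.G (\<pi> u) \<le> \<gamma>"
      using lo.grad_norm_triangle[OF d(1) KW[OF u]] c0(2)[OF u] lo.grad_norm_le_W1_norm[OF d(1)] n(1)
      by (simp add: \<gamma>_def)
  qed
  have gh: "grad_norm \<Omega> hi.G (\<pi> u) \<le> \<gamma> * (1 + \<kappa> S * C)" if u: "u \<in> K" for u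
    unfolding grad_norm_def
  proof (rule luxemburg_hi_le[OF lo.W1D(4)[OF \<pi>W(2)] \<gamma> _ S C])
    show "luxemburg \<Omega> lo.G (\<lambda>x. norm (grad \<Omega> (\<pi> u) x)) \<le> \<gamma>" using g[OF u] by (simp add: grad_norm_def)
    have "(\<integral>\<^sup>+x. ennreal (\<bar>norm (grad \<Omega> (\<pi> u) x) / \<gamma>\<bar> powr S) \<partial>lebesgue_on \<Omega>)
        \<le> (\<integral>\<^sup>+x. ennreal ((M / \<gamma>) powr S) \<partial>lebesgue_on \<Omega>)"
    proof (rule nn_integral_mono_AE)
      show "AE x in lebesgue_on \<Omega>. ennreal (\<bar>norm (grad \<Omega> (\<pi> u) x) / \<gamma>\<bar> powr S) \<le> ennreal ((M / \<gamma>) powr S)"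
        using M[OF u]
      proof eventually_elim
        case (elim x)
        then show ?case
          using \<gamma> S lo.r_gt_1 by (intro ennreal_leI powr_mono2) (auto simp: \<pi>_def abs_divide intro!: divide_right_mono)
      qed
    qed
    also have "\<dots> = ennreal C" by (simp add: C_def emeasure_\<Omega> ennreal_mult)
    finally show "(\<integral>\<^sup>+x. ennreal (\<bar>norm (grad \<Omega> (\<pi> u) x) / \<gamma>\<bar> powr S) \<partial>lebesgue_on \<Omega>) \<le> ennreal C" .
  qed
  have D: "0 \<le> \<gamma> * (1 + \<kappa> S * C)"
    using \<gamma> C r_le s_le A(2) S unfolding \<kappa>_def by (intro mult_nonneg_nonneg add_nonneg_nonneg) auto
  have "variational_eigenvalue i \<Omega> hi.G m \<le> ereal (\<gamma> * (1 + \<kappa> S * C) * (1 + \<eta>) / (1 - \<delta>))"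
  proof (rule eigenvalue_le_of_odd_map[OF lo.double_phase_domain_axioms hi.double_phase_domain_axioms i K, where \<pi> = \<pi>])
    fix u assume u: "u \<in> K"
    show "\<pi> u \<in> W0 \<Omega> hi.G" by (rule \<pi>W0)
    show "\<pi> (- u) = - \<pi> u" using c_odd[OF u] by (simp add: \<pi>_def sum_negf)
    show "0 < L_norm \<Omega> hi.G (\<pi> u)"
      using L[OF u] \<delta> pos by (smt (verit) mult_nonneg_nonpos)
    have "1 \<le> (1 + \<eta>) / (1 - \<delta>) * L_norm \<Omega> hi.G (\<pi> u)" using L[OF u] \<delta> by (simp add: field_simps)
    from mult_left_mono[OF this D] gh[OF u]
    show "grad_norm \<Omega> hi.G (\<pi> u) \<le> \<gamma> * (1 + \<kappa> S * C) * (1 + \<eta>) / (1 - \<delta>) * L_norm \<Omega> hi.G (\<pi> u)" by simp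
  next
    fix u and e :: real assume u: "u \<in> K" and e: "0 < e"
    define T where "T = (\<Sum>f\<in>F. W1_norm \<Omega> hi.G f)"
    have T: "0 \<le> T" unfolding T_def using FW by (intro sum_nonneg hi.W0.N_nonneg)
    have e': "0 < e / (T + 1)" using e T by simp
    \<comment> \<open>The divisor is \<open>T + 1\<close> because \<open>T\<close> may be 0; the
      errors of the coefficients are weighted by the \<open>hi\<close> norms of the finitely many
      \<open>f\<close>.\<close>
    obtain D where D: "\<And>f. f \<in> F \<Longrightarrow> 0 < D f"
      "\<And>f v. f \<in> F \<Longrightarrow> v \<in> K \<Longrightarrow> W1_norm \<Omega> lo.G (v - u) < D f \<Longrightarrow> \<bar>c f v - c f u\<bar> < e / (T + 1)"
      using c_cont[OF u e'] by metis
    \<comment> \<open>The entry 1 keeps the minimum defined when \<open>F\<close> is empty.\<close>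
    define d where "d = Min (insert 1 (D ` F))"
    have d: "0 < d" "\<And>f. f \<in> F \<Longrightarrow> d \<le> D f" using F(1) D(1) by (auto simp: d_def)
    have "W1_norm \<Omega> hi.G (\<pi> v - \<pi> u) < e" if v: "v \<in> K" "W1_norm \<Omega> lo.G (v - u) < d" for v
    proof -
      have "\<pi> v - \<pi> u = (\<Sum>f\<in>F. (c f v - c f u) *\<^sub>R f)"
        by (simp add: \<pi>_def scaleR_diff_left sum_subtractf)
      then have "W1_norm \<Omega> hi.G (\<pi> v - \<pi> u) \<le> (\<Sum>f\<in>F. W1_norm \<Omega> hi.G ((c f v - c f u) *\<^sub>R f))"
        using F(1) FW by (simp only:) (intro hi.W0.N_sum_le hi.W0.scale_mem, auto)
      also have "\<dots> \<le> (\<Sum>f\<in>F. e / (T + 1) * W1_norm \<Omega> hi.G f)"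
      proof (rule sum_mono)
        fix f assume f: "f \<in> F"
        have "\<bar>c f v - c f u\<bar> \<le> e / (T + 1)" using D(2)[OF f v(1)] v(2) d(2)[OF f] by linarith
        then show "W1_norm \<Omega> hi.G ((c f v - c f u) *\<^sub>R f) \<le> e / (T + 1) * W1_norm \<Omega> hi.G f"
          using hi.W0.N_nonneg[OF FW[OF f]] by (simp only: hi.W0.N_scaleR[OF FW[OF f]]) (rule mult_right_mono)
      qed
      also have "\<dots> = e / (T + 1) * T" by (simp add: T_def sum_distrib_left)
      also have "\<dots> < e" using e T by (simp add: field_simps)
      finally show ?thesis .
    qed
    then show "\<exists>d>0. \<forall>v\<in>K. W1_norm \<Omega> lo.G (v - u) < d \<longrightarrow> W1_norm \<Omega> hi.G (\<pi> v - \<pi> u) < e"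
      using d(1) by blast
  qed
  then show ?thesis by (simp only: \<gamma>_def C_def)
qed

end

theorem theorem1p3:
  fixes \<Omega> :: "(real ^ 'n::finite) set"
    and a :: "real ^ 'n \<Rightarrow> real"
    and p q :: real
    and ph qh :: "nat \<Rightarrow> real"
    and i :: "'n aefun topology \<Rightarrow> 'n aefun set \<Rightarrow> enat"
    and m :: nat
  assumes "1 < p" and "p < q" and "q < real CARD('n)"
    and "open \<Omega>" and "connected \<Omega>" and "\<Omega> \<noteq> {}" and "bounded \<Omega>"
    and "q / p < 1 + 1 / real CARD('n)"
    and "lipschitz_boundary \<Omega>"
    and "\<forall>x \<in> closure \<Omega>. 0 \<le> a x"
    and "\<exists>L. L-lipschitz_on (closure \<Omega>) a"
    and "exponents_decrease_to (real CARD('n)) ph qh p q"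
    and "i = genus \<or> topological_index i"
    and "1 \<le> m"
  shows "(\<lambda>h. variational_eigenvalue i \<Omega> (double_phase a (ph h) (qh h)) m)
           \<longlonglongrightarrow> variational_eigenvalue i \<Omega> (double_phase a p q) m"
proof -
  let ?n = "real CARD('n)"
  let ?ev = "\<lambda>h. variational_eigenvalue i \<Omega> (double_phase a (ph h) (qh h)) m"
  let ?lim = "variational_eigenvalue i \<Omega> (double_phase a p q) m"
  note p = assms(1) and pq = assms(2) and \<Omega> = assms(4,7) and i = assms(13)
  have exps: "ph h < qh h" "decseq ph" "decseq qh" "ph \<longlonglongrightarrow> p" "qh \<longlonglongrightarrow> q" for h
    using assms(12) by (auto simp: exponents_decrease_to_def)
  have ph: "p \<le> ph h" and qh: "q \<le> qh h" for h
    using decseq_ge[OF exps(2,4)] decseq_ge[OF exps(3,5)] by auto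
  have cont: "continuous_on (closure \<Omega>) a" using assms(11) lipschitz_on_continuous_on by blast
  have cpt: "compact (closure \<Omega>)" using \<Omega>(2) by simp
  have "bdd_above (a ` closure \<Omega>)"
    by (intro bounded_imp_bdd_above compact_imp_bounded compact_continuous_image cont cpt)
  then obtain A' where A': "\<And>x. x \<in> closure \<Omega> \<Longrightarrow> a x \<le> A'" by (auto simp: bdd_above_def)
  define A where "A = max 0 A'"
  have A: "\<And>x. x \<in> \<Omega> \<Longrightarrow> a x \<le> A" "0 \<le> A" using A' closure_subset[of \<Omega>] by (force simp: A_def)+
  have a0: "0 \<le> a x" if "x \<in> \<Omega>" for x using assms(10) closure_subset[of \<Omega>] that by auto
  have am: "a \<in> borel_measurable (lebesgue_on \<Omega>)"
    using cont \<Omega>(1) closure_subset[of \<Omega>]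
    by (intro continuous_imp_measurable_on_sets_lebesgue) (auto intro: continuous_on_subset)
  have dom: "double_phase_domain \<Omega> a r s" if "1 < r" "r < s" for r s
    using that \<Omega> a0 am A(1) by unfold_locales auto
  have pair: "double_phase_pair \<Omega> a p q (ph h) (qh h) A" for h
    unfolding double_phase_pair_def double_phase_pair_axioms_def
    using dom[OF p pq] dom[of "ph h" "qh h"] ph[of h] qh[of h] p exps(1)[of h] A by auto
  interpret lo: double_phase_domain \<Omega> a p q by (rule dom[OF p pq])

  have "q < p + p * p / ?n"
  proof -
    have "q < p + p / ?n" using assms(8) p by (simp add: field_simps)
    also have "p / ?n \<le> p * p / ?n" using p by (intro divide_right_mono) auto
    finally show ?thesis by simp
  qed
  \<comment> \<open>A single \<open>S\<close> for the whole proof: above \<open>q\<close>, so that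
    it eventually exceeds all \<open>qh h\<close>, and below the range limit of the Sobolev
    inequality.\<close>
  then obtain S where S: "q < S" "S < p + p * p / ?n" using dense by blast
  have evS: "\<forall>\<^sub>F h in sequentially. qh h < S" by (rule order_tendstoD(2)[OF exps(5) S(1)])

  define \<eta> where "\<eta> h = ((1 - p / ph h) + A * (1 - q / qh h)) * measure lebesgue \<Omega>" for h
  define \<kappa> where "\<kappa> h = (ph h - p) / (S - p) + A * ((qh h - q) / (S - q))" for h
  have \<eta>_eq: "double_phase_pair.\<eta> \<Omega> p q (ph h) (qh h) A = \<eta> h"
    and \<kappa>_eq: "double_phase_pair.\<kappa> p q (ph h) (qh h) A S = \<kappa> h" for h
    using double_phase_pair.\<eta>_def[OF pair] double_phase_pair.\<kappa>_def[OF pair] by (auto simp: \<eta>_def \<kappa>_def)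
  have "\<eta> \<longlonglongrightarrow> ((1 - p / p) + A * (1 - q / q)) * measure lebesgue \<Omega>"
    unfolding \<eta>_def using p pq by (intro tendsto_intros exps) auto
  then have \<eta>0: "\<eta> \<longlonglongrightarrow> 0" using p pq by simp
  have "\<kappa> \<longlonglongrightarrow> (p - p) / (S - p) + A * ((q - q) / (S - q))"
    unfolding \<kappa>_def using S pq by (intro tendsto_intros exps) auto
  then have \<kappa>0: "\<kappa> \<longlonglongrightarrow> 0" by simp

  show ?thesis
  proof (rule order_tendstoI)
    fix b assume "b < ?lim"
    \<comment> \<open>The gap between \<open>c\<close> and \<open>c'\<close> absorbs the factor
      \<open>(1 + \<eta> h) / (1 - \<epsilon>)\<close> lost in the comparison.\<close>
    then obtain c c' where c: "b < ereal c" "ereal c < ereal c'" "ereal c' < ?lim"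
      by (meson ereal_dense2)
    have cc: "c < c'" using c by simp
    have "((\<lambda>\<epsilon>. c / (1 - \<epsilon>)) \<longlongrightarrow> c / (1 - 0)) (at_right 0)" by (intro tendsto_intros) auto
    then have "\<forall>\<^sub>F \<epsilon> in at_right 0. c / (1 - \<epsilon>) < c'" using cc by (intro order_tendstoD(2)) auto
    moreover have "\<forall>\<^sub>F \<epsilon> in at_right (0::real). 0 < \<epsilon> \<and> \<epsilon> \<le> 1 / 2"
      unfolding eventually_at_right_field by (intro exI[of _ "1 / 2"]) auto
    ultimately have "\<forall>\<^sub>F \<epsilon> in at_right 0. c / (1 - \<epsilon>) < c' \<and> 0 < \<epsilon> \<and> \<epsilon> \<le> 1 / 2" by eventually_elim auto
    then obtain \<epsilon> where \<epsilon>: "c / (1 - \<epsilon>) < c'" "0 < \<epsilon>" "\<epsilon> \<le> 1 / 2"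
      using eventually_happens trivial_limit_at_right_real by blast
    \<comment> \<open>The absolute value and the 1 secure both \<open>4 * c \<le> B\<close> and
      \<open>1 \<le> B\<close>, whatever the sign of \<open>c\<close>.\<close>
    define B where "B = 4 * \<bar>c\<bar> + 1"
    have B: "0 < B" "1 \<le> B" "4 * c \<le> B" by (auto simp: B_def)
    have pS: "p \<le> S" using S pq by simp
    \<comment> \<open>\<open>C\<close> depends on the limit exponents and \<open>B\<close> but not
      on \<open>h\<close>, so \<open>\<kappa> h * C\<close> tends to 0.\<close>
    obtain C where C: "0 \<le> C" "\<And>u. u \<in> W0 \<Omega> lo.G \<Longrightarrow> L_norm \<Omega> lo.G u \<le> B \<Longrightarrow> grad_norm \<Omega> lo.G u \<le> B \<Longrightarrow>
        (\<integral>\<^sup>+x. ennreal (\<bar>rep_aefun u x\<bar> powr S) \<partial>lebesgue_on \<Omega>) \<le> ennreal C"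
      by (rule lo.sobolev_W0[OF pS S(2) B(1)]) (rule that)
    have "(\<lambda>h. (1 + \<eta> h) * c / (1 - \<epsilon>)) \<longlonglongrightarrow> (1 + 0) * c / (1 - \<epsilon>)"
      using \<epsilon> by (intro tendsto_intros \<eta>0) auto
    then have e1: "\<forall>\<^sub>F h in sequentially. (1 + \<eta> h) * c / (1 - \<epsilon>) < c'"
      using \<epsilon>(1) by (intro order_tendstoD(2)) auto
    have "(\<lambda>h. (1 - \<epsilon>) * (1 + \<kappa> h * C)) \<longlonglongrightarrow> (1 - \<epsilon>) * (1 + 0 * C)" by (intro tendsto_intros \<kappa>0)
    then have e2: "\<forall>\<^sub>F h in sequentially. (1 - \<epsilon>) * (1 + \<kappa> h * C) < 1"
      using \<epsilon>(2) by (intro order_tendstoD(2)) auto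
    have e3: "\<forall>\<^sub>F h in sequentially. \<eta> h < 1" by (rule order_tendstoD(2)[OF \<eta>0]) simp
    show "\<forall>\<^sub>F h in sequentially. b < ?ev h"
      using e1 e2 e3 evS
    proof eventually_elim
      case (elim h)
      interpret pr: double_phase_pair \<Omega> a p q "ph h" "qh h" A by (rule pair)
      \<comment> \<open>A smaller eigenvalue for \<open>h\<close> would be carried over to the limit
        integrand and push the limit eigenvalue below \<open>c'\<close>.\<close>
      have "\<not> ?ev h < ereal c"
      proof
        assume "?ev h < ereal c"
        then have "?lim \<le> ereal ((1 + \<eta> h) * c / (1 - \<epsilon>))"
          using elim exps(1)[of h] S(1) pq \<epsilon> B C
          unfolding \<eta>_eq[symmetric] \<kappa>_eq[symmetric] by (intro pr.eigenvalue_lo_le[OF i, where S = S and C = C and B = B]) auto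
        also have "\<dots> < ereal c'" using elim by simp
        finally show False using c(3) by simp
      qed
      then show ?case using c(1) by simp
    qed
  next
    fix b assume "?lim < b"
    then obtain c where c: "?lim < ereal c" "ereal c < b" by (meson ereal_dense2)
    then obtain K where K: "K \<in> W_family i \<Omega> lo.G m" and Kc: "(SUP u\<in>K. ereal (grad_norm \<Omega> lo.G u)) < ereal c"
      unfolding variational_eigenvalue_def by (auto simp: INF_less_iff)
    \<comment> \<open>A strict intermediate value, leaving room for the approximation error
      \<open>\<delta>\<close> in numerator and denominator.\<close>
    obtain c0 where c0: "(SUP u\<in>K. ereal (grad_norm \<Omega> lo.G u)) < ereal c0" "ereal c0 < ereal c"
      using ereal_dense2[OF Kc] by blast
    note KF = lo.index_set_W_family[OF K]
    have gK: "grad_norm \<Omega> lo.G u \<le> c0" if "u \<in> K" for u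
    proof -
      have "ereal (grad_norm \<Omega> lo.G u) \<le> (SUP u\<in>K. ereal (grad_norm \<Omega> lo.G u))" using that by (rule SUP_upper)
      then show ?thesis using c0(1) by (metis ereal_less_eq(3) less_imp_le order_trans)
    qed
    obtain u0 where u0: "u0 \<in> K" using KF(1) by (auto simp: index_set_def)
    have c00: "0 \<le> c0"
      using lo.grad_norm_nonneg[of u0] gK[OF u0] u0 KF(2) lo.W0_subset_W1 by force
    have "((\<lambda>\<delta>. (c0 + \<delta>) / (1 - \<delta>)) \<longlongrightarrow> (c0 + 0) / (1 - 0)) (at_right 0)" by (intro tendsto_intros) auto
    then have "\<forall>\<^sub>F \<delta> in at_right 0. (c0 + \<delta>) / (1 - \<delta>) < c" using c0(2) by (intro order_tendstoD(2)) auto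
    moreover have "\<forall>\<^sub>F \<delta> in at_right (0::real). 0 < \<delta> \<and> \<delta> < 1"
      unfolding eventually_at_right_field by (intro exI[of _ 1]) auto
    ultimately have "\<forall>\<^sub>F \<delta> in at_right 0. (c0 + \<delta>) / (1 - \<delta>) < c \<and> 0 < \<delta> \<and> \<delta> < 1" by eventually_elim auto
    then obtain \<delta> where \<delta>: "(c0 + \<delta>) / (1 - \<delta>) < c" "0 < \<delta>" "\<delta> < 1"
      using eventually_happens trivial_limit_at_right_real by blast
    have cK: "compactin (norm_topology (W0 \<Omega> lo.G) (W1_norm \<Omega> lo.G)) K" and symK: "uminus ` K = K"
      using KF(1) by (auto simp: index_set_def W0_topology_def)
    have TW: "abs_aefun ` test_functions \<Omega> \<subseteq> W0 \<Omega> lo.G" using lo.test_function_in_W0 by auto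
    have dense: "\<exists>v\<in>abs_aefun ` test_functions \<Omega>. W1_norm \<Omega> lo.G (v - u) < e" if "u \<in> W0 \<Omega> lo.G" "0 < e" for u e
      using that unfolding lo.W0_iff by auto
    obtain F cf where F: "finite F" "F \<subseteq> abs_aefun ` test_functions \<Omega>"
      and cf: "\<And>f u. u \<in> K \<Longrightarrow> cf f (- u) = - cf f u" "\<And>f u. u \<in> K \<Longrightarrow> \<bar>cf f u\<bar> \<le> (1::real)"
        "\<And>f u d. u \<in> K \<Longrightarrow> 0 < d \<Longrightarrow> \<exists>\<delta>>0. \<forall>v\<in>K. W1_norm \<Omega> lo.G (v - u) < \<delta> \<longrightarrow> \<bar>cf f v - cf f u\<bar> < d"
        "\<And>u. u \<in> K \<Longrightarrow> W1_norm \<Omega> lo.G ((\<Sum>f\<in>F. cf f u *\<^sub>R f) - u) \<le> \<delta>"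
      by (rule lo.W0.odd_finite_rank_approximation[OF cK symK TW dense \<delta>(2)]) (assumption, assumption, rule that)
    \<comment> \<open>\<open>F\<close> and with it \<open>M\<close> are fixed by \<open>K\<close>
      and \<open>\<delta>\<close> before \<open>h\<close> varies, so the constant built from
      \<open>M\<close> below is harmless as \<open>\<kappa> h\<close> tends to 0.\<close>
    obtain M where M: "\<And>c. (\<forall>f\<in>F. \<bar>c f\<bar> \<le> 1) \<Longrightarrow> (AE x in lebesgue_on \<Omega>. norm (grad \<Omega> (\<Sum>f\<in>F. c f *\<^sub>R f) x) \<le> M)"
      using lo.test_span_gradient_bound[OF F] by blast
    have MK: "AE x in lebesgue_on \<Omega>. norm (grad \<Omega> (\<Sum>f\<in>F. cf f u *\<^sub>R f) x) \<le> M" if "u \<in> K" for u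
      using M[of "\<lambda>f. cf f u"] cf(2)[OF that] by blast
    define C where "C = (M / (c0 + \<delta>)) powr S * measure lebesgue \<Omega>"
    have "(\<lambda>h. (c0 + \<delta>) * (1 + \<kappa> h * C) * (1 + \<eta> h) / (1 - \<delta>)) \<longlonglongrightarrow> (c0 + \<delta>) * (1 + 0 * C) * (1 + 0) / (1 - \<delta>)"
      using \<delta> by (intro tendsto_intros \<eta>0 \<kappa>0) auto
    then have e1: "\<forall>\<^sub>F h in sequentially. (c0 + \<delta>) * (1 + \<kappa> h * C) * (1 + \<eta> h) / (1 - \<delta>) < c"
      using \<delta>(1) by (intro order_tendstoD(2)) auto
    show "\<forall>\<^sub>F h in sequentially. ?ev h < b"
      using e1 evS
    proof eventually_elim
      case (elim h)
      interpret pr: double_phase_pair \<Omega> a p q "ph h" "qh h" A by (rule pair)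
      have SS: "ph h \<le> S" "qh h \<le> S" "p < S" "q < S" using elim exps(1)[of h] S(1) pq by auto
      have "?ev h \<le> ereal ((c0 + \<delta>) * (1 + \<kappa> h * C) * (1 + \<eta> h) / (1 - \<delta>))"
        using pr.eigenvalue_hi_le[OF i K SS F cf(1,3,4) MK c00 gK \<delta>(2,3)]
        by (simp only: \<eta>_eq \<kappa>_eq C_def)
      also have "\<dots> < ereal c" using elim by simp
      finally show ?case using c(2) by (rule less_trans)
    qed
  qed
qed

end
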